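(* Let $X_{\Sigma}$ be a smooth complete toric variety of dimension $n$ over $\mathbb{C}$ which satisfies the affine codimension condition. Let $R=\mathbb{C}[x_{\rho_1},\dots,x_{\rho_m}]$ be its total coordinate ring, let $\mathfrak{p}=\{\mathbf{p_1},\dots,\mathbf{p_\nu}\}$ be the set of all primitive collections of rays in $\Sigma(1)=\{\rho_1,\dots,\rho_m\}$, and let $V=V(I)$ be any (reduced) dimension zero subscheme of $X_{\Sigma}$, defined by a homogeneous ideal $I$ of $R$. Then the number of points in $V\subset X_{\Sigma}$ is equal to the number of points in the affine set $V(I)\cap V(L_A(\Lambda))\subset\mathbb{C}^m$, where $$L_A(\Lambda)=\left(\sum_{\rho_j\in\mathbf{p_1}}\lambda_j^{(1)}x_{\rho_j}-1,\ \dots,\ \sum_{\rho_j\in\mathbf{p_\nu}}\lambda_j^{(\nu)}x_{\rho_j}-1\right)$$ for general $\lambda_j^{(l)}\in\mathbb{C}^*$, and $\Lambda$ denotes the collection of all $\lambda_j^{(l)}$. In other words, $L_A(\Lambda)$ is a general dehomogenizing ideal for $X_{\Sigma}$.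
   Context: $R$ is the Cox ring of $X_\Sigma$, with one variable for each ray of the fan $\Sigma$, graded by $A^1(X_\Sigma)$ via $\deg(\mathsf{x})=[V(\mathsf{x})]$ for monomials; "homogeneous" is with respect to this grading. A homogeneous ideal $I$ defines a subscheme $V(I)\subset X_\Sigma$, and, forgetting the grading, a subscheme $V(I)\subset\mathbb{C}^m=\mathrm{Spec}(\mathbb{C}[x_{\rho_1},\dots,x_{\rho_m}])$. A set of rays $\{\rho_{i_1},\dots,\rho_{i_s}\}\subset\Sigma(1)$ is a primitive collection if its ray generators do not all lie in any single cone $\sigma\in\Sigma$ but every proper subset does. The irrelevant ideal is $B=\bigcap_{\{\rho_{i_1},\dots,\rho_{i_s}\}\in\mathfrak{p}}(x_{\rho_{i_1}},\dots,x_{\rho_{i_s}})$. $X_\Sigma$ satisfies the affine codimension condition if the number $\nu$ of primitive collections of $\Sigma$ equals $m-n$, where $m=|\Sigma(1)|$ and $n=\dim X_\Sigma$. For a reduced zero dimensional subscheme $W=V(J)$ of $X_\Sigma$ consisting of $q$ points, an ideal $L$ of the ungraded polynomial ring is a dehomogenizing ideal for $W$ if $V(J)\cap V(L)\subset\mathbb{C}^m$ contains $q$ points. An ideal $L_A(\Lambda)$ depending on scalars $\Lambda$ is a general dehomogenizing ideal for $X_\Sigma$ if, for every reduced zero dimensional subscheme $W$ of $X_\Sigma$, it is a dehomogenizing ideal for $W$ for a general choice of $\Lambda$. "General" means for all choices of scalars in some nonempty Zariski open (dense) set, which may depend on $W$. *)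

theory Defs
  imports "HOL-Analysis.Analysis" "HOL-Library.Poly_Mapping"
begin

section \<open>Fans\<close>

text \<open>
  The lattice \<open>N\<close> is \<open>\<int>\<^sup>n\<close> inside \<open>N\<^sub>\<real> = \<real>\<^sup>n\<close>, with \<open>n = CARD('n)\<close>. The dual lattice \<open>M\<close> is also
  identified with \<open>\<int>\<^sup>n\<close>; the pairing of \<open>M\<close> and \<open>N\<close> is the standard inner product.
\<close>

definition lattice_points :: "(real ^ 'n) set" where
  "lattice_points = {v. \<forall>i. v $ i \<in> \<int>}"

definition strongly_convex_rational_cone :: "(real ^ 'n) set \<Rightarrow> bool" where
  "strongly_convex_rational_cone \<sigma> \<longleftrightarrow>
     (\<exists>S. finite S \<and> S \<subseteq> lattice_points \<and> \<sigma> = convex_cone hull S) \<and>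
     \<sigma> \<inter> uminus ` \<sigma> = {0}"

text \<open>The library counts the empty set among the faces of a convex set; a face of a cone is nonempty.\<close>

definition cone_face :: "(real ^ 'n) set \<Rightarrow> (real ^ 'n) set \<Rightarrow> bool" where
  "cone_face \<tau> \<sigma> \<longleftrightarrow> \<tau> face_of \<sigma> \<and> \<tau> \<noteq> {}"

definition fan :: "(real ^ 'n) set set \<Rightarrow> bool" where
  "fan \<Sigma> \<longleftrightarrow>
     finite \<Sigma> \<and> \<Sigma> \<noteq> {} \<and>
     (\<forall>\<sigma>\<in>\<Sigma>. strongly_convex_rational_cone \<sigma>) \<and>
     (\<forall>\<sigma>\<in>\<Sigma>. \<forall>\<tau>. cone_face \<tau> \<sigma> \<longrightarrow> \<tau> \<in> \<Sigma>) \<and>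
     (\<forall>\<sigma>\<in>\<Sigma>. \<forall>\<sigma>'\<in>\<Sigma>. cone_face (\<sigma> \<inter> \<sigma>') \<sigma> \<and> cone_face (\<sigma> \<inter> \<sigma>') \<sigma>')"

definition rays :: "(real ^ 'n) set set \<Rightarrow> (real ^ 'n) set set" where
  "rays \<Sigma> = {\<rho> \<in> \<Sigma>. dim \<rho> = 1}"

text \<open>The ray generator of \<open>\<rho>\<close> is the unique generator of the semigroup \<open>\<rho> \<inter> N\<close>.\<close>

definition ray_gen :: "(real ^ 'n) set \<Rightarrow> real ^ 'n" where
  "ray_gen \<rho> = (THE u. u \<in> \<rho> \<inter> lattice_points \<and> u \<noteq> 0 \<and>
     (\<forall>v \<in> \<rho> \<inter> lattice_points. \<exists>k::nat. v = of_nat k *\<^sub>R u))"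

definition lattice_basis :: "(real ^ 'n) set \<Rightarrow> bool" where
  "lattice_basis B \<longleftrightarrow> finite B \<and> B \<subseteq> lattice_points \<and>
     (\<forall>v \<in> lattice_points. \<exists>!k :: real ^ 'n \<Rightarrow> int.
        (\<forall>b. b \<notin> B \<longrightarrow> k b = 0) \<and> v = (\<Sum>b\<in>B. of_int (k b) *\<^sub>R b))"

text \<open>
  The toric variety of a fan is smooth iff every cone is generated by part of a basis of \<open>N\<close>, and
  complete iff the fan covers \<open>N\<^sub>\<real>\<close>.
\<close>

definition smooth_fan :: "(real ^ 'n) set set \<Rightarrow> bool" where
  "smooth_fan \<Sigma> \<longleftrightarrow>
     (\<forall>\<sigma>\<in>\<Sigma>. \<exists>B. lattice_basis B \<and> ray_gen ` {\<rho> \<in> rays \<Sigma>. cone_face \<rho> \<sigma>} \<subseteq> B)"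

definition complete_fan :: "(real ^ 'n) set set \<Rightarrow> bool" where
  "complete_fan \<Sigma> \<longleftrightarrow> \<Union>\<Sigma> = UNIV"

text \<open>
  From here on \<open>\<rho> :: 'm \<Rightarrow> (real ^ 'n) set\<close> is an enumeration of the rays,
  \<open>\<Sigma>(1) = {\<rho>\<^sub>1, \<dots>, \<rho>\<^sub>m}\<close> with \<open>m = CARD('m)\<close>; sets of rays are sets of indices.
\<close>

definition primitive_collections :: "(real ^ 'n) set set \<Rightarrow> ('m \<Rightarrow> (real ^ 'n) set) \<Rightarrow> 'm set set" where
  "primitive_collections \<Sigma> \<rho> =
     {P. \<not> (\<exists>\<sigma>\<in>\<Sigma>. (\<lambda>j. ray_gen (\<rho> j)) ` P \<subseteq> \<sigma>) \<and>
         (\<forall>Q. Q \<subset> P \<longrightarrow> (\<exists>\<sigma>\<in>\<Sigma>. (\<lambda>j. ray_gen (\<rho> j)) ` Q \<subseteq> \<sigma>))}"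

definition affine_codimension_condition ::
    "(real ^ 'n) set set \<Rightarrow> ('m::finite \<Rightarrow> (real ^ 'n) set) \<Rightarrow> bool" where
  "affine_codimension_condition \<Sigma> \<rho> \<longleftrightarrow>
     int (card (primitive_collections \<Sigma> \<rho>)) = int CARD('m) - int CARD('n)"


section \<open>Polynomials and affine vanishing sets\<close>

text \<open>\<open>'k mpoly\<close> is the ring \<open>\<complex>[x\<^sub>k | k :: 'k]\<close>, as the monoid algebra of the exponent vectors.\<close>

type_synonym 'k mpoly = "('k \<Rightarrow>\<^sub>0 nat) \<Rightarrow>\<^sub>0 complex"

definition var :: "'k \<Rightarrow> 'k mpoly" where
  "var k = Poly_Mapping.single (Poly_Mapping.single k 1) 1"

definition const :: "complex \<Rightarrow> 'k mpoly" where
  "const c = Poly_Mapping.single 0 c"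

definition eval_poly :: "'k::finite mpoly \<Rightarrow> ('k \<Rightarrow> complex) \<Rightarrow> complex" where
  "eval_poly f x =
     (\<Sum>a\<in>Poly_Mapping.keys f. Poly_Mapping.lookup f a * (\<Prod>k\<in>UNIV. x k ^ Poly_Mapping.lookup a k))"

text \<open>Ideals of a commutative ring, viewed as the submodules of the ring over itself.\<close>

interpretation ideal: module "(*) :: 'a::comm_ring_1 \<Rightarrow> 'a \<Rightarrow> 'a"
  by unfold_locales (simp_all add: algebra_simps)

abbreviation is_ideal :: "'a::comm_ring_1 set \<Rightarrow> bool" where
  "is_ideal \<equiv> module.subspace (*)"

abbreviation ideal_generated :: "'a::comm_ring_1 set \<Rightarrow> 'a set" where
  "ideal_generated \<equiv> module.span (*)"

definition affine_V :: "'k::finite mpoly set \<Rightarrow> ('k \<Rightarrow> complex) set" where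
  "affine_V I = {x. \<forall>f\<in>I. eval_poly f x = 0}"

definition irrelevant_ideal ::
    "(real ^ 'n) set set \<Rightarrow> ('m::finite \<Rightarrow> (real ^ 'n) set) \<Rightarrow> 'm mpoly set" where
  "irrelevant_ideal \<Sigma> \<rho> = (\<Inter>P \<in> primitive_collections \<Sigma> \<rho>. ideal_generated (var ` P))"


section \<open>The grading of the Cox ring\<close>

text \<open>
  \<open>A\<^sup>1(X\<^sub>\<Sigma>)\<close> is the group \<open>\<int>\<^bsup>\<Sigma>(1)\<^esup>\<close> of torus-invariant divisors \<open>\<Sum>\<^sub>j a\<^sub>j D\<^sub>j\<close> modulo the principal ones,
  \<open>div(\<chi>\<^sup>w) = \<Sum>\<^sub>j \<langle>w, u\<^sub>j\<rangle> D\<^sub>j\<close> for \<open>w \<in> M\<close>, where \<open>u\<^sub>j\<close> is the generator of \<open>\<rho>\<^sub>j\<close>; its elements are the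
  classes of the relation below. A monomial \<open>x\<^sup>a\<close> has degree \<open>[V(x\<^sup>a)] = [\<Sum>\<^sub>j a\<^sub>j D\<^sub>j]\<close>.
\<close>

definition lin_equiv :: "('m \<Rightarrow> (real ^ 'n) set) \<Rightarrow> (('m \<Rightarrow> int) \<times> ('m \<Rightarrow> int)) set" where
  "lin_equiv \<rho> = {(a, b). \<exists>w\<in>lattice_points. \<forall>j. of_int (a j - b j) = w \<bullet> ray_gen (\<rho> j)}"

definition monomial_degree :: "('m \<Rightarrow> (real ^ 'n) set) \<Rightarrow> ('m \<Rightarrow>\<^sub>0 nat) \<Rightarrow> ('m \<Rightarrow> int) set" where
  "monomial_degree \<rho> a = lin_equiv \<rho> `` {\<lambda>j. int (Poly_Mapping.lookup a j)}"

definition homogeneous_of_degree ::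
    "('m \<Rightarrow> (real ^ 'n) set) \<Rightarrow> ('m \<Rightarrow> int) set \<Rightarrow> 'm mpoly \<Rightarrow> bool" where
  "homogeneous_of_degree \<rho> d f \<longleftrightarrow> (\<forall>a\<in>Poly_Mapping.keys f. monomial_degree \<rho> a = d)"

definition homogeneous_ideal :: "('m \<Rightarrow> (real ^ 'n) set) \<Rightarrow> 'm mpoly set \<Rightarrow> bool" where
  "homogeneous_ideal \<rho> I \<longleftrightarrow>
     (\<exists>S. (\<forall>f\<in>S. \<exists>d. homogeneous_of_degree \<rho> d f) \<and> I = ideal_generated S)"


section \<open>The toric variety and its subschemes\<close>

text \<open>
  For a smooth fan, \<open>X\<^sub>\<Sigma>\<close> is the geometric quotient \<open>(\<complex>\<^sup>m - V(B)) / G\<close>, where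
  \<open>G = Hom(A\<^sup>1(X\<^sub>\<Sigma>), \<complex>\<^sup>*)\<close> is the subgroup of \<open>(\<complex>\<^sup>*)\<^sup>m\<close> below, acting coordinatewise. The floor only
  turns the integer \<open>\<langle>w, u\<^sub>j\<rangle>\<close> into an exponent of type \<open>int\<close>.
\<close>

definition cox_group :: "('m::finite \<Rightarrow> (real ^ 'n) set) \<Rightarrow> ('m \<Rightarrow> complex) set" where
  "cox_group \<rho> =
     {t. (\<forall>j. t j \<noteq> 0) \<and> (\<forall>w\<in>lattice_points. (\<Prod>j\<in>UNIV. t j powi \<lfloor>w \<bullet> ray_gen (\<rho> j)\<rfloor>) = 1)}"

definition orbit_rel ::
    "('m::finite \<Rightarrow> (real ^ 'n) set) \<Rightarrow> (('m \<Rightarrow> complex) \<times> ('m \<Rightarrow> complex)) set" where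
  "orbit_rel \<rho> = {(x, y). \<exists>t\<in>cox_group \<rho>. y = (\<lambda>j. t j * x j)}"

text \<open>
  The set of (closed) points of the subscheme \<open>V(I) \<subseteq> X\<^sub>\<Sigma>\<close> of a homogeneous ideal \<open>I\<close>; the points of
  \<open>X\<^sub>\<Sigma>\<close> itself are \<open>toric_V \<Sigma> \<rho> {0}\<close>.
\<close>

definition toric_V ::
    "(real ^ 'n) set set \<Rightarrow> ('m::finite \<Rightarrow> (real ^ 'n) set) \<Rightarrow> 'm mpoly set \<Rightarrow> ('m \<Rightarrow> complex) set set" where
  "toric_V \<Sigma> \<rho> I = (affine_V I - affine_V (irrelevant_ideal \<Sigma> \<rho>)) // orbit_rel \<rho>"

definition toric_closed ::
    "(real ^ 'n) set set \<Rightarrow> ('m::finite \<Rightarrow> (real ^ 'n) set) \<Rightarrow> ('m \<Rightarrow> complex) set set \<Rightarrow> bool" where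
  "toric_closed \<Sigma> \<rho> Z \<longleftrightarrow> (\<exists>J. homogeneous_ideal \<rho> J \<and> Z = toric_V \<Sigma> \<rho> J)"

definition toric_irreducible ::
    "(real ^ 'n) set set \<Rightarrow> ('m::finite \<Rightarrow> (real ^ 'n) set) \<Rightarrow> ('m \<Rightarrow> complex) set set \<Rightarrow> bool" where
  "toric_irreducible \<Sigma> \<rho> Z \<longleftrightarrow> Z \<noteq> {} \<and>
     (\<forall>Z1 Z2. toric_closed \<Sigma> \<rho> Z1 \<and> toric_closed \<Sigma> \<rho> Z2 \<and> Z \<subseteq> Z1 \<union> Z2 \<longrightarrow> Z \<subseteq> Z1 \<or> Z \<subseteq> Z2)"

text \<open>The Krull dimension of a closed subset: the supremum of the lengths of chains of irreducible
  closed subsets. The empty set has dimension \<open>-\<infinity>\<close>, so a zero dimensional set is nonempty.\<close>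

definition toric_dim ::
    "(real ^ 'n) set set \<Rightarrow> ('m::finite \<Rightarrow> (real ^ 'n) set) \<Rightarrow> ('m \<Rightarrow> complex) set set \<Rightarrow> ereal" where
  "toric_dim \<Sigma> \<rho> Y =
     (SUP l \<in> {l::nat. \<exists>Z. (\<forall>i\<le>l. toric_closed \<Sigma> \<rho> (Z i) \<and> toric_irreducible \<Sigma> \<rho> (Z i) \<and> Z i \<subseteq> Y) \<and>
                          (\<forall>i<l. Z i \<subset> Z (Suc i))}. ereal (real l))"

text \<open>The exponent of the monomial \<open>x\<^sup>\<sigma>\<close>, the product of the \<open>x\<^sub>j\<close> over the rays \<open>\<rho>\<^sub>j \<notin> \<sigma>(1)\<close>.\<close>

definition cone_exponent ::
    "('m::finite \<Rightarrow> (real ^ 'n) set) \<Rightarrow> (real ^ 'n) set \<Rightarrow> 'm \<Rightarrow>\<^sub>0 nat" where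
  "cone_exponent \<rho> \<sigma> = (\<Sum>j | \<not> cone_face (\<rho> j) \<sigma>. Poly_Mapping.single j 1)"

definition cone_monomial :: "('m::finite \<Rightarrow> (real ^ 'n) set) \<Rightarrow> (real ^ 'n) set \<Rightarrow> 'm mpoly" where
  "cone_monomial \<rho> \<sigma> = Poly_Mapping.single (cone_exponent \<rho> \<sigma>) 1"

text \<open>
  Let \<open>s = x\<^sup>\<sigma>\<close>. On the affine chart \<open>U\<^sub>\<sigma> = Spec (R\<^sub>s)\<^sub>0\<close> the subscheme \<open>V(I)\<close> is given by the degree
  zero part \<open>(I\<^sub>s)\<^sub>0\<close> of the localisation, and \<open>V(I)\<close> is reduced iff these ideals are radical for all
  \<open>\<sigma> \<in> \<Sigma>\<close>. Elements of \<open>(R\<^sub>s)\<^sub>0\<close> are the fractions \<open>f/s\<^sup>k\<close> with \<open>f\<close> homogeneous of degree \<open>k deg s\<close>,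
  and \<open>f/s\<^sup>k \<in> I\<^sub>s\<close> iff \<open>s\<^sup>e f \<in> I\<close> for some \<open>e\<close>.
\<close>

definition numerator_in_localisation :: "'m mpoly set \<Rightarrow> 'm mpoly \<Rightarrow> 'm mpoly \<Rightarrow> bool" where
  "numerator_in_localisation I s f \<longleftrightarrow> (\<exists>e::nat. s ^ e * f \<in> I)"

definition reduced_subscheme ::
    "(real ^ 'n) set set \<Rightarrow> ('m::finite \<Rightarrow> (real ^ 'n) set) \<Rightarrow> 'm mpoly set \<Rightarrow> bool" where
  "reduced_subscheme \<Sigma> \<rho> I \<longleftrightarrow>
     (\<forall>\<sigma>\<in>\<Sigma>. \<forall>(f :: 'm mpoly) (k::nat) (r::nat).
        homogeneous_of_degree \<rho> (monomial_degree \<rho> (\<Sum>_<k. cone_exponent \<rho> \<sigma>)) f \<longrightarrow>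
        numerator_in_localisation I (cone_monomial \<rho> \<sigma>) (f ^ r) \<longrightarrow>
        numerator_in_localisation I (cone_monomial \<rho> \<sigma>) f)"

definition reduced_zero_dimensional ::
    "(real ^ 'n) set set \<Rightarrow> ('m::finite \<Rightarrow> (real ^ 'n) set) \<Rightarrow> 'm mpoly set \<Rightarrow> bool" where
  "reduced_zero_dimensional \<Sigma> \<rho> I \<longleftrightarrow>
     reduced_subscheme \<Sigma> \<rho> I \<and> toric_dim \<Sigma> \<rho> (toric_V \<Sigma> \<rho> I) = 0"


section \<open>General choices of scalars and dehomogenizing ideals\<close>

text \<open>
  The affine space \<open>\<complex>\<^sup>K\<close> of families of scalars indexed by \<open>K\<close>: functions on the ambient index type
  that vanish outside \<open>K\<close>.
\<close>

definition scalar_space :: "'k set \<Rightarrow> ('k \<Rightarrow> complex) set" where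
  "scalar_space K = {\<Lambda>. \<forall>k. k \<notin> K \<longrightarrow> \<Lambda> k = 0}"

definition zariski_open :: "'k::finite set \<Rightarrow> ('k \<Rightarrow> complex) set \<Rightarrow> bool" where
  "zariski_open K U \<longleftrightarrow> (\<exists>S. U = scalar_space K - affine_V S)"

definition for_general :: "'k::finite set \<Rightarrow> (('k \<Rightarrow> complex) \<Rightarrow> bool) \<Rightarrow> bool" where
  "for_general K Q \<longleftrightarrow> (\<exists>U. zariski_open K U \<and> U \<noteq> {} \<and> (\<forall>\<Lambda>\<in>U. Q \<Lambda>))"

text \<open>\<open>L\<close> is a dehomogenizing ideal for the reduced zero dimensional subscheme \<open>W = V(J)\<close>.\<close>

definition dehomogenizing_ideal ::
    "(real ^ 'n) set set \<Rightarrow> ('m::finite \<Rightarrow> (real ^ 'n) set) \<Rightarrow> 'm mpoly set \<Rightarrow> 'm mpoly set \<Rightarrow> bool" where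
  "dehomogenizing_ideal \<Sigma> \<rho> J L \<longleftrightarrow> is_ideal L \<and>
     (\<exists>q. finite (toric_V \<Sigma> \<rho> J) \<and> card (toric_V \<Sigma> \<rho> J) = q \<and>
          finite (affine_V J \<inter> affine_V L) \<and> card (affine_V J \<inter> affine_V L) = q)"

definition general_dehomogenizing_ideal ::
    "(real ^ 'n) set set \<Rightarrow> ('m::finite \<Rightarrow> (real ^ 'n) set) \<Rightarrow>
     'k::finite set \<Rightarrow> (('k \<Rightarrow> complex) \<Rightarrow> 'm mpoly set) \<Rightarrow> bool" where
  "general_dehomogenizing_ideal \<Sigma> \<rho> K L \<longleftrightarrow>
     (\<forall>J. homogeneous_ideal \<rho> J \<and> reduced_zero_dimensional \<Sigma> \<rho> J \<longrightarrow>
        for_general K (\<lambda>\<Lambda>. dehomogenizing_ideal \<Sigma> \<rho> J (L \<Lambda>)))"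

text \<open>The scalar \<open>\<lambda>\<^sub>j\<^bsup>(l)\<^esup>\<close> is indexed by the pair \<open>(P, j)\<close>, where \<open>P\<close> is the \<open>l\<close>-th primitive collection
  and \<open>j \<in> P\<close>.\<close>

definition LA_indices ::
    "(real ^ 'n) set set \<Rightarrow> ('m::finite \<Rightarrow> (real ^ 'n) set) \<Rightarrow> ('m set \<times> 'm) set" where
  "LA_indices \<Sigma> \<rho> = (SIGMA P : primitive_collections \<Sigma> \<rho>. P)"

definition LA ::
    "(real ^ 'n) set set \<Rightarrow> ('m::finite \<Rightarrow> (real ^ 'n) set) \<Rightarrow> ('m set \<times> 'm \<Rightarrow> complex) \<Rightarrow> 'm mpoly set" where
  "LA \<Sigma> \<rho> \<Lambda> =
     ideal_generated ((\<lambda>P. (\<Sum>j\<in>P. const (\<Lambda> (P, j)) * var j) - 1) ` primitive_collections \<Sigma> \<rho>)"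

end

theory Submission
  imports Defs
begin

text \<open>
  Minimal non-faces of a pure simplicial complex on \<open>m\<close> vertices whose facets have \<open>n\<close> elements are
  pairwise disjoint if there are only \<open>m - n\<close> of them. So under the affine codimension condition,
  picking one ray \<open>s P\<close> from every primitive collection \<open>P\<close> leaves the rays of a maximal cone, and
  smoothness gives a basis \<open>b\<^sup>P\<close> of the relations between the ray generators that is dual to the \<open>s P\<close>.
  The dependency relation "\<open>b\<^sup>P\<close> is nonzero somewhere on \<open>Q\<close>" is acyclic (this is the combinatorial
  shadow of Batyrev's theorem that \<open>X\<^sub>\<Sigma>\<close> is an iterated projective bundle).

  A point of \<open>X\<^sub>\<Sigma>\<close> is an orbit of the torus \<open>G\<close> with coordinates \<open>t (s P)\<close>. On an orbit, the equation of
  \<open>L\<^sub>A(\<Lambda>)\<close> for \<open>Q\<close> is linear in \<open>t (s Q)\<close>, with a coefficient depending only on earlier coordinates, so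
  there is at most one solution, and exactly one if these coefficients do not vanish, which holds
  for general \<open>\<Lambda>\<close>. Finiteness of a zero dimensional \<open>V(I)\<close> follows from Hilbert's basis theorem and
  the fact that orbits are closed.
\<close>

text \<open>The interpretation of \<open>module\<close> in the definitions makes \<open>a * (b * c) = (a * b) * c\<close> a simp rule,
  which loops with \<open>mult_ac\<close>.\<close>

declare ideal.scale_scale [simp del]

subsection \<open>Lattices and ray generators\<close>

text \<open>Torus coordinates depend on a selection. A point outside the irrelevant locus supplies a
  selection whose coordinates do not vanish at it, but the selection changes from orbit to orbit. So
  the facts on \<open>rel_basis\<close> and \<open>dep\<close> are needed for every selection, and
  comparing two selections is also what forces the coefficients of \<open>rel_basis s P\<close> on
  \<open>P\<close> to be 1. This coefficient is the reason why the equation of a collection is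
  linear in its own coordinate.

  The solution on an orbit is a rational function of the scalars, obtained by recursion. To get a
  nonempty open set of good scalars it suffices to exhibit one choice at which all the functions in
  the recursion are regular and nonzero; the witness may differ from orbit to orbit, since finitely
  many nonempty open sets have a common point.\<close>

lemma lattice_points_add: "v \<in> lattice_points \<Longrightarrow> w \<in> lattice_points \<Longrightarrow> v + w \<in> lattice_points"
  by (simp add: lattice_points_def)

lemma lattice_points_minus: "v \<in> lattice_points \<Longrightarrow> - v \<in> lattice_points"
  by (simp add: lattice_points_def)

lemma lattice_points_zero: "0 \<in> lattice_points"
  by (simp add: lattice_points_def)

lemma lattice_points_diff: "v \<in> lattice_points \<Longrightarrow> w \<in> lattice_points \<Longrightarrow> v - w \<in> lattice_points"
  by (simp add: lattice_points_def)

lemma lattice_points_scaleR_of_int: "v \<in> lattice_points \<Longrightarrow> of_int k *\<^sub>R v \<in> lattice_points"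
  by (simp add: lattice_points_def)

lemma inner_lattice_points_Ints:
  fixes v w :: "real ^ 'n"
  shows "v \<in> lattice_points \<Longrightarrow> w \<in> lattice_points \<Longrightarrow> v \<bullet> w \<in> \<int>"
  unfolding inner_vec_def by (intro Ints_sum) (auto simp: lattice_points_def intro: Ints_mult)

lemma axis_in_lattice_points: "axis i 1 \<in> lattice_points"
  by (simp add: lattice_points_def axis_def)

lemma sum_axis_expansion: "(\<Sum>i\<in>UNIV. (v $ i) *\<^sub>R axis i (1::real)) = (v :: real ^ 'n)"
  using basis_expansion[of v] by (simp add: scalar_mult_eq_scaleR)

text \<open>The integer coefficients of the unit vectors, transposed, give the candidates for
  \<open>w\<close>; the expansion of a real vector then follows by linearity. Duality is uniqueness
  of coefficients: a basis vector also has the trivial expansion.\<close>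

lemma lattice_basis_dual:
  fixes B :: "(real ^ 'n) set"
  assumes "lattice_basis B"
  shows "\<exists>w. (\<forall>b. w b \<in> lattice_points) \<and>
    (\<forall>b\<in>B. \<forall>b'\<in>B. w b \<bullet> b' = (if b = b' then 1 else 0)) \<and>
    (\<forall>v. (\<Sum>b\<in>B. (w b \<bullet> v) *\<^sub>R b) = v)"
proof -
  have fin: "finite B" and lat: "B \<subseteq> lattice_points"
    and uniq: "\<And>v. v \<in> lattice_points \<Longrightarrow> \<exists>!k :: real ^ 'n \<Rightarrow> int.
        (\<forall>b. b \<notin> B \<longrightarrow> k b = 0) \<and> v = (\<Sum>b\<in>B. of_int (k b) *\<^sub>R b)"
    using assms by (auto simp: lattice_basis_def)
  have "\<forall>i. \<exists>k :: real ^ 'n \<Rightarrow> int. axis i 1 = (\<Sum>b\<in>B. of_int (k b) *\<^sub>R b)"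
    using uniq[OF axis_in_lattice_points] by blast
  then obtain k :: "'n \<Rightarrow> real ^ 'n \<Rightarrow> int"
    where k: "\<And>i. axis i 1 = (\<Sum>b\<in>B. of_int (k i b) *\<^sub>R b)" by metis
  define w :: "real ^ 'n \<Rightarrow> real ^ 'n" where "w b = (\<chi> i. of_int (k i b))" for b
  have expand: "(\<Sum>b\<in>B. (w b \<bullet> v) *\<^sub>R b) = v" for v
  proof -
    have "(\<Sum>b\<in>B. (w b \<bullet> v) *\<^sub>R b) = (\<Sum>b\<in>B. \<Sum>i\<in>UNIV. (v $ i * of_int (k i b)) *\<^sub>R b)"
      by (simp add: w_def inner_vec_def scaleR_sum_left mult.commute)
    also have "\<dots> = (\<Sum>i\<in>UNIV. (v $ i) *\<^sub>R (\<Sum>b\<in>B. of_int (k i b) *\<^sub>R b))"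
      by (subst sum.swap) (simp add: scaleR_sum_right)
    also have "\<dots> = v" by (simp add: k[symmetric] sum_axis_expansion)
    finally show ?thesis .
  qed
  have wlat: "w b \<in> lattice_points" for b by (simp add: w_def lattice_points_def)
  have dual: "w b \<bullet> b' = (if b = b' then 1 else 0)" if b: "b \<in> B" and b': "b' \<in> B" for b b'
  proof -
    have int: "w c \<bullet> b' = of_int \<lfloor>w c \<bullet> b'\<rfloor>" for c
      using inner_lattice_points_Ints[OF wlat, of b' c] b' lat by (metis Ints_cases floor_of_int subsetD)
    define k1 :: "real ^ 'n \<Rightarrow> int" where "k1 c = (if c \<in> B then \<lfloor>w c \<bullet> b'\<rfloor> else 0)" for c
    define k2 :: "real ^ 'n \<Rightarrow> int" where "k2 c = (if c = b' then 1 else 0)" for c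
    have "(\<Sum>c\<in>B. of_int (k1 c) *\<^sub>R c) = (\<Sum>c\<in>B. (w c \<bullet> b') *\<^sub>R c)"
      using int by (intro sum.cong) (auto simp: k1_def)
    then have 1: "b' = (\<Sum>c\<in>B. of_int (k1 c) *\<^sub>R c)" using expand[of b'] by simp
    have "(\<Sum>c\<in>B. of_int (k2 c) *\<^sub>R c) = (\<Sum>c\<in>B. if c = b' then b' else 0)"
      by (intro sum.cong) (auto simp: k2_def)
    then have 2: "b' = (\<Sum>c\<in>B. of_int (k2 c) *\<^sub>R c)" using fin b' by simp
    have "b' \<in> lattice_points" using b' lat by blast
    moreover have "\<forall>b. b \<notin> B \<longrightarrow> k1 b = 0" "\<forall>b. b \<notin> B \<longrightarrow> k2 b = 0"
      using b' by (auto simp: k1_def k2_def)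
    ultimately have "k1 = k2"
      using uniq[of b'] 1 2 by blast
    then have "k1 b = k2 b" by simp
    then show ?thesis using b by (subst int) (auto simp: k1_def k2_def)
  qed
  show ?thesis by (intro exI[of _ w] conjI allI ballI wlat dual expand)
qed

lemma lattice_basis_card:
  fixes B :: "(real ^ 'n) set"
  assumes "lattice_basis B"
  shows "independent B" "card B = CARD('n)"
proof -
  obtain w where "\<forall>b\<in>B. \<forall>b'\<in>B. w b \<bullet> b' = (if b = b' then 1 else 0)"
    and "\<forall>v. (\<Sum>b\<in>B. (w b \<bullet> v) *\<^sub>R b) = v"
    using lattice_basis_dual[OF assms] by blast
  then have w: "b \<in> B \<Longrightarrow> b' \<in> B \<Longrightarrow> w b \<bullet> b' = (if b = b' then 1 else 0)"
    and ex: "(\<Sum>b\<in>B. (w b \<bullet> v) *\<^sub>R b) = v" for b b' v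
    by blast+
  have fin: "finite B" using assms by (simp add: lattice_basis_def)
  show ind: "independent B"
  proof (rule independent_if_scalars_zero[OF fin])
    fix f b assume 0: "(\<Sum>c\<in>B. f c *\<^sub>R c) = 0" and b: "b \<in> B"
    have "0 = w b \<bullet> (\<Sum>c\<in>B. f c *\<^sub>R c)" using 0 by simp
    also have "\<dots> = (\<Sum>c\<in>B. f c * (w b \<bullet> c))" by (simp add: inner_sum_right)
    also have "\<dots> = (\<Sum>c\<in>B. if b = c then f c else 0)"
      using w[OF b] by (intro sum.cong) auto
    finally show "f b = 0" using b fin by simp
  qed
  have "span B = UNIV"
  proof -
    have "v \<in> span B" for v
    proof -
      have "(\<Sum>b\<in>B. (w b \<bullet> v) *\<^sub>R b) \<in> span B"
        by (intro span_sum span_scale span_base)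
      then show ?thesis by (simp only: ex)
    qed
    then show ?thesis by blast
  qed
  then have "dim (UNIV :: (real ^ 'n) set) = dim B" by (metis dim_span)
  then show "card B = CARD('n)" using dim_eq_card_independent[OF ind] by simp
qed

lemma strongly_convex_rational_cone_convex_cone:
  "strongly_convex_rational_cone \<sigma> \<Longrightarrow> convex_cone \<sigma>"
  unfolding strongly_convex_rational_cone_def using convex_cone_convex_cone_hull by blast

lemma strongly_convex_rational_cone_pointed:
  "strongly_convex_rational_cone \<sigma> \<Longrightarrow> v \<in> \<sigma> \<Longrightarrow> - v \<in> \<sigma> \<Longrightarrow> v = 0"
  unfolding strongly_convex_rational_cone_def by force

lemma convex_cone_subset_span: "convex_cone hull S \<subseteq> span S"
  by (rule hull_minimal) (auto simp: convex_cone_iff span_base span_add span_scale span_zero)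

text \<open>The description in \<open>ray_gen\<close> determines a vector because lattice points on
  a half line are discrete: division by the shortest nonzero one leaves remainder zero. Two
  generators are natural multiples of each other, hence equal.\<close>

lemma ray_gen_properties:
  fixes \<Sigma> :: "(real ^ 'n) set set"
  assumes "fan \<Sigma>" and r: "r \<in> rays \<Sigma>"
  shows "ray_gen r \<in> lattice_points" "ray_gen r \<noteq> 0" "r = {c *\<^sub>R ray_gen r |c. 0 \<le> c}"
proof -
  have sc: "strongly_convex_rational_cone r" and dim: "dim r = 1"
    using assms by (auto simp: fan_def rays_def)
  obtain S where S: "finite S" "S \<subseteq> lattice_points" "r = convex_cone hull S"
    using sc by (auto simp: strongly_convex_rational_cone_def)
  have "\<not> S \<subseteq> {0}"
  proof
    assume "S \<subseteq> {0}"
    then have "r \<subseteq> {0}" using convex_cone_subset_span[of S] S(3) span_mono[of S "{0}"] by auto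
    then show False using dim by (metis dim_eq_0 zero_neq_one)
  qed
  then obtain v where v: "v \<in> S" "v \<noteq> 0" by auto
  have vr: "v \<in> r" and vl: "v \<in> lattice_points" using v S by (auto intro: hull_inc)
  have cc: "convex_cone r" using sc by (rule strongly_convex_rational_cone_convex_cone)
  have rsp: "r \<subseteq> span {v}"
  proof -
    have "dim {v} = dim r" using dim v by simp
    then have "span {v} = span r" using vr by (intro dim_eq_span) auto
    then show ?thesis using span_superset by blast
  qed
  have rv: "r = {c *\<^sub>R v |c. 0 \<le> c}"
  proof (intro equalityI subsetI)
    fix x assume x: "x \<in> r"
    then obtain c where c: "x = c *\<^sub>R v" using rsp by (auto simp: span_singleton)
    have "0 \<le> c"
    proof (rule ccontr)
      assume neg: "\<not> 0 \<le> c"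
      have "(1 / - c) *\<^sub>R x \<in> r" using neg x by (intro convex_cone_scaleR[OF cc]) auto
      then have "- v \<in> r" using neg c by simp
      then show False using strongly_convex_rational_cone_pointed[OF sc vr] v by blast
    qed
    then show "x \<in> {c *\<^sub>R v |c. 0 \<le> c}" using c by blast
  qed (auto intro: convex_cone_scaleR[OF cc] vr)
  obtain i where i: "v $ i \<noteq> 0" using v by (auto simp: vec_eq_iff)
  \<comment> \<open>A nonzero coordinate of \<open>v\<close> measures the lattice multiples of
    \<open>v\<close> by natural numbers, so there is a shortest one.\<close>
  define A where "A = {c::real. 0 < c \<and> c *\<^sub>R v \<in> lattice_points}"
  define f where "f c = nat \<lfloor>\<bar>c * v $ i\<bar>\<rfloor>" for c :: real
  have fA: "real (f c) = \<bar>c * v $ i\<bar>" if "c *\<^sub>R v \<in> lattice_points" for c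
  proof -
    have "c * v $ i \<in> \<int>" using that by (auto simp: lattice_points_def dest: spec[of _ i])
    then show ?thesis by (auto simp: f_def elim!: Ints_cases)
  qed
  have "1 \<in> A" using vl by (simp add: A_def)
  then obtain c where c: "c \<in> A" and cmin: "\<And>d. d \<in> A \<Longrightarrow> f c \<le> f d"
    using ex_has_least_nat[of "\<lambda>c. c \<in> A" 1 f] by auto
  have c0: "0 < c" and cl: "c *\<^sub>R v \<in> lattice_points" using c by (auto simp: A_def)
  define u where "u = c *\<^sub>R v"
  have u0: "u \<noteq> 0" using c0 v by (simp add: u_def)
  have mult: "\<exists>k::nat. x = of_nat k *\<^sub>R u" if x: "x \<in> r \<inter> lattice_points" for x
  proof -
    obtain d where d: "x = d *\<^sub>R v" "0 \<le> d" using x rv by auto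
    define k where "k = nat \<lfloor>d / c\<rfloor>"
    have "real k = of_int \<lfloor>d / c\<rfloor>" using d c0 by (simp add: k_def)
    then have "real k \<le> d / c" "d / c < real k + 1" by linarith+
    then have ge: "0 \<le> d - real k * c" and lt: "d - real k * c < c"
      using c0 by (simp_all add: field_simps)
    have eq: "(d - real k * c) *\<^sub>R v = x - of_int (int k) *\<^sub>R (c *\<^sub>R v)"
      by (simp add: d algebra_simps)
    have l: "(d - real k * c) *\<^sub>R v \<in> lattice_points"
      unfolding eq using x cl by (intro lattice_points_diff lattice_points_scaleR_of_int) auto
    have "d - real k * c = 0"
    proof (rule ccontr)
      assume "d - real k * c \<noteq> 0"
      then have "d - real k * c \<in> A" using ge l by (auto simp: A_def)
      from cmin[OF this] have "real (f c) \<le> real (f (d - real k * c))" by simp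
      then have "c * \<bar>v $ i\<bar> \<le> (d - real k * c) * \<bar>v $ i\<bar>"
        using fA[OF l] fA[OF cl] c0 ge by (simp add: abs_mult)
      then show False using lt i by simp
    qed
    then have "x = of_nat k *\<^sub>R u" using d by (simp add: u_def)
    then show ?thesis by blast
  qed
  have ur: "u \<in> r" using rv c0 by (auto simp: u_def)
  have "ray_gen r = u"
    unfolding ray_gen_def
  proof (rule the_equality)
    show "u \<in> r \<inter> lattice_points \<and> u \<noteq> 0 \<and> (\<forall>v\<in>r \<inter> lattice_points. \<exists>k::nat. v = of_nat k *\<^sub>R u)"
      using ur u0 cl mult by (simp add: u_def)
  next
    fix u' assume u': "u' \<in> r \<inter> lattice_points \<and> u' \<noteq> 0 \<and> (\<forall>v\<in>r \<inter> lattice_points. \<exists>k::nat. v = of_nat k *\<^sub>R u')"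
    then obtain k where k: "u' = of_nat k *\<^sub>R u" using mult by blast
    obtain l :: nat where l: "u = of_nat l *\<^sub>R u'" using u' ur cl by (auto simp: u_def)
    have "(real l * real k) *\<^sub>R u = 1 *\<^sub>R u" using k l by (metis scaleR_scaleR scaleR_one)
    then have "real l * real k = 1" using u0 by (metis scaleR_right_imp_eq)
    then have "l * k = 1" by (metis of_nat_1 of_nat_eq_iff of_nat_mult)
    then show "u' = u" using k by simp
  qed
  moreover have "r = {c *\<^sub>R u |c. 0 \<le> c}"
  proof (intro equalityI subsetI)
    fix x assume "x \<in> r"
    then obtain d where d: "x = d *\<^sub>R v" "0 \<le> d" using rv by auto
    then have "x = (d / c) *\<^sub>R u" "0 \<le> d / c" using c0 by (auto simp: u_def)
    then show "x \<in> {c *\<^sub>R u |c. 0 \<le> c}" by blast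
  qed (auto intro: convex_cone_scaleR[OF cc] ur)
  ultimately show "ray_gen r \<in> lattice_points" "ray_gen r \<noteq> 0" "r = {c *\<^sub>R ray_gen r |c. 0 \<le> c}"
    using cl u0 by (simp_all add: u_def)
qed

subsection \<open>Cones of a smooth complete fan\<close>

lemma convex_cone_sum:
  "convex_cone \<sigma> \<Longrightarrow> (\<And>j. j \<in> A \<Longrightarrow> v j \<in> \<sigma>) \<Longrightarrow> (\<Sum>j\<in>A. v j) \<in> \<sigma>"
  by (induction A rule: infinite_finite_induct) (simp_all add: convex_cone_add convex_cone_contains_0)

text \<open>Up to the factor 1/2, the sum is the midpoint of \<open>v i\<close> and of the sum of
  the other vectors, so the face property applies to this segment unless it degenerates to a
  point.\<close>

lemma face_of_convex_cone_sum_mem: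
  assumes "\<tau> face_of \<sigma>" and "convex_cone \<sigma>" and "convex_cone \<tau>"
    and "finite A" and "\<And>j. j \<in> A \<Longrightarrow> v j \<in> \<sigma>" and "(\<Sum>j\<in>A. v j) \<in> \<tau>" and "i \<in> A"
  shows "v i \<in> \<tau>"
proof -
  define y where "y = (\<Sum>j\<in>A - {i}. v j)"
  have y: "y \<in> \<sigma>" and x: "v i \<in> \<sigma>" using assms by (auto simp: y_def intro: convex_cone_sum)
  have "v i + y \<in> \<tau>" using assms by (simp add: y_def sum.remove[of A i])
  then have mid: "(1/2) *\<^sub>R (v i + y) \<in> \<tau>" by (intro convex_cone_scaleR[OF assms(3)]) auto
  show ?thesis
  proof (cases "v i = y")
    case True
    then have "(1/2) *\<^sub>R (v i + y) = v i" by (simp add: scaleR_2[symmetric])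
    then show ?thesis using mid by simp
  next
    case False
    then have "(1/2) *\<^sub>R (v i + y) \<in> open_segment (v i) y"
      unfolding in_segment by (intro conjI exI[of _ "1/2"]) (auto simp: scaleR_add_right)
    then show ?thesis using face_ofD[OF assms(1) _ x y mid] by blast
  qed
qed

lemma int_card_Compl: "int (card (- F)) = int CARD('m) - int (card F)" for F :: "'m::finite set"
  using card_mono[of UNIV F] by (simp add: Compl_eq_Diff_UNIV card_Diff_subset)

locale smooth_complete_fan =
  fixes \<Sigma> :: "(real ^ 'n) set set" and \<rho> :: "'m::finite \<Rightarrow> (real ^ 'n) set"
  assumes fan: "fan \<Sigma>" and smooth: "smooth_fan \<Sigma>" and complete: "complete_fan \<Sigma>"
    and bij: "bij_betw \<rho> UNIV (rays \<Sigma>)"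
begin

abbreviation u :: "'m \<Rightarrow> real ^ 'n" where "u j \<equiv> ray_gen (\<rho> j)"

abbreviation PC :: "'m set set" where "PC \<equiv> primitive_collections \<Sigma> \<rho>"

text \<open>These are the faces of the simplicial complex of the fan; its minimal non-faces are the
  primitive collections.\<close>

definition spans_cone :: "'m set \<Rightarrow> bool" where
  "spans_cone S \<longleftrightarrow> (\<exists>\<sigma>\<in>\<Sigma>. u ` S \<subseteq> \<sigma>)"

lemma rho_in_rays: "\<rho> j \<in> rays \<Sigma>"
  using bij by (auto simp: bij_betw_def)

lemma u_lattice: "u j \<in> lattice_points" and u_nonzero: "u j \<noteq> 0"
  and rho_eq: "\<rho> j = {c *\<^sub>R u j |c. 0 \<le> c}"
  by (rule ray_gen_properties[OF fan rho_in_rays])+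

lemma inj_u: "inj u"
proof (rule injI)
  fix i j assume eq: "u i = u j"
  have "\<rho> i = {c *\<^sub>R u i |c. 0 \<le> c}" by (rule rho_eq)
  also have "\<dots> = {c *\<^sub>R u j |c. 0 \<le> c}" by (simp only: eq)
  also have "\<dots> = \<rho> j" by (rule rho_eq[symmetric])
  finally show "i = j" using bij by (auto simp: bij_betw_def inj_eq)
qed

lemma cone_convex_cone: "\<sigma> \<in> \<Sigma> \<Longrightarrow> convex_cone \<sigma>"
  using fan by (auto simp: fan_def intro: strongly_convex_rational_cone_convex_cone)

lemma cone_Int: "\<sigma> \<in> \<Sigma> \<Longrightarrow> \<sigma>' \<in> \<Sigma> \<Longrightarrow> \<sigma> \<inter> \<sigma>' \<in> \<Sigma> \<and> (\<sigma> \<inter> \<sigma>') face_of \<sigma> \<and> (\<sigma> \<inter> \<sigma>') face_of \<sigma>'"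
  using fan by (simp add: fan_def cone_face_def)

lemma cone_face_ray:
  assumes \<sigma>: "\<sigma> \<in> \<Sigma>" and u: "u j \<in> \<sigma>"
  shows "cone_face (\<rho> j) \<sigma>"
proof -
  have "\<rho> j \<subseteq> \<sigma>"
    using convex_cone_scaleR[OF cone_convex_cone[OF \<sigma>] _ u] by (subst rho_eq) auto
  moreover have "\<rho> j \<in> \<Sigma>" using rho_in_rays[of j] by (simp add: rays_def)
  ultimately show ?thesis
    using fan \<sigma> unfolding fan_def by (metis inf.absorb_iff2)
qed

lemma cone_lattice_basis:
  assumes "\<sigma> \<in> \<Sigma>"
  shows "\<exists>B. lattice_basis B \<and> u ` {j. u j \<in> \<sigma>} \<subseteq> B"
proof -
  obtain B where B: "lattice_basis B" "ray_gen ` {r \<in> rays \<Sigma>. cone_face r \<sigma>} \<subseteq> B"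
    using smooth assms by (auto simp: smooth_fan_def)
  then show ?thesis using cone_face_ray[OF assms] rho_in_rays by (intro exI[of _ B]) auto
qed

lemma cone_coefficients_zero:
  assumes "\<sigma> \<in> \<Sigma>" and "u ` S \<subseteq> \<sigma>" and sum: "(\<Sum>j\<in>S. c j *\<^sub>R u j) = 0" and "i \<in> S"
  shows "c i = 0"
proof -
  obtain B where B: "lattice_basis B" "u ` {j. u j \<in> \<sigma>} \<subseteq> B"
    using cone_lattice_basis[OF assms(1)] by blast
  have "u ` S \<subseteq> B" using B(2) assms(2) by blast
  then have "independent (u ` S)" using lattice_basis_card(1)[OF B(1)] independent_mono by blast
  moreover have "(\<Sum>v\<in>u ` S. c (inv u v) *\<^sub>R v) = 0"
    using sum by (subst sum.reindex) (auto simp: inv_f_f[OF inj_u] intro: inj_on_subset[OF inj_u])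
  ultimately have "c (inv u (u i)) = 0"
    using independentD[of "u ` S" "u ` S" "\<lambda>v. c (inv u v)" "u i"] assms(4) by auto
  then show ?thesis by (simp add: inv_f_f[OF inj_u])
qed

lemma spans_cone_mono: "spans_cone S \<Longrightarrow> T \<subseteq> S \<Longrightarrow> spans_cone T"
  unfolding spans_cone_def by blast

lemma PC_iff: "P \<in> PC \<longleftrightarrow> \<not> spans_cone P \<and> (\<forall>Q. Q \<subset> P \<longrightarrow> spans_cone Q)"
  by (simp add: primitive_collections_def spans_cone_def)

lemma PC_not_spans_cone: "P \<in> PC \<Longrightarrow> \<not> spans_cone P"
  and PC_psubset: "P \<in> PC \<Longrightarrow> Q \<subset> P \<Longrightarrow> spans_cone Q"
  using PC_iff by simp_all

lemma spans_cone_iff: "spans_cone S \<longleftrightarrow> \<not> (\<exists>P\<in>PC. P \<subseteq> S)"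
proof
  show "spans_cone S \<Longrightarrow> \<not> (\<exists>P\<in>PC. P \<subseteq> S)" using PC_iff spans_cone_mono by blast
next
  assume no: "\<not> (\<exists>P\<in>PC. P \<subseteq> S)"
  show "spans_cone S"
  proof (rule ccontr)
    assume "\<not> spans_cone S"
    then have "\<exists>P\<in>{Q. Q \<subseteq> S \<and> \<not> spans_cone Q}. \<forall>Q\<in>{Q. Q \<subseteq> S \<and> \<not> spans_cone Q}. Q \<subseteq> P \<longrightarrow> P = Q"
      by (intro finite_has_minimal) auto
    then obtain P where "P \<subseteq> S" "\<not> spans_cone P"
      and "\<forall>Q. Q \<subseteq> S \<and> \<not> spans_cone Q \<and> Q \<subseteq> P \<longrightarrow> P = Q" by blast
    then have "P \<in> PC" unfolding PC_iff by blast
    then show False using no \<open>P \<subseteq> S\<close> by blast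
  qed
qed

text \<open>The intersection of the two cones is a face of \<sigma>', and a face that contains a sum
  of elements of the cone contains every summand.\<close>

lemma cone_contains_rays:
  assumes \<sigma>: "\<sigma> \<in> \<Sigma>" and \<sigma>': "\<sigma>' \<in> \<Sigma>" and sub: "u ` S \<subseteq> \<sigma>'"
    and pos: "\<And>j. j \<in> S \<Longrightarrow> c j > 0" and mem: "(\<Sum>j\<in>S. c j *\<^sub>R u j) \<in> \<sigma>"
  shows "u ` S \<subseteq> \<sigma>"
proof
  fix x assume "x \<in> u ` S"
  then obtain j where j: "j \<in> S" "x = u j" by blast
  have cone: "convex_cone \<sigma>'" using \<sigma>' by (rule cone_convex_cone)
  have in': "c i *\<^sub>R u i \<in> \<sigma>'" if "i \<in> S" for i
    using sub pos[OF that] that by (intro convex_cone_scaleR[OF cone]) auto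
  have I: "\<sigma>' \<inter> \<sigma> \<in> \<Sigma>" "(\<sigma>' \<inter> \<sigma>) face_of \<sigma>'" using cone_Int[OF \<sigma>' \<sigma>] by auto
  have "(\<Sum>j\<in>S. c j *\<^sub>R u j) \<in> \<sigma>'"
    using in' by (rule convex_cone_sum[OF cone])
  then have "c j *\<^sub>R u j \<in> \<sigma>' \<inter> \<sigma>"
    using mem j(1) by (intro face_of_convex_cone_sum_mem[OF I(2) cone cone_convex_cone[OF I(1)] finite in']) auto
  then have "(1 / c j) *\<^sub>R (c j *\<^sub>R u j) \<in> \<sigma>"
    using pos[OF j(1)] convex_cone_scaleR[OF cone_convex_cone[OF \<sigma>], of "1 / c j"] by (simp del: scaleR_scaleR)
  then show "x \<in> \<sigma>" using pos[OF j(1)] j by simp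
qed

text \<open>Otherwise the rays with positive and those with negative coefficient both span cones.
  The relation exhibits one point of both, so all these rays lie in a single cone, where they are
  linearly independent.\<close>

lemma relation_sign:
  fixes b :: "'m \<Rightarrow> real"
  assumes rel: "(\<Sum>j\<in>UNIV. b j *\<^sub>R u j) = 0" and nz: "b i \<noteq> 0"
  shows "\<exists>P\<in>PC. (\<forall>j\<in>P. b j > 0) \<or> (\<forall>j\<in>P. b j < 0)"
proof (rule ccontr)
  assume no: "\<not> ?thesis"
  define X where "X = {j. b j > 0}"
  define Y where "Y = {j. b j < 0}"
  have "spans_cone X" "spans_cone Y"
    using no by (auto simp: spans_cone_iff X_def Y_def)
  then obtain \<sigma> \<sigma>' where \<sigma>: "\<sigma> \<in> \<Sigma>" "u ` X \<subseteq> \<sigma>" and \<sigma>': "\<sigma>' \<in> \<Sigma>" "u ` Y \<subseteq> \<sigma>'"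
    by (auto simp: spans_cone_def)
  have "(\<Sum>j\<in>UNIV. b j *\<^sub>R u j) = (\<Sum>j\<in>X \<union> Y. b j *\<^sub>R u j)"
    by (rule sum.mono_neutral_right) (auto simp: X_def Y_def)
  also have "\<dots> = (\<Sum>j\<in>X. b j *\<^sub>R u j) + (\<Sum>j\<in>Y. b j *\<^sub>R u j)"
    by (rule sum.union_disjoint) (auto simp: X_def Y_def)
  finally have sumXY: "(\<Sum>j\<in>X. b j *\<^sub>R u j) + (\<Sum>j\<in>Y. b j *\<^sub>R u j) = 0" using rel by simp
  then have eq: "(\<Sum>j\<in>X. b j *\<^sub>R u j) = (\<Sum>j\<in>Y. (- b j) *\<^sub>R u j)"
    by (simp add: sum_negf eq_neg_iff_add_eq_0)
  have cone: "convex_cone \<sigma>" using \<sigma> by (simp add: cone_convex_cone)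
  have "(\<Sum>j\<in>X. b j *\<^sub>R u j) \<in> \<sigma>"
    using \<sigma>(2) by (intro convex_cone_sum[OF cone] convex_cone_scaleR[OF cone]) (auto simp: X_def)
  then have "(\<Sum>j\<in>Y. (- b j) *\<^sub>R u j) \<in> \<sigma>" by (simp only: eq)
  then have "u ` Y \<subseteq> \<sigma>"
    by (intro cone_contains_rays[OF \<sigma>(1) \<sigma>', of "\<lambda>j. - b j"]) (auto simp: Y_def)
  then have "u ` (X \<union> Y) \<subseteq> \<sigma>" using \<sigma> by auto
  moreover have "(\<Sum>j\<in>X \<union> Y. b j *\<^sub>R u j) = 0" using sumXY
    by (subst sum.union_disjoint) (auto simp: X_def Y_def)
  moreover have "i \<in> X \<union> Y" using nz by (auto simp: X_def Y_def)
  ultimately show False using cone_coefficients_zero[OF \<sigma>(1), of "X \<union> Y" b i] nz by blast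
qed

text \<open>The elements of a minimal generating set of a pointed cone span one-dimensional faces.\<close>

lemma cone_subset_span_rays:
  assumes "\<sigma> \<in> \<Sigma>"
  shows "\<sigma> \<subseteq> span (u ` {j. u j \<in> \<sigma>})"
proof -
  have sc: "strongly_convex_rational_cone \<sigma>" using fan assms by (simp add: fan_def)
  have cone: "convex_cone \<sigma>" using assms by (rule cone_convex_cone)
  obtain S0 where S0: "finite S0" "\<sigma> = convex_cone hull S0"
    using sc by (auto simp: strongly_convex_rational_cone_def)
  define gen where "gen T \<longleftrightarrow> T \<subseteq> S0 \<and> \<sigma> = convex_cone hull T" for T
  have "\<exists>S\<in>{T. gen T}. \<forall>T\<in>{T. gen T}. T \<subseteq> S \<longrightarrow> S = T"
    by (intro finite_has_minimal) (use S0 in \<open>auto simp: gen_def\<close>)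
  then obtain S where "gen S" and least: "\<And>T. gen T \<Longrightarrow> T \<subseteq> S \<Longrightarrow> S = T" by blast
  then have S: "S \<subseteq> S0" "\<sigma> = convex_cone hull S" by (simp_all add: gen_def)
  have min: "\<sigma> \<noteq> convex_cone hull T" if "T \<subset> S" for T
    using that S(1) least[of T] by (auto simp: gen_def)
  have S\<sigma>: "S \<subseteq> \<sigma>" using S(2) by (auto intro: hull_inc)
  have "v \<in> span (u ` {j. u j \<in> \<sigma>})" if v: "v \<in> S" for v
  proof -
    define T where "T = convex_cone hull (S - {v})"
    have Tcone: "convex_cone T" unfolding T_def by (rule convex_cone_convex_cone_hull)
    have T\<sigma>: "T \<subseteq> \<sigma>" unfolding T_def S(2) by (rule hull_mono) auto
    have vT: "v \<notin> T"
    proof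
      assume "v \<in> T"
      moreover have "S - {v} \<subseteq> T" unfolding T_def by (auto intro: hull_inc)
      ultimately have "S \<subseteq> T" by blast
      then have "\<sigma> \<subseteq> T" unfolding S(2) using Tcone by (rule hull_minimal)
      then show False using min[of "S - {v}"] T\<sigma> v by (auto simp: T_def)
    qed
    then have v0: "v \<noteq> 0" using convex_cone_contains_0[OF Tcone] by auto
    define R where "R = {c *\<^sub>R v |c. 0 \<le> c}"
    have v\<sigma>: "v \<in> \<sigma>" using v S\<sigma> by blast
    have R\<sigma>: "R \<subseteq> \<sigma>" using convex_cone_scaleR[OF cone _ v\<sigma>] by (auto simp: R_def)
    have hull_v: "convex_cone hull {v} = R"
    proof (rule hull_unique)
      show "{v} \<subseteq> R" unfolding R_def by (auto intro: exI[of _ 1])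
      have "0 \<in> R" unfolding R_def by (auto intro: exI[of _ 0])
      moreover have "x + y \<in> R" if "x \<in> R" "y \<in> R" for x y
        using that unfolding R_def by (force simp: scaleR_add_left[symmetric])
      moreover have "c *\<^sub>R x \<in> R" if "x \<in> R" "0 \<le> c" for x c
        using that unfolding R_def by force
      ultimately show "convex_cone R" unfolding convex_cone_iff by blast
    next
      fix t assume "{v} \<subseteq> t" "convex_cone t"
      then show "R \<subseteq> t" by (auto simp: R_def intro: convex_cone_scaleR)
    qed
    have decomp: "\<exists>c t. 0 \<le> c \<and> t \<in> T \<and> x = c *\<^sub>R v + t" if "x \<in> \<sigma>" for x
    proof -
      have "\<sigma> = convex_cone hull ({v} \<union> (S - {v}))"
        using S(2) v by (simp add: insert_absorb)
      then show ?thesis using that unfolding convex_cone_hull_Un hull_v T_def R_def by auto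
    qed
    have "R face_of \<sigma>"
      unfolding face_of_def
    proof (intro conjI ballI impI)
      show "R \<subseteq> \<sigma>" by (rule R\<sigma>)
      show "convex R" using hull_v convex_convex_cone_hull[of "{v}"] by simp
    next
      fix a b x assume a: "a \<in> \<sigma>" and b: "b \<in> \<sigma>" and x: "x \<in> R" and seg: "x \<in> open_segment a b"
      obtain ca ta where ta: "0 \<le> ca" "ta \<in> T" "a = ca *\<^sub>R v + ta" using decomp[OF a] by blast
      obtain cb tb where tb: "0 \<le> cb" "tb \<in> T" "b = cb *\<^sub>R v + tb" using decomp[OF b] by blast
      obtain l where l: "0 < l" "l < 1" "x = (1 - l) *\<^sub>R a + l *\<^sub>R b"
        using seg by (auto simp: in_segment)
      obtain c where c: "0 \<le> c" "x = c *\<^sub>R v" using x by (auto simp: R_def)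
      define g where "g = (1 - l) * ca + l * cb"
      define p where "p = (1 - l) *\<^sub>R ta"
      define q where "q = l *\<^sub>R tb"
      have p: "p \<in> T" and q: "q \<in> T"
        using l ta tb by (auto simp: p_def q_def intro!: convex_cone_scaleR[OF Tcone])
      have pq: "p + q = (c - g) *\<^sub>R v"
        using l(3) c(2) ta(3) tb(3) by (simp add: g_def p_def q_def algebra_simps)
      have pqT: "p + q \<in> T" using p q by (rule convex_cone_add[OF Tcone])
      \<comment> \<open>If \<open>c > g\<close>, then \<open>p + q\<close> would be a positive
        multiple of \<open>v\<close> in \<open>T\<close>, against minimality of \<open>S\<close>. So
        \<open>- (p + q)\<close> lies in the cone, hence so do \<open>- p\<close> and
        \<open>- q\<close>, and pointedness makes both vanish.\<close>
      have cg: "c \<le> g"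
      proof (rule ccontr)
        assume "\<not> c \<le> g"
        then have "(1 / (c - g)) *\<^sub>R (p + q) \<in> T" by (intro convex_cone_scaleR[OF Tcone _ pqT]) auto
        then show False using \<open>\<not> c \<le> g\<close> vT by (simp add: pq)
      qed
      have "- (p + q) = (g - c) *\<^sub>R v" by (simp add: pq algebra_simps)
      then have "- (p + q) \<in> \<sigma>" using cg convex_cone_scaleR[OF cone _ v\<sigma>, of "g - c"] by simp
      then have "- p \<in> \<sigma>" "- q \<in> \<sigma>"
        using convex_cone_add[OF cone, of "- (p + q)" q] convex_cone_add[OF cone, of "- (p + q)" p] p q T\<sigma>
        by auto
      then have "p = 0" "q = 0"
        using strongly_convex_rational_cone_pointed[OF sc] p q T\<sigma> by blast+
      then have "ta = 0" "tb = 0" using l by (auto simp: p_def q_def)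
      then show "a \<in> R" "b \<in> R" using ta tb by (auto simp: R_def)
    qed
    moreover have "R \<noteq> {}" by (auto simp: R_def)
    ultimately have "R \<in> \<Sigma>" using fan assms by (auto simp: fan_def cone_face_def)
    moreover have "dim R = 1"
    proof -
      have "span R = span {v}"
      proof (rule span_eq[THEN iffD2], intro conjI)
        show "R \<subseteq> span {v}" by (auto simp: R_def span_singleton)
        have "v \<in> R" by (auto simp: R_def intro: exI[of _ 1])
        then show "{v} \<subseteq> span R" by (simp add: span_base)
      qed
      then have "dim R = dim {v}" by (metis dim_span)
      then show ?thesis using v0 by simp
    qed
    ultimately have "R \<in> rays \<Sigma>" by (simp add: rays_def)
    then obtain j where j: "R = \<rho> j" using bij by (auto simp: bij_betw_def)
    have "u j \<in> R" unfolding j by (subst rho_eq) (auto intro: exI[of _ 1])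
    moreover have "v \<in> \<rho> j" unfolding j[symmetric] R_def by (auto intro: exI[of _ 1])
    then obtain c where "v = c *\<^sub>R u j" by (subst (asm) rho_eq) auto
    ultimately show ?thesis using R\<sigma> by (auto intro: span_scale span_base)
  qed
  then have "span S \<subseteq> span (u ` {j. u j \<in> \<sigma>})" by (intro span_minimal) auto
  then show ?thesis using S(2) convex_cone_subset_span[of S] by blast
qed

lemma card_spans_cone: "spans_cone F \<Longrightarrow> card F \<le> CARD('n)"
  and spans_cone_image_basis: "spans_cone F \<Longrightarrow> card F = CARD('n) \<Longrightarrow> lattice_basis (u ` F)"
proof -
  assume "spans_cone F"
  then obtain \<sigma> where \<sigma>: "\<sigma> \<in> \<Sigma>" "u ` F \<subseteq> \<sigma>" by (auto simp: spans_cone_def)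
  obtain B where B: "lattice_basis B" "u ` {j. u j \<in> \<sigma>} \<subseteq> B"
    using cone_lattice_basis[OF \<sigma>(1)] by blast
  have sub: "u ` F \<subseteq> B" using \<sigma>(2) B(2) by (auto simp: image_subset_iff)
  have fin: "finite B" using B(1) by (simp add: lattice_basis_def)
  have c: "card (u ` F) = card F" by (rule card_image) (rule inj_on_subset[OF inj_u subset_UNIV])
  have cB: "card B = CARD('n)" using B(1) by (rule lattice_basis_card(2))
  show "card F \<le> CARD('n)" using card_mono[OF fin sub] c cB by simp
  show "lattice_basis (u ` F)" if "card F = CARD('n)"
  proof -
    have "u ` F = B" using card_subset_eq[OF fin sub] c cB that by simp
    then show ?thesis using B(1) by simp
  qed
qed

text \<open>A small ball around an interior point of the cone over \<open>S\<close> meets only cones containing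
  \<open>S\<close>, and cones of smaller dimension cannot cover it.\<close>

lemma spans_cone_extend:
  assumes "spans_cone S"
  shows "\<exists>F. S \<subseteq> F \<and> spans_cone F \<and> card F = CARD('n)"
proof -
  obtain \<sigma>0 where \<sigma>0: "\<sigma>0 \<in> \<Sigma>" "u ` S \<subseteq> \<sigma>0" using assms by (auto simp: spans_cone_def)
  define p where "p = (\<Sum>j\<in>S. u j)"
  have fin: "finite \<Sigma>" using fan by (simp add: fan_def)
  have closed: "closed \<sigma>" if "\<sigma> \<in> \<Sigma>" for \<sigma>
    using fan that by (auto simp: fan_def strongly_convex_rational_cone_def intro: closed_convex_cone_hull)
  define N where "N = - \<Union>{\<sigma>\<in>\<Sigma>. p \<notin> \<sigma>}"
  have oN: "open N" unfolding N_def
    by (intro open_Compl closed_Union) (use fin closed in auto)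
  have pN: "p \<in> N" by (auto simp: N_def)
  have NU: "N \<subseteq> \<Union>{\<sigma>\<in>\<Sigma>. p \<in> \<sigma>}"
    using complete by (auto simp: N_def complete_fan_def)
  have "\<exists>\<sigma>\<in>\<Sigma>. p \<in> \<sigma> \<and> dim \<sigma> = CARD('n)"
  proof (rule ccontr)
    assume no: "\<not> ?thesis"
    have "negligible \<sigma>" if "\<sigma> \<in> \<Sigma>" "p \<in> \<sigma>" for \<sigma>
    proof -
      have "dim \<sigma> \<noteq> CARD('n)" using no that by blast
      moreover have "dim \<sigma> \<le> CARD('n)" using dim_subset_UNIV[of \<sigma>] by simp
      ultimately show ?thesis by (intro negligible_lowdim) simp
    qed
    then have "negligible (\<Union>{\<sigma>\<in>\<Sigma>. p \<in> \<sigma>})"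
      using fin by (intro negligible_Union) auto
    then have "negligible N" using NU by (rule negligible_subset)
    then show False using open_not_negligible[OF oN] pN by blast
  qed
  then obtain \<sigma> where \<sigma>: "\<sigma> \<in> \<Sigma>" "p \<in> \<sigma>" "dim \<sigma> = CARD('n)" by blast
  define F where "F = {j. u j \<in> \<sigma>}"
  have "u ` S \<subseteq> \<sigma>"
    by (rule cone_contains_rays[OF \<sigma>(1) \<sigma>0, of "\<lambda>_. 1"]) (use \<sigma> in \<open>auto simp: p_def\<close>)
  then have "S \<subseteq> F" by (auto simp: F_def)
  moreover have F: "spans_cone F" using \<sigma> by (auto simp: spans_cone_def F_def)
  moreover have "CARD('n) \<le> card F"
  proof -
    have "CARD('n) \<le> dim (u ` F)"
      using cone_subset_span_rays[OF \<sigma>(1)] \<sigma>(3) unfolding F_def by (metis dim_mono)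
    also have "\<dots> \<le> card (u ` F)" by (rule dim_le_card') simp
    also have "\<dots> \<le> card F" by (rule card_image_le) simp
    finally show ?thesis .
  qed
  ultimately show ?thesis using card_spans_cone[OF F] by (intro exI[of _ F]) auto
qed

end

section \<open>Disjoint primitive collections and selections of rays\<close>

locale affine_codimension_fan = smooth_complete_fan \<Sigma> \<rho>
  for \<Sigma> :: "(real ^ 'n) set set" and \<rho> :: "'m::finite \<Rightarrow> (real ^ 'n) set" +
  assumes codim: "affine_codimension_condition \<Sigma> \<rho>"
begin

text \<open>The complement of a maximal cone meets every primitive collection, and each of its elements
  is the only one in some primitive collection. As there are \<open>m - n\<close> collections, every
  collection meets the complement exactly once.\<close>

lemma PC_disjoint:
  assumes P: "P \<in> PC" and Q: "Q \<in> PC" and i: "i \<in> P" "i \<in> Q"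
  shows "P = Q"
proof -
  have "spans_cone (P - {i})" using i by (intro PC_psubset[OF P]) auto
  then obtain F where F: "P - {i} \<subseteq> F" "spans_cone F" "card F = CARD('n)"
    using spans_cone_extend by blast
  have "\<not> P \<subseteq> F" using PC_not_spans_cone[OF P] spans_cone_mono[OF F(2)] by blast
  then have iF: "i \<in> - F" using F(1) by blast
  have "\<exists>R\<in>PC. R \<inter> - F = {k}" if k: "k \<in> - F" for k
  proof -
    have "\<not> spans_cone (insert k F)"
      using card_spans_cone[of "insert k F"] F(3) k by auto
    then obtain R where R: "R \<in> PC" "R \<subseteq> insert k F" using spans_cone_iff by blast
    moreover have "\<not> R \<subseteq> F" using R F(2) spans_cone_iff by blast
    ultimately show ?thesis by blast
  qed
  then obtain R where R: "\<And>k. k \<in> - F \<Longrightarrow> R k \<in> PC \<and> R k \<inter> - F = {k}" by metis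
  have "inj_on R (- F)"
    by (rule inj_onI) (metis R singleton_inject)
  then have "card (R ` (- F)) = card (- F)" by (rule card_image)
  also have "int \<dots> = int CARD('m) - int CARD('n)"
    using F(3) by (simp add: int_card_Compl)
  finally have "card (R ` (- F)) = card PC"
    using codim by (simp add: affine_codimension_condition_def)
  then have "R ` (- F) = PC"
    using R by (intro card_subset_eq) auto
  \<comment> \<open>The only element of \<open>R k\<close> outside \<open>F\<close> is
    \<open>k\<close>; since \<open>i\<close> is outside \<open>F\<close>, both indices must be
    \<open>i\<close>.\<close>
  then have "P \<in> R ` (- F)" "Q \<in> R ` (- F)" using P Q by simp_all
  then obtain k l where k: "k \<in> - F" "P = R k" and l: "l \<in> - F" "Q = R l" by (elim imageE)
  have "i \<in> R k \<inter> - F" "i \<in> R l \<inter> - F" using k(2) l(2) i iF by auto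
  then have "i = k" "i = l" using R[OF k(1)] R[OF l(1)] by auto
  then show ?thesis using k(2) l(2) by simp
qed

definition selection :: "('m set \<Rightarrow> 'm) \<Rightarrow> bool" where
  "selection s \<longleftrightarrow> (\<forall>P\<in>PC. s P \<in> P)"

text \<open>The unselected rays contain no primitive collection, so they span a cone. Disjointness
  makes \<open>s\<close> injective, so there are m - (m - n) = n of them, and smoothness
  applies.\<close>

lemma selection_lattice_basis:
  assumes s: "selection s"
  shows "lattice_basis (u ` (- s ` PC))"
proof -
  have inj: "inj_on s PC"
  proof (rule inj_onI)
    fix P Q assume "P \<in> PC" "Q \<in> PC" "s P = s Q"
    moreover from this have "s P \<in> P" "s P \<in> Q" using s by (auto simp: selection_def)
    ultimately show "P = Q" by (rule_tac PC_disjoint)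
  qed
  have "spans_cone (- s ` PC)"
    unfolding spans_cone_iff
  proof (rule notI, elim bexE)
    fix P assume P: "P \<in> PC" "P \<subseteq> - s ` PC"
    then have "s P \<in> P" using s by (simp add: selection_def)
    then show False using P by auto
  qed
  moreover have "card (- s ` PC) = CARD('n)"
  proof -
    have "int (card (- s ` PC)) = int CARD('m) - int (card PC)"
      using card_image[OF inj] by (simp add: int_card_Compl)
    then show ?thesis using codim by (simp add: affine_codimension_condition_def)
  qed
  ultimately show ?thesis by (rule spans_cone_image_basis)
qed

end

subsection \<open>Integer relations between the ray generators\<close>

context affine_codimension_fan
begin

lemma selectionD: "selection s \<Longrightarrow> P \<in> PC \<Longrightarrow> s P \<in> P"
  by (simp add: selection_def)

lemma selection_eq: "selection s \<Longrightarrow> P \<in> PC \<Longrightarrow> Q \<in> PC \<Longrightarrow> s Q \<in> P \<Longrightarrow> Q = P"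
  by (rule PC_disjoint[of Q P "s Q"]) (simp_all add: selectionD)

lemma selection_eq_iff: "selection s \<Longrightarrow> P \<in> PC \<Longrightarrow> Q \<in> PC \<Longrightarrow> s Q = s P \<longleftrightarrow> Q = P"
  using selection_eq[of s P Q] selectionD[of s P] by auto

lemma selection_fun_upd: "selection s \<Longrightarrow> j \<in> P \<Longrightarrow> selection (s(P := j))"
  by (simp add: selection_def)

definition relation :: "('m \<Rightarrow> int) \<Rightarrow> bool" where
  "relation b \<longleftrightarrow> (\<Sum>j\<in>UNIV. of_int (b j) *\<^sub>R u j) = 0"

lemma ex_dual:
  assumes s: "selection s" and i: "i \<notin> s ` PC"
  shows "\<exists>w\<in>lattice_points. \<forall>k. k \<notin> s ` PC \<longrightarrow> w \<bullet> u k = (if k = i then 1 else 0)"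
proof -
  obtain w where w: "\<forall>b. w b \<in> lattice_points"
    "\<forall>b\<in>u ` (- s ` PC). \<forall>b'\<in>u ` (- s ` PC). w b \<bullet> b' = (if b = b' then 1 else 0)"
    using lattice_basis_dual[OF selection_lattice_basis[OF s]] by blast
  have "w (u i) \<bullet> u k = (if k = i then 1 else 0)" if "k \<notin> s ` PC" for k
  proof -
    have "w (u i) \<bullet> u k = (if u i = u k then 1 else 0)" using w(2) i that by simp
    then show ?thesis using inj_eq[OF inj_u, of i k] by auto
  qed
  then show ?thesis using w(1) by (intro bexI[of _ "w (u i)"]) auto
qed

text \<open>Expand \<open>- u (s P)\<close> in the lattice basis formed by the unselected
  rays.\<close>

lemma ex_relation:
  assumes s: "selection s" and P: "P \<in> PC"
  shows "\<exists>b. relation b \<and> (\<forall>Q\<in>PC. b (s Q) = (if Q = P then 1 else 0))"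
proof -
  define F where "F = - s ` PC"
  have "lattice_basis (u ` F)" unfolding F_def using s by (rule selection_lattice_basis)
  moreover have "- u (s P) \<in> lattice_points" by (intro lattice_points_minus u_lattice)
  ultimately obtain k :: "real ^ 'n \<Rightarrow> int" where "- u (s P) = (\<Sum>b\<in>u ` F. of_int (k b) *\<^sub>R b)"
    unfolding lattice_basis_def by metis
  also have "\<dots> = (\<Sum>j\<in>F. of_int (k (u j)) *\<^sub>R u j)"
    by (subst sum.reindex) (auto intro: inj_on_subset[OF inj_u])
  finally have k: "(\<Sum>j\<in>F. of_int (k (u j)) *\<^sub>R u j) = - u (s P)" by simp
  define b where "b j = (if j \<in> F then k (u j) else if j = s P then 1 else 0)" for j
  have sPF: "s P \<notin> F" using P by (simp add: F_def)
  have "(\<Sum>j\<in>UNIV. of_int (b j) *\<^sub>R u j) =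
      (\<Sum>j\<in>F. of_int (b j) *\<^sub>R u j) + (\<Sum>j\<in>- F. of_int (b j) *\<^sub>R u j)"
    using sum.union_disjoint[of F "- F" "\<lambda>j. of_int (b j) *\<^sub>R u j"] by simp
  also have "(\<Sum>j\<in>F. of_int (b j) *\<^sub>R u j) = - u (s P)"
    unfolding k[symmetric] by (rule sum.cong) (simp_all add: b_def)
  also have "(\<Sum>j\<in>- F. of_int (b j) *\<^sub>R u j) = (\<Sum>j\<in>- F. if s P = j then u j else 0)"
    by (rule sum.cong) (simp_all add: b_def)
  also have "\<dots> = u (s P)" using sPF by simp
  finally have "relation b" by (simp add: relation_def)
  moreover have "\<forall>Q\<in>PC. b (s Q) = (if Q = P then 1 else 0)"
    using selection_eq_iff[OF s P] by (simp add: b_def F_def)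
  ultimately show ?thesis by blast
qed

text \<open>The relations form the cocharacter lattice of the torus \<open>G\<close>, and these are
  its basis elements dual to the selected coordinates. The choice is harmless:
  \<open>relation_zero\<close> makes them unique.\<close>

definition rel_basis :: "('m set \<Rightarrow> 'm) \<Rightarrow> 'm set \<Rightarrow> 'm \<Rightarrow> int" where
  "rel_basis s P = (SOME b. relation b \<and> (\<forall>Q\<in>PC. b (s Q) = (if Q = P then 1 else 0)))"

lemma rel_basis:
  assumes "selection s" and "P \<in> PC"
  shows "relation (rel_basis s P)"
    and "Q \<in> PC \<Longrightarrow> rel_basis s P (s Q) = (if Q = P then 1 else 0)"
proof -
  have *: "relation (rel_basis s P) \<and> (\<forall>Q\<in>PC. rel_basis s P (s Q) = (if Q = P then 1 else 0))"
    unfolding rel_basis_def by (rule someI_ex[OF ex_relation[OF assms]])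
  then show "relation (rel_basis s P)" by (rule conjunct1)
  show "rel_basis s P (s Q) = (if Q = P then 1 else 0)" if "Q \<in> PC"
    using * that by simp
qed

lemma relation_inner:
  assumes "relation b"
  shows "(\<Sum>j\<in>UNIV. of_int (b j) * (w \<bullet> u j)) = 0"
proof -
  have "w \<bullet> (\<Sum>j\<in>UNIV. of_int (b j) *\<^sub>R u j) = 0" using assms by (simp add: relation_def)
  then show ?thesis by (simp add: inner_sum_right)
qed

text \<open>Pairing the relation with the dual vector of an unselected ray \<open>i\<close> leaves
  only the coefficient \<open>b i\<close>.\<close>

lemma relation_zero:
  assumes s: "selection s" and b: "relation b" and zero: "\<And>Q. Q \<in> PC \<Longrightarrow> b (s Q) = 0"
  shows "b i = 0"
proof (cases "i \<in> s ` PC")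
  case False
  then obtain w where w: "\<forall>k. k \<notin> s ` PC \<longrightarrow> w \<bullet> u k = (if k = i then 1 else 0)"
    using ex_dual[OF s] by blast
  have "0 = (\<Sum>j\<in>UNIV. of_int (b j) * (w \<bullet> u j))" using relation_inner[OF b] by simp
  also have "\<dots> = (\<Sum>j\<in>UNIV. if i = j then of_int (b j) else 0)"
  proof (rule sum.cong[OF refl])
    fix j
    show "of_int (b j) * (w \<bullet> u j) = (if i = j then of_int (b j) else 0)"
      using w zero False by (cases "j \<in> s ` PC") auto
  qed
  finally show ?thesis by simp
qed (use zero in auto)

text \<open>The difference of the two sides is a relation that vanishes on all selected
  rays.\<close>

lemma relation_expand:
  assumes s: "selection s" and c: "relation c"
  shows "c j = (\<Sum>P\<in>PC. c (s P) * rel_basis s P j)"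
proof -
  define d where "d j = c j - (\<Sum>P\<in>PC. c (s P) * rel_basis s P j)" for j
  have "(\<Sum>j\<in>UNIV. of_int (d j) *\<^sub>R u j) = (\<Sum>j\<in>UNIV. of_int (c j) *\<^sub>R u j) -
      (\<Sum>j\<in>UNIV. \<Sum>P\<in>PC. of_int (c (s P)) *\<^sub>R of_int (rel_basis s P j) *\<^sub>R u j)"
    by (simp add: d_def scaleR_diff_left sum_subtractf scaleR_sum_left)
  also have "\<dots> = - (\<Sum>P\<in>PC. of_int (c (s P)) *\<^sub>R (\<Sum>j\<in>UNIV. of_int (rel_basis s P j) *\<^sub>R u j))"
    using c by (subst sum.swap) (simp add: relation_def scaleR_sum_right)
  also have "\<dots> = 0" using rel_basis(1)[OF s] by (simp add: relation_def)
  finally have d: "relation d" by (simp add: relation_def)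
  have "d (s Q) = 0" if Q: "Q \<in> PC" for Q
  proof -
    have "(\<Sum>P\<in>PC. c (s P) * rel_basis s P (s Q)) = (\<Sum>P\<in>PC. if Q = P then c (s P) else 0)"
      using rel_basis(2)[OF s _ Q] by (intro sum.cong) auto
    then show ?thesis using Q by (simp add: d_def)
  qed
  then have "d j = 0" by (rule relation_zero[OF s d])
  then show ?thesis by (simp add: d_def)
qed

lemma relation_sign_int:
  assumes "relation b" and "b i \<noteq> 0"
  shows "\<exists>P\<in>PC. (\<forall>j\<in>P. b j > 0) \<or> (\<forall>j\<in>P. b j < 0)"
  using relation_sign[of "\<lambda>j. of_int (b j)" i] assms by (simp add: relation_def)

text \<open>Positivity comes from the geometry of the fan, and \<open>\<plusminus>1\<close> from the smoothness of the
  cones of the two selections \<open>s\<close> and \<open>s(P := j)\<close>.\<close>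

lemma rel_basis_self:
  assumes s: "selection s" and P: "P \<in> PC" and j: "j \<in> P"
  shows "rel_basis s P j = 1"
proof -
  have "rel_basis s P (s P) \<noteq> 0" using rel_basis(2)[OF s P P] by simp
  then obtain Q where Q: "Q \<in> PC" "(\<forall>j\<in>Q. rel_basis s P j > 0) \<or> (\<forall>j\<in>Q. rel_basis s P j < 0)"
    using relation_sign_int[OF rel_basis(1)[OF s P]] by blast
  have "s Q \<in> Q" using s Q(1) by (rule selectionD)
  then have "Q = P \<and> (\<forall>j\<in>Q. rel_basis s P j > 0)"
    using Q(2) rel_basis(2)[OF s P Q(1)] by (auto split: if_splits)
  then have pos: "rel_basis s P j > 0" using j by blast
  define s' where "s' = s(P := j)"
  have s': "selection s'" unfolding s'_def using s j by (rule selection_fun_upd)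
  \<comment> \<open>The relation \<open>c\<close> belongs to the modified selection and vanishes on
    \<open>s Q\<close> for all other \<open>Q\<close>, so it is an integer multiple of
    \<open>rel_basis s P\<close>. Evaluation at \<open>j\<close> writes 1 as a product of two
    integers, one of them positive.\<close>
  define c where "c = rel_basis s' P"
  have cQ: "c (s Q) = 0" if "Q \<in> PC" "Q \<noteq> P" for Q
    using rel_basis(2)[OF s' P that(1)] that(2) by (simp add: c_def s'_def)
  have "1 = c j" using rel_basis(2)[OF s' P P] by (simp add: c_def s'_def)
  also have "\<dots> = (\<Sum>Q\<in>PC. c (s Q) * rel_basis s Q j)"
    unfolding c_def by (rule relation_expand[OF s rel_basis(1)[OF s' P]])
  also have "\<dots> = (\<Sum>Q\<in>PC. if P = Q then c (s P) * rel_basis s P j else 0)"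
    using cQ by (intro sum.cong) auto
  also have "\<dots> = c (s P) * rel_basis s P j" using P by simp
  finally have "rel_basis s P j * c (s P) = 1" by (simp add: mult.commute)
  then show ?thesis using pos pos_zmult_eq_1_iff by blast
qed

text \<open>A pair \<open>(P, Q)\<close> means that the torus coordinate of \<open>P\<close> enters
  the action on some variable of \<open>Q\<close>, so \<open>P\<close> has to be solved before
  \<open>Q\<close>.\<close>

definition dep :: "('m set \<Rightarrow> 'm) \<Rightarrow> ('m set \<times> 'm set) set" where
  "dep s = {(P, Q). P \<in> PC \<and> Q \<in> PC \<and> P \<noteq> Q \<and> (\<exists>j\<in>Q. rel_basis s P j \<noteq> 0)}"

text \<open>In a minimal set \<open>C\<close> of collections in which each has a predecessor, the predecessor \<open>g\<close> is unique
  and a permutation. Let \<open>c\<close> be the relation of a selection that picks on \<open>C\<close> the rays witnessing the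
  dependencies. Comparing \<open>\<Sum>\<^sub>Q \<bar>c (s Q)\<bar>\<close> with \<open>\<Sum>\<^sub>Q \<bar>c (s (g Q))\<bar>\<close> over \<open>Q \<in> C\<close> gives a
  contradiction.\<close>

lemma wf_dep:
  assumes s: "selection s"
  shows "wf (dep s)"
proof (rule ccontr)
  assume "\<not> wf (dep s)"
  define closed where "closed C \<longleftrightarrow> C \<noteq> {} \<and> (\<forall>Q\<in>C. \<exists>P\<in>C. (P, Q) \<in> dep s)" for C
  obtain X x where X: "x \<in> X" "\<forall>z\<in>X. \<exists>y. (y, z) \<in> dep s \<and> y \<in> X"
    using \<open>\<not> wf (dep s)\<close> by (auto simp: wf_eq_minimal)
  have "closed X" unfolding closed_def using X by auto
  then have "\<exists>C. closed C" ..
  then have "\<exists>C\<in>{C. closed C}. \<forall>D\<in>{C. closed C}. D \<subseteq> C \<longrightarrow> C = D"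
    by (intro finite_has_minimal) auto
  then obtain C where C: "closed C" and min: "\<And>D. closed D \<Longrightarrow> D \<subseteq> C \<Longrightarrow> D = C" by blast
  have ne: "C \<noteq> {}" using C by (simp add: closed_def)
  have "\<forall>Q\<in>C. \<exists>P. P \<in> C \<and> (P, Q) \<in> dep s" using C by (auto simp: closed_def)
  then obtain g where g: "\<And>Q. Q \<in> C \<Longrightarrow> g Q \<in> C" "\<And>Q. Q \<in> C \<Longrightarrow> (g Q, Q) \<in> dep s" by metis
  have CPC: "C \<subseteq> PC" using g(2) by (auto simp: dep_def)
  \<comment> \<open>The image of a predecessor map is again closed: an element \<open>Q\<close> of
    the image lies in \<open>C\<close>, and its predecessor \<open>h Q\<close> is in the
    image.\<close>
  have onto: "h ` C = C" if h: "\<And>Q. Q \<in> C \<Longrightarrow> h Q \<in> C" "\<And>Q. Q \<in> C \<Longrightarrow> (h Q, Q) \<in> dep s" for h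
  proof (rule min)
    have "\<exists>P\<in>h ` C. (P, Q) \<in> dep s" if "Q \<in> h ` C" for Q
    proof -
      have "Q \<in> C" using that h(1) by auto
      then show ?thesis using h(2) by blast
    qed
    then show "closed (h ` C)" using ne by (simp add: closed_def)
    show "h ` C \<subseteq> C" using h(1) by auto
  qed
  have gC: "g ` C = C" using g by (rule onto)
  then have inj: "inj_on g C" by (intro eq_card_imp_inj_on) simp_all
  have pred_unique: "P = g Q" if PQ: "P \<in> C" "Q \<in> C" "(P, Q) \<in> dep s" for P Q
  proof (rule ccontr)
    assume neq: "P \<noteq> g Q"
    \<comment> \<open>Redirecting \<open>g\<close> at \<open>Q\<close> to \<open>P\<close> gives
      another predecessor map, hence another surjection; but by injectivity of \<open>g\<close>
      nothing is mapped to \<open>g Q\<close> any more.\<close>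
    have "(g(Q := P)) ` C = C" using g PQ by (intro onto) auto
    then have "g Q \<in> (g(Q := P)) ` C" using g(1)[OF PQ(2)] by simp
    then obtain R where R: "R \<in> C" "g Q = (g(Q := P)) R" by (elim imageE)
    then have "R \<noteq> Q" "g Q = g R" using neq by (auto split: if_splits)
    then show False using inj R(1) PQ(2) by (auto dest: inj_onD)
  qed
  have "\<forall>Q\<in>C. \<exists>j. j \<in> Q \<and> rel_basis s (g Q) j \<noteq> 0" using g(2) by (auto simp: dep_def)
  then obtain wit where wit: "\<And>Q. Q \<in> C \<Longrightarrow> wit Q \<in> Q" "\<And>Q. Q \<in> C \<Longrightarrow> rel_basis s (g Q) (wit Q) \<noteq> 0"
    by metis
  define s' where "s' Q = (if Q \<in> C then wit Q else s Q)" for Q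
  have s': "selection s'" using s wit(1) by (auto simp: s'_def selection_def)
  obtain P0 where P0: "P0 \<in> C" using ne by blast
  then have P0': "P0 \<in> PC" using CPC by blast
  define c where "c = rel_basis s' P0"
  have c: "relation c" unfolding c_def by (rule rel_basis(1)[OF s' P0'])
  have cs: "c (s Q) = 0" if "Q \<in> PC" "Q \<notin> C" for Q
    using rel_basis(2)[OF s' P0' that(1)] that P0 by (auto simp: c_def s'_def)
  have cw: "c (wit Q) = (if Q = P0 then 1 else 0)" if "Q \<in> C" for Q
    using rel_basis(2)[OF s' P0' subsetD[OF CPC that]] that by (simp add: c_def s'_def)
  \<comment> \<open>In the expansion at \<open>wit Q\<close> only \<open>Q\<close> and its unique
    predecessor survive: outside \<open>C\<close> the coefficient \<open>c (s P)\<close> is zero,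
    and the other members of \<open>C\<close> do not precede \<open>Q\<close>.\<close>
  have step: "c (wit Q) = c (s Q) + c (s (g Q)) * rel_basis s (g Q) (wit Q)" if Q: "Q \<in> C" for Q
  proof -
    have gQ: "g Q \<noteq> Q" "g Q \<in> C" using g Q by (auto simp: dep_def)
    have "c (wit Q) = (\<Sum>P\<in>PC. c (s P) * rel_basis s P (wit Q))" by (rule relation_expand[OF s c])
    also have "\<dots> = (\<Sum>P\<in>{Q, g Q}. c (s P) * rel_basis s P (wit Q))"
    proof (rule sum.mono_neutral_right)
      show "\<forall>P\<in>PC - {Q, g Q}. c (s P) * rel_basis s P (wit Q) = 0"
      proof
        fix P assume P: "P \<in> PC - {Q, g Q}"
        show "c (s P) * rel_basis s P (wit Q) = 0"
        proof (cases "P \<in> C")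
          case True
          then have "(P, Q) \<notin> dep s" using pred_unique Q P by blast
          then show ?thesis using P Q CPC wit(1)[OF Q] by (auto simp: dep_def)
        qed (use cs P in simp)
      qed
    qed (use Q gQ CPC in auto)
    also have "\<dots> = c (s Q) * rel_basis s Q (wit Q) + c (s (g Q)) * rel_basis s (g Q) (wit Q)"
      using gQ by simp
    also have "rel_basis s Q (wit Q) = 1"
      using rel_basis_self[OF s] Q CPC wit(1) by blast
    finally show ?thesis by simp
  qed
  \<comment> \<open>A collection on which \<open>c\<close> has constant sign is in \<open>C\<close>,
    since \<open>c (s P)\<close> vanishes elsewhere, and \<open>c\<close> is nonzero at its witness.
    This leaves \<open>P0\<close>, where the sign is positive.\<close>
  have "c (wit P0) \<noteq> 0" using cw P0 by simp
  then obtain P where P: "P \<in> PC" "(\<forall>j\<in>P. c j > 0) \<or> (\<forall>j\<in>P. c j < 0)"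
    using relation_sign_int[OF c] by blast
  have "P \<in> C"
  proof (rule ccontr)
    assume "P \<notin> C"
    then have "c (s P) = 0" using cs P(1) by blast
    then show False using P selectionD[OF s P(1)] by force
  qed
  then have "P = P0" using P(2) cw[of P] wit(1)[of P] by (force split: if_splits)
  then have pos: "c (s P0) > 0"
    using P(2) cw[OF P0] wit(1)[OF P0] selectionD[OF s P0'] by force
  have "(\<Sum>Q\<in>C. \<bar>c (s Q)\<bar>) = (\<Sum>Q\<in>C. \<bar>c (s (g Q))\<bar>)"
    using sum.reindex[OF inj, of "\<lambda>Q. \<bar>c (s Q)\<bar>"] gC by simp
  also have "\<dots> \<le> (\<Sum>Q\<in>C. \<bar>c (s Q) - c (wit Q)\<bar>)"
  proof (rule sum_mono)
    fix Q assume Q: "Q \<in> C"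
    have "1 \<le> \<bar>rel_basis s (g Q) (wit Q)\<bar>" using wit(2)[OF Q] by linarith
    then have "\<bar>c (s (g Q))\<bar> \<le> \<bar>c (s (g Q))\<bar> * \<bar>rel_basis s (g Q) (wit Q)\<bar>"
      using mult_left_mono[of 1 _ "\<bar>c (s (g Q))\<bar>"] by simp
    then show "\<bar>c (s (g Q))\<bar> \<le> \<bar>c (s Q) - c (wit Q)\<bar>"
      using step[OF Q] by (simp add: abs_mult)
  qed
  \<comment> \<open>The terms agree except at \<open>P0\<close>, where subtracting
    \<open>c (wit P0) = 1\<close> from the positive integer \<open>c (s P0)\<close> lowers the
    absolute value.\<close>
  also have "\<dots> < (\<Sum>Q\<in>C. \<bar>c (s Q)\<bar>)"
  proof (rule sum_strict_mono_ex1)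
    show "\<forall>Q\<in>C. \<bar>c (s Q) - c (wit Q)\<bar> \<le> \<bar>c (s Q)\<bar>" using cw pos by auto
    show "\<exists>Q\<in>C. \<bar>c (s Q) - c (wit Q)\<bar> < \<bar>c (s Q)\<bar>" using cw[OF P0] pos P0 by force
  qed simp
  finally show False by simp
qed

end

subsection \<open>Evaluation of polynomials\<close>

lemma eval_poly_superset:
  fixes f :: "'k::finite mpoly"
  assumes "finite A" and "Poly_Mapping.keys f \<subseteq> A"
  shows "eval_poly f x = (\<Sum>a\<in>A. Poly_Mapping.lookup f a * (\<Prod>k\<in>UNIV. x k ^ Poly_Mapping.lookup a k))"
  unfolding eval_poly_def
  by (rule sum.mono_neutral_left) (use assms in \<open>auto simp: in_keys_iff\<close>)

lemma eval_poly_single [simp]: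
  "eval_poly (Poly_Mapping.single a c) x = c * (\<Prod>k\<in>UNIV. x k ^ Poly_Mapping.lookup a k)"
  by (subst eval_poly_superset[of "{a}"]) auto

lemma eval_poly_zero [simp]: "eval_poly 0 x = 0"
  by (simp add: eval_poly_def)

lemma eval_poly_add [simp]: "eval_poly (f + g) x = eval_poly f x + eval_poly g x"
proof -
  let ?A = "Poly_Mapping.keys f \<union> Poly_Mapping.keys g"
  have "Poly_Mapping.keys (f + g) \<subseteq> ?A" by (rule Poly_Mapping.keys_add)
  then show ?thesis
    by (simp add: eval_poly_superset[of ?A] lookup_add distrib_right sum.distrib)
qed

lemma eval_poly_sum [simp]: "eval_poly (\<Sum>i\<in>A. f i) x = (\<Sum>i\<in>A. eval_poly (f i) x)"
  by (induction A rule: infinite_finite_induct) simp_all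

lemma sum_single_lookup: "(\<Sum>a\<in>Poly_Mapping.keys f. Poly_Mapping.single a (Poly_Mapping.lookup f a)) = f"
proof (rule poly_mapping_eqI)
  fix b
  have "Poly_Mapping.lookup (\<Sum>a\<in>Poly_Mapping.keys f. Poly_Mapping.single a (Poly_Mapping.lookup f a)) b
      = (\<Sum>a\<in>Poly_Mapping.keys f. if a = b then Poly_Mapping.lookup f a else 0)"
    unfolding lookup_sum by (rule sum.cong) (auto simp: lookup_single)
  also have "\<dots> = Poly_Mapping.lookup f b" by (simp add: in_keys_iff)
  finally show "Poly_Mapping.lookup (\<Sum>a\<in>Poly_Mapping.keys f. Poly_Mapping.single a (Poly_Mapping.lookup f a)) b
      = Poly_Mapping.lookup f b" .
qed

lemma eval_poly_mult [simp]:
  fixes f g :: "'k::finite mpoly"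
  shows "eval_poly (f * g) x = eval_poly f x * eval_poly g x"
proof -
  define m where "m a = (\<Prod>k\<in>UNIV. x k ^ Poly_Mapping.lookup a k)" for a :: "'k \<Rightarrow>\<^sub>0 nat"
  have m: "m (a + b) = m a * m b" for a b
    by (simp add: m_def lookup_add power_add prod.distrib)
  have "f * g = (\<Sum>a\<in>Poly_Mapping.keys f. Poly_Mapping.single a (Poly_Mapping.lookup f a)) *
      (\<Sum>b\<in>Poly_Mapping.keys g. Poly_Mapping.single b (Poly_Mapping.lookup g b))"
    by (simp only: sum_single_lookup)
  also have "\<dots> = (\<Sum>a\<in>Poly_Mapping.keys f. \<Sum>b\<in>Poly_Mapping.keys g.
      Poly_Mapping.single (a + b) (Poly_Mapping.lookup f a * Poly_Mapping.lookup g b))"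
    by (simp add: sum_product mult_single)
  finally have "eval_poly (f * g) x = (\<Sum>a\<in>Poly_Mapping.keys f. \<Sum>b\<in>Poly_Mapping.keys g.
      (Poly_Mapping.lookup f a * m a) * (Poly_Mapping.lookup g b * m b))"
    by (simp add: m_def[symmetric] m mult_ac)
  then show ?thesis
    by (simp add: eval_poly_def m_def[symmetric] sum_product)
qed

lemma eval_poly_var [simp]: "eval_poly (var k) x = x k"
proof -
  have "(\<Prod>i\<in>UNIV. x i ^ Poly_Mapping.lookup (Poly_Mapping.single k (1::nat)) i) = (\<Prod>i\<in>UNIV. if k = i then x i else 1)"
    by (rule prod.cong) (auto simp: lookup_single)
  then show ?thesis by (simp add: var_def)
qed

lemma eval_poly_const [simp]: "eval_poly (const c) x = c"
  by (simp add: const_def)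

lemma eval_poly_one [simp]: "eval_poly 1 x = 1"
  using eval_poly_const[of 1 x] by (simp add: const_def)

lemma eval_poly_uminus [simp]: "eval_poly (- f) x = - eval_poly f x"
  using eval_poly_add[of f "- f" x] by (simp add: eq_neg_iff_add_eq_0 add.commute)

lemma eval_poly_diff [simp]: "eval_poly (f - g) x = eval_poly f x - eval_poly g x"
  using eval_poly_add[of f "- g" x] by simp

lemma affine_V_ideal_generated: "affine_V (ideal_generated S) = affine_V S"
proof (intro equalityI subsetI)
  fix x assume x: "x \<in> affine_V S"
  have "eval_poly f x = 0" if "f \<in> ideal_generated S" for f
    using that by (induction rule: ideal.span_induct_alt) (use x in \<open>auto simp: affine_V_def\<close>)
  then show "x \<in> affine_V (ideal_generated S)" by (simp add: affine_V_def)
qed (auto simp: affine_V_def intro: ideal.span_base)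

subsection \<open>Noetherianity\<close>

text \<open>Hilbert's basis theorem as the ascending chain condition. An "ideal" is an additive subgroup
  of \<open>A\<close> closed under multiplication by the generators in \<open>M\<close>, so that passing from \<open>A\<close> to \<open>A[x]\<close>
  only adds \<open>x\<close> to \<open>M\<close>.\<close>

definition stable :: "'a::comm_ring_1 set \<Rightarrow> 'a set \<Rightarrow> bool" where
  "stable M I \<longleftrightarrow> 0 \<in> I \<and> (\<forall>f\<in>I. \<forall>g\<in>I. f - g \<in> I) \<and> (\<forall>c\<in>M. \<forall>f\<in>I. c * f \<in> I)"

lemma stableD:
  assumes "stable M I"
  shows "0 \<in> I" "f \<in> I \<Longrightarrow> g \<in> I \<Longrightarrow> f - g \<in> I" "c \<in> M \<Longrightarrow> f \<in> I \<Longrightarrow> c * f \<in> I"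
    "f \<in> I \<Longrightarrow> g \<in> I \<Longrightarrow> f + g \<in> I"
proof -
  show 1: "0 \<in> I" and 2: "f \<in> I \<Longrightarrow> g \<in> I \<Longrightarrow> f - g \<in> I" and "c \<in> M \<Longrightarrow> f \<in> I \<Longrightarrow> c * f \<in> I" for f g c
    using assms by (auto simp: stable_def)
  show "f + g \<in> I" if "f \<in> I" "g \<in> I"
    using 2[OF that(1) 2[OF 1 that(2)]] by simp
qed

definition acc :: "'a::comm_ring_1 set \<Rightarrow> 'a set \<Rightarrow> bool" where
  "acc A M \<longleftrightarrow> (\<forall>I::nat \<Rightarrow> 'a set. (\<forall>i. stable M (I i) \<and> I i \<subseteq> A \<and> I i \<subseteq> I (Suc i)) \<longrightarrow>
     (\<exists>n. \<forall>i\<ge>n. I i = I n))"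

text \<open>Polynomial expressions in \<open>x\<close> of degree strictly below \<open>d\<close>. As
  \<open>x\<close> need not be transcendental over \<open>A\<close>, this is a filtration and not a
  degree: coefficients need not be unique.\<close>

fun adjoin_upto :: "'a::comm_ring_1 set \<Rightarrow> 'a \<Rightarrow> nat \<Rightarrow> 'a set" where
  "adjoin_upto A x 0 = {0}"
| "adjoin_upto A x (Suc d) = {f + a * x ^ d |f a. f \<in> adjoin_upto A x d \<and> a \<in> A}"

definition adjoin :: "'a::comm_ring_1 set \<Rightarrow> 'a \<Rightarrow> 'a set" where
  "adjoin A x = (\<Union>d. adjoin_upto A x d)"

lemma adjoin_upto_SucI: "f \<in> adjoin_upto A x d \<Longrightarrow> a \<in> A \<Longrightarrow> f + a * x ^ d \<in> adjoin_upto A x (Suc d)"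
  by auto

lemma adjoin_upto_SucE:
  assumes "f \<in> adjoin_upto A x (Suc d)"
  obtains g a where "f = g + a * x ^ d" "g \<in> adjoin_upto A x d" "a \<in> A"
  using assms by auto

declare adjoin_upto.simps(2) [simp del]

lemma adjoin_upto_mono:
  assumes "0 \<in> A" and "d \<le> e"
  shows "adjoin_upto A x d \<subseteq> adjoin_upto A x e"
proof -
  have "adjoin_upto A x n \<subseteq> adjoin_upto A x (Suc n)" for n
    using adjoin_upto_SucI[of _ A x n 0] assms(1) by auto
  then show ?thesis using lift_Suc_mono_le[of "adjoin_upto A x"] assms(2) by blast
qed

lemma stable_adjoin_upto:
  assumes "stable M A"
  shows "stable M (adjoin_upto A x d)"
proof (induction d)
  case 0 then show ?case by (simp add: stable_def)
next
  case (Suc d)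
  show ?case
    unfolding stable_def
  proof (intro conjI ballI)
    show "0 \<in> adjoin_upto A x (Suc d)"
      using adjoin_upto_SucI[OF stableD(1)[OF Suc] stableD(1)[OF assms]] by simp
  next
    fix f g assume "f \<in> adjoin_upto A x (Suc d)" and g: "g \<in> adjoin_upto A x (Suc d)"
    from this(1) obtain f' a where f': "f = f' + a * x ^ d" "f' \<in> adjoin_upto A x d" "a \<in> A"
      by (rule adjoin_upto_SucE)
    from g obtain g' b where g': "g = g' + b * x ^ d" "g' \<in> adjoin_upto A x d" "b \<in> A"
      by (rule adjoin_upto_SucE)
    have "f - g = (f' - g') + (a - b) * x ^ d" by (simp add: f' g' algebra_simps)
    then show "f - g \<in> adjoin_upto A x (Suc d)"
      using adjoin_upto_SucI[OF stableD(2)[OF Suc f'(2) g'(2)] stableD(2)[OF assms f'(3) g'(3)]] by simp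
  next
    fix c f assume c: "c \<in> M" and "f \<in> adjoin_upto A x (Suc d)"
    from this(2) obtain f' a where f': "f = f' + a * x ^ d" "f' \<in> adjoin_upto A x d" "a \<in> A"
      by (rule adjoin_upto_SucE)
    have "c * f = c * f' + (c * a) * x ^ d" by (simp add: f' algebra_simps)
    then show "c * f \<in> adjoin_upto A x (Suc d)"
      using adjoin_upto_SucI[OF stableD(3)[OF Suc c f'(2)] stableD(3)[OF assms c f'(3)]] by simp
  qed
qed

lemma adjoin_upto_mult_x:
  assumes A: "0 \<in> A" shows "f \<in> adjoin_upto A x d \<Longrightarrow> x * f \<in> adjoin_upto A x (Suc d)"
proof (induction d arbitrary: f)
  case 0
  then show ?case using adjoin_upto_SucI[of 0 A x 0 0] A by simp
next
  case (Suc d)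
  from Suc.prems obtain f' a where f': "f = f' + a * x ^ d" "f' \<in> adjoin_upto A x d" "a \<in> A"
    by (rule adjoin_upto_SucE)
  have "x * f = x * f' + a * x ^ Suc d" by (simp add: f' algebra_simps)
  then show ?case using adjoin_upto_SucI[OF Suc.IH[OF f'(2)] f'(3)] by simp
qed

lemma stable_adjoin:
  assumes "stable M A"
  shows "stable (insert x M) (adjoin A x)"
  unfolding stable_def
proof (intro conjI ballI)
  have z: "0 \<in> A" using assms by (rule stableD)
  show "0 \<in> adjoin A x" using stableD(1)[OF stable_adjoin_upto[OF assms]] by (auto simp: adjoin_def)
  show "f - g \<in> adjoin A x" if fg: "f \<in> adjoin A x" "g \<in> adjoin A x" for f g
  proof -
    obtain d e where "f \<in> adjoin_upto A x d" "g \<in> adjoin_upto A x e" using fg by (auto simp: adjoin_def)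
    then have "f \<in> adjoin_upto A x (max d e)" "g \<in> adjoin_upto A x (max d e)"
      using adjoin_upto_mono[OF z, of d "max d e"] adjoin_upto_mono[OF z, of e "max d e"] by auto
    then have "f - g \<in> adjoin_upto A x (max d e)" by (rule stableD(2)[OF stable_adjoin_upto[OF assms]])
    then show ?thesis unfolding adjoin_def by blast
  qed
  show "c * f \<in> adjoin A x" if cf: "c \<in> insert x M" "f \<in> adjoin A x" for c f
  proof -
    obtain d where d: "f \<in> adjoin_upto A x d" using cf by (auto simp: adjoin_def)
    have "c * f \<in> adjoin_upto A x (Suc d) \<or> c * f \<in> adjoin_upto A x d"
      using cf(1) adjoin_upto_mult_x[OF z d] stableD(3)[OF stable_adjoin_upto[OF assms] _ d] by blast
    then show ?thesis unfolding adjoin_def by blast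
  qed
qed

lemma subset_adjoin: assumes "stable M A" shows "A \<subseteq> adjoin A x"
proof
  fix a assume "a \<in> A"
  then have "a \<in> adjoin_upto A x (Suc 0)" using adjoin_upto_SucI[of 0 A x 0 a] by simp
  then show "a \<in> adjoin A x" unfolding adjoin_def by blast
qed

text \<open>The possible coefficients at \<open>x ^ d\<close> of elements of \<open>I\<close> of
  degree at most \<open>d\<close>.\<close>

definition leading :: "'a::comm_ring_1 set \<Rightarrow> 'a \<Rightarrow> 'a set \<Rightarrow> nat \<Rightarrow> 'a set" where
  "leading A x I d = {a \<in> A. \<exists>f\<in>I. f - a * x ^ d \<in> adjoin_upto A x d}"

lemma stable_leading:
  assumes A: "stable M A" and I: "stable (insert x M) I"
  shows "stable M (leading A x I d)"
  unfolding stable_def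
proof (intro conjI ballI)
  note B = stable_adjoin_upto[OF A, of x d]
  show "0 \<in> leading A x I d"
    using stableD(1)[OF A] stableD(1)[OF B] stableD(1)[OF I] by (auto simp: leading_def intro!: bexI[of _ 0])
  fix a assume "a \<in> leading A x I d"
  then obtain f where f: "a \<in> A" "f \<in> I" "f - a * x ^ d \<in> adjoin_upto A x d" by (auto simp: leading_def)
  show "a - b \<in> leading A x I d" if b: "b \<in> leading A x I d" for b
  proof -
    obtain g where g: "b \<in> A" "g \<in> I" "g - b * x ^ d \<in> adjoin_upto A x d"
      using b by (auto simp: leading_def)
    have eq: "(f - g) - (a - b) * x ^ d = (f - a * x ^ d) - (g - b * x ^ d)" by (simp add: algebra_simps)
    have "(f - g) - (a - b) * x ^ d \<in> adjoin_upto A x d"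
      unfolding eq by (rule stableD(2)[OF B f(3) g(3)])
    then show ?thesis using stableD(2)[OF A f(1) g(1)] stableD(2)[OF I f(2) g(2)] by (auto simp: leading_def)
  qed
  show "c * a \<in> leading A x I d" if "c \<in> M" for c
  proof -
    have eq: "c * f - (c * a) * x ^ d = c * (f - a * x ^ d)" by (simp add: algebra_simps)
    have "c * f - (c * a) * x ^ d \<in> adjoin_upto A x d"
      unfolding eq by (rule stableD(3)[OF B that f(3)])
    then show ?thesis using stableD(3)[OF A that f(1)] stableD(3)[OF I _ f(2), of c] that
      by (auto simp: leading_def)
  qed
qed

lemma leading_mono: "I \<subseteq> J \<Longrightarrow> leading A x I d \<subseteq> leading A x J d"
  by (auto simp: leading_def)

lemma leading_Suc:
  assumes A: "stable M A" and I: "stable (insert x M) I"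
  shows "leading A x I d \<subseteq> leading A x I (Suc d)"
proof
  fix a assume "a \<in> leading A x I d"
  then obtain f where f: "a \<in> A" "f \<in> I" "f - a * x ^ d \<in> adjoin_upto A x d" by (auto simp: leading_def)
  have "x * f - a * x ^ Suc d = x * (f - a * x ^ d)" by (simp add: algebra_simps)
  then have "x * f - a * x ^ Suc d \<in> adjoin_upto A x (Suc d)"
    using adjoin_upto_mult_x[OF stableD(1)[OF A] f(3)] by simp
  then show "a \<in> leading A x I (Suc d)"
    using f(1) stableD(3)[OF I _ f(2), of x] unfolding leading_def by blast
qed

text \<open>An element of \<open>J\<close> is reduced by an element of \<open>I\<close> with the
  same leading coefficient; the difference is in \<open>J\<close> and of smaller degree.\<close>

lemma leading_eq_imp_eq:
  assumes A: "stable M A" and I: "stable (insert x M) I" and J: "stable (insert x M) J"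
    and IJ: "I \<subseteq> J" "J \<subseteq> adjoin A x" and eq: "\<And>d. leading A x J d = leading A x I d"
  shows "I = J"
proof -
  have "J \<inter> adjoin_upto A x d \<subseteq> I" for d
  proof (induction d)
    case 0 then show ?case using stableD(1)[OF I] by auto
  next
    case (Suc d)
    show ?case
    proof
      fix f assume f: "f \<in> J \<inter> adjoin_upto A x (Suc d)"
      then have "f \<in> adjoin_upto A x (Suc d)" by blast
      then obtain f' a where *: "f = f' + a * x ^ d" "f' \<in> adjoin_upto A x d" "a \<in> A"
        by (rule adjoin_upto_SucE)
      then have "f - a * x ^ d \<in> adjoin_upto A x d" by simp
      then have "a \<in> leading A x J d" using f *(3) by (auto simp: leading_def)
      then obtain g where g: "g \<in> I" "g - a * x ^ d \<in> adjoin_upto A x d"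
        unfolding eq by (auto simp: leading_def)
      have eq: "f - g = f' - (g - a * x ^ d)" by (simp add: *(1))
      have "f - g \<in> adjoin_upto A x d"
        unfolding eq by (rule stableD(2)[OF stable_adjoin_upto[OF A] *(2) g(2)])
      moreover have "f - g \<in> J" using stableD(2)[OF J] f g(1) IJ by blast
      ultimately have "f - g \<in> I" using Suc by blast
      then show "f \<in> I" using stableD(4)[OF I _ g(1), of "f - g"] by simp
    qed
  qed
  then have "J \<subseteq> I" using IJ(2) unfolding adjoin_def by blast
  then show ?thesis using IJ(1) by blast
qed

text \<open>The sets \<open>L i d\<close> increase in both indices. Stability of the diagonal at
  \<open>N\<close> settles all degrees \<open>d \<ge> N\<close> at once, and the finitely many
  smaller degrees stabilize one by one; \<open>K\<close> is late enough for all of them.\<close>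

lemma acc_adjoin:
  assumes A: "stable M A" and acc: "acc A M"
  shows "acc (adjoin A x) (insert x M)"
  unfolding acc_def
proof (intro allI impI)
  fix I :: "nat \<Rightarrow> 'a set"
  assume I: "\<forall>i. stable (insert x M) (I i) \<and> I i \<subseteq> adjoin A x \<and> I i \<subseteq> I (Suc i)"
  define L where "L i d = leading A x (I i) d" for i d
  have st: "stable M (L i d)" and LA: "L i d \<subseteq> A" for i d
    unfolding L_def using stable_leading[OF A] I by (auto simp: leading_def)
  have Imono: "i \<le> j \<Longrightarrow> I i \<subseteq> I j" for i j
    using I lift_Suc_mono_le[of I] by blast
  have Li: "i \<le> j \<Longrightarrow> L i d \<subseteq> L j d" for i j d
    unfolding L_def by (intro leading_mono Imono)
  have Ld: "d \<le> e \<Longrightarrow> L i d \<subseteq> L i e" for i d e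
    unfolding L_def using lift_Suc_mono_le[of "leading A x (I i)"] leading_Suc[OF A] I by blast
  have stab: "\<exists>n. \<forall>i\<ge>n. F i = F n"
    if ex: "\<And>i. \<exists>k d. F i = L k d" and inc: "\<And>i. F i \<subseteq> F (Suc i)" for F
  proof -
    have "stable M (F i) \<and> F i \<subseteq> A" for i
    proof -
      obtain k d where "F i = L k d" using ex[of i] by blast
      then show ?thesis using st LA by simp
    qed
    then show ?thesis using acc inc unfolding acc_def by blast
  qed
  have "\<exists>n. \<forall>i\<ge>n. L i i = L n n"
    by (rule stab) (use Li Ld in \<open>blast intro: subset_trans le_SucI order_refl\<close>)+
  then obtain N where N: "\<And>i. i \<ge> N \<Longrightarrow> L i i = L N N" by blast
  have "\<forall>d. \<exists>n. \<forall>i\<ge>n. L i d = L n d"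
    by (intro allI stab) (use Li in auto)
  then obtain n where n: "\<And>d i. i \<ge> n d \<Longrightarrow> L i d = L (n d) d" by metis
  define K where "K = Max (insert N (n ` {..<N}))"
  have KN: "N \<le> K" and Kn: "d < N \<Longrightarrow> n d \<le> K" for d unfolding K_def by (auto intro: Max_ge)
  have LK: "L i d = L K d" if "i \<ge> K" for i d
  proof (cases "d < N")
    case True
    then show ?thesis using n[of d i] n[of d K] Kn[OF True] that by simp
  next
    case False
    \<comment> \<open>Squeeze: \<open>L j d\<close> contains \<open>L N N\<close> and is contained
      in the diagonal term at \<open>max j d\<close>, which equals \<open>L N N\<close>.\<close>
    have "L j d = L N N" if "j \<ge> N" for j
    proof
      show "L j d \<subseteq> L N N" using Li[of j "max j d" d] Ld[of d "max j d" "max j d"] N[of "max j d"] that by auto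
      show "L N N \<subseteq> L j d" using Li[of N j N] Ld[of N d j] False that by auto
    qed
    then show ?thesis using that KN by simp
  qed
  have "I K = I i" if "i \<ge> K" for i
  proof (rule leading_eq_imp_eq[OF A])
    show "stable (insert x M) (I K)" "stable (insert x M) (I i)" "I i \<subseteq> adjoin A x" using I by simp_all
    show "I K \<subseteq> I i" using that by (rule Imono)
    show "leading A x (I i) d = leading A x (I K) d" for d using LK[OF that] by (simp add: L_def)
  qed
  then have "\<forall>i\<ge>K. I i = I K" by simp
  then show "\<exists>n. \<forall>i\<ge>n. I i = I n" by blast
qed

lemma const_diff: "const (c - d) = const c - const d"
  by (simp add: const_def single_diff)

lemma const_mult: "const (c * d) = const c * const d"
  by (simp add: const_def mult_single)

lemma stable_const: "stable (range const) (range const)"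
  unfolding stable_def
  by (auto simp: const_diff[symmetric] const_mult[symmetric]) (auto simp: const_def intro: range_eqI[of _ _ 0])

text \<open>The constants form a field: as soon as a nonzero constant appears, the chain is at its
  maximum.\<close>

lemma acc_const: "acc (range const) (range const :: 'k mpoly set)"
  unfolding acc_def
proof (intro allI impI)
  fix I :: "nat \<Rightarrow> 'k mpoly set"
  assume I: "\<forall>i. stable (range const) (I i) \<and> I i \<subseteq> range const \<and> I i \<subseteq> I (Suc i)"
  have mono: "i \<le> j \<Longrightarrow> I i \<subseteq> I j" for i j using I lift_Suc_mono_le[of I] by blast
  have full: "I i = range const" if f: "f \<in> I i" "f \<noteq> 0" for i f
  proof
    show "I i \<subseteq> range const" using I by blast
    obtain c where c: "f = const c" using f I by blast
    then have "c \<noteq> 0" using f by (auto simp: const_def)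
    show "range const \<subseteq> I i"
    proof
      fix g :: "'k mpoly" assume "g \<in> range const"
      then obtain d where "g = const d" by blast
      then have "g = const (d / c) * f" using \<open>c \<noteq> 0\<close> by (simp add: c const_mult[symmetric])
      then show "g \<in> I i" using I f(1) stableD(3)[of "range const" "I i" "const (d / c)" f] by simp
    qed
  qed
  show "\<exists>n. \<forall>i\<ge>n. I i = I n"
  proof (cases "\<exists>n f. f \<in> I n \<and> f \<noteq> 0")
    case True
    then obtain n f where "f \<in> I n" "f \<noteq> 0" by blast
    then have "\<forall>i\<ge>n. I i = I n" using full mono by (metis subsetD)
    then show ?thesis by blast
  next
    case False
    moreover have "0 \<in> I i" for i using I stableD(1) by blast
    ultimately have "I i = {0}" for i by blast
    then show ?thesis by simp
  qed
qed

text \<open>The variables are adjoined to the constants one at a time. The resulting set is closed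
  under multiplication by all variables, so it contains every monomial and hence every
  polynomial.\<close>

lemma acc_mpoly: "acc (UNIV :: 'k::finite mpoly set) (range const \<union> range var)"
proof -
  have "\<exists>A :: 'k mpoly set. stable (range const \<union> var ` V) A \<and> acc A (range const \<union> var ` V) \<and> range const \<subseteq> A"
    for V :: "'k set"
    using finite[of V]
  proof (induction V rule: finite_induct)
    case empty
    then show ?case using stable_const acc_const by (intro exI[of _ "range const"]) auto
  next
    case (insert k V)
    then obtain A :: "'k mpoly set" where A: "stable (range const \<union> var ` V) A" "acc A (range const \<union> var ` V)" "range const \<subseteq> A"
      by blast
    have *: "range const \<union> var ` insert k V = insert (var k) (range const \<union> var ` V)" by auto
    show ?case unfolding *
      using stable_adjoin[OF A(1)] acc_adjoin[OF A(1,2)] subset_adjoin[OF A(1)] A(3)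
      by (intro exI[of _ "adjoin A (var k)"]) blast
  qed
  then obtain A :: "'k mpoly set" where A: "stable (range const \<union> range var) A"
    "acc A (range const \<union> range var)" "range const \<subseteq> A" by blast
  have var_mult: "var k * Poly_Mapping.single a c = Poly_Mapping.single (Poly_Mapping.single k 1 + a) c" for k :: 'k and a c
    by (simp add: var_def mult_single)
  have mono: "Poly_Mapping.single a c \<in> A" for a c
  proof (induction "\<Sum>k\<in>UNIV. Poly_Mapping.lookup a k" arbitrary: a)
    case 0
    then have "a = 0" by (intro poly_mapping_eqI) simp
    then show ?case using A(3) by (auto simp: const_def)
  next
    case (Suc n)
    then obtain k where k: "Poly_Mapping.lookup a k \<noteq> 0"
      by (metis nat.distinct(1) sum.neutral)
    define b where "b = a - Poly_Mapping.single k 1"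
    have a: "a = Poly_Mapping.single k 1 + b"
      using k by (intro poly_mapping_eqI) (auto simp: b_def lookup_add lookup_minus lookup_single when_def)
    have "(\<Sum>i\<in>UNIV. Poly_Mapping.lookup a i) = 1 + (\<Sum>i\<in>UNIV. Poly_Mapping.lookup b i)"
      by (simp add: a lookup_add sum.distrib lookup_single when_def)
    then have "Poly_Mapping.single b c \<in> A" using Suc by simp
    then have "var k * Poly_Mapping.single b c \<in> A" by (intro stableD(3)[OF A(1)]) auto
    then show ?case by (simp only: a var_mult)
  qed
  have "f \<in> A" for f
  proof -
    have "(\<Sum>a\<in>S. Poly_Mapping.single a (Poly_Mapping.lookup f a)) \<in> A" for S
      by (induction S rule: infinite_finite_induct) (auto intro: stableD[OF A(1)] mono)
    then show ?thesis using sum_single_lookup[of f] by metis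
  qed
  then have "A = UNIV" by blast
  then show ?thesis using A by simp
qed

lemma ideal_chain_stabilizes:
  fixes I :: "nat \<Rightarrow> 'k::finite mpoly set"
  assumes "\<And>i. is_ideal (I i)" and "\<And>i. I i \<subseteq> I (Suc i)"
  shows "\<exists>n. \<forall>i\<ge>n. I i = I n"
proof -
  have "stable (range const \<union> range var) (I i)" for i
    using assms(1)[of i] unfolding stable_def
    by (auto intro: ideal.subspace_0 ideal.subspace_diff ideal.subspace_scale)
  then show ?thesis using acc_mpoly assms(2) unfolding acc_def by blast
qed

subsection \<open>The group action\<close>

lemma power_int_sum':
  fixes x :: "'a::field"
  assumes "x \<noteq> 0"
  shows "x powi (\<Sum>i\<in>A. f i) = (\<Prod>i\<in>A. x powi f i)"
  by (induction A rule: infinite_finite_induct) (simp_all add: power_int_add assms)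

lemma prod_power_int:
  fixes f :: "'i \<Rightarrow> 'a::field"
  shows "(\<Prod>i\<in>A. f i) powi n = (\<Prod>i\<in>A. f i powi n)"
  by (induction A rule: infinite_finite_induct) (simp_all add: power_int_mult_distrib)

lemma prod_inverse:
  fixes f :: "'i \<Rightarrow> 'a::field"
  shows "(\<Prod>i\<in>A. inverse (f i)) = inverse (\<Prod>i\<in>A. f i)"
  by (induction A rule: infinite_finite_induct) simp_all

lemma eval_poly_prod: "eval_poly (\<Prod>i\<in>A. f i) x = (\<Prod>i\<in>A. eval_poly (f i) x)"
  by (induction A rule: infinite_finite_induct) simp_all

lemma lin_equiv_trans:
  assumes "(a, b) \<in> lin_equiv \<rho>" and "(b, c) \<in> lin_equiv \<rho>"
  shows "(a, c) \<in> lin_equiv \<rho>"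
proof -
  obtain v w where vw: "v \<in> lattice_points" "\<And>j. of_int (a j - b j) = v \<bullet> ray_gen (\<rho> j)"
    "w \<in> lattice_points" "\<And>j. of_int (b j - c j) = w \<bullet> ray_gen (\<rho> j)"
    using assms unfolding lin_equiv_def by blast
  have "of_int (a j - c j) = (v + w) \<bullet> ray_gen (\<rho> j)" for j
    unfolding inner_add_left vw(2,4)[symmetric] by simp
  then show ?thesis
    unfolding lin_equiv_def using lattice_points_add[OF vw(1,3)] by blast
qed

lemma lin_equiv_sym:
  assumes "(a, b) \<in> lin_equiv \<rho>" shows "(b, a) \<in> lin_equiv \<rho>"
proof -
  obtain v where v: "v \<in> lattice_points" "\<And>j. of_int (a j - b j) = v \<bullet> ray_gen (\<rho> j)"
    using assms unfolding lin_equiv_def by blast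
  have "of_int (b j - a j) = (- v) \<bullet> ray_gen (\<rho> j)" for j
    unfolding inner_minus_left v(2)[symmetric] by simp
  then show ?thesis
    unfolding lin_equiv_def using lattice_points_minus[OF v(1)] by blast
qed

lemma lin_equiv_refl: "(a, a) \<in> lin_equiv \<rho>"
  unfolding lin_equiv_def using lattice_points_zero by (auto intro: bexI[of _ 0])

lemma monomial_degree_eq_iff:
  "monomial_degree \<rho> a = monomial_degree \<rho> b \<longleftrightarrow>
   (\<lambda>j. int (Poly_Mapping.lookup a j), \<lambda>j. int (Poly_Mapping.lookup b j)) \<in> lin_equiv \<rho>"
  (is "_ \<longleftrightarrow> (?a, ?b) \<in> _")
proof
  assume "monomial_degree \<rho> a = monomial_degree \<rho> b"
  then have "?b \<in> lin_equiv \<rho> `` {?a}" using lin_equiv_refl by (auto simp: monomial_degree_def)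
  then show "(?a, ?b) \<in> lin_equiv \<rho>" by simp
next
  assume "(?a, ?b) \<in> lin_equiv \<rho>"
  then have "(?a, c) \<in> lin_equiv \<rho> \<longleftrightarrow> (?b, c) \<in> lin_equiv \<rho>" for c
    using lin_equiv_trans lin_equiv_sym by metis
  then show "monomial_degree \<rho> a = monomial_degree \<rho> b" by (auto simp: monomial_degree_def)
qed

context affine_codimension_fan
begin

abbreviation ss :: "('m \<Rightarrow> complex) set" where
  "ss \<equiv> - affine_V (irrelevant_ideal \<Sigma> \<rho>)"

text \<open>If \<open>x\<close> has a nonzero coordinate in every collection, the product of one
  such variable per collection is in the irrelevant ideal and does not vanish at
  \<open>x\<close>.\<close>

lemma ss_iff: "x \<in> ss \<longleftrightarrow> (\<forall>P\<in>PC. \<exists>j\<in>P. x j \<noteq> 0)"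
proof
  assume x: "x \<in> ss"
  show "\<forall>P\<in>PC. \<exists>j\<in>P. x j \<noteq> 0"
  proof (rule ccontr)
    assume "\<not> ?thesis"
    then obtain P where P: "P \<in> PC" "\<And>j. j \<in> P \<Longrightarrow> x j = 0" by blast
    have "x \<in> affine_V (ideal_generated (var ` P))"
      unfolding affine_V_ideal_generated using P(2) by (simp add: affine_V_def)
    moreover have "irrelevant_ideal \<Sigma> \<rho> \<subseteq> ideal_generated (var ` P)"
      unfolding irrelevant_ideal_def using P(1) by (rule INT_lower)
    ultimately show False using x by (auto simp: affine_V_def)
  qed
next
  assume "\<forall>P\<in>PC. \<exists>j\<in>P. x j \<noteq> 0"
  then have "\<forall>P\<in>PC. \<exists>j. j \<in> P \<and> x j \<noteq> 0" by blast
  then obtain s where s: "\<And>P. P \<in> PC \<Longrightarrow> s P \<in> P" "\<And>P. P \<in> PC \<Longrightarrow> x (s P) \<noteq> 0"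
    by metis
  define f :: "'m mpoly" where "f = (\<Prod>P\<in>PC. var (s P))"
  have "f \<in> ideal_generated (var ` P)" if P: "P \<in> PC" for P
  proof -
    have f: "f = (\<Prod>Q\<in>PC - {P}. var (s Q)) * var (s P)"
      unfolding f_def using P by (simp add: prod.remove mult.commute)
    show ?thesis unfolding f using s(1)[OF P] by (intro ideal.span_scale ideal.span_base imageI)
  qed
  then have "f \<in> irrelevant_ideal \<Sigma> \<rho>" by (simp add: irrelevant_ideal_def)
  moreover have "eval_poly f x \<noteq> 0" using s(2) by (simp add: f_def eval_poly_prod)
  ultimately show "x \<in> ss" by (auto simp: affine_V_def)
qed

lemma ss_selection:
  assumes "x \<in> ss"
  shows "\<exists>s. selection s \<and> (\<forall>P\<in>PC. x (s P) \<noteq> 0)"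
proof -
  have "\<forall>P\<in>PC. \<exists>j. j \<in> P \<and> x j \<noteq> 0" using assms unfolding ss_iff by blast
  then obtain s where "\<forall>P\<in>PC. s P \<in> P \<and> x (s P) \<noteq> 0" by metis
  then show ?thesis unfolding selection_def by blast
qed

section \<open>Coordinates on the group of the quotient construction\<close>

abbreviation G :: "('m \<Rightarrow> complex) set" where "G \<equiv> cox_group \<rho>"

abbreviation pairing :: "real ^ 'n \<Rightarrow> 'm \<Rightarrow> int" where "pairing w j \<equiv> \<lfloor>w \<bullet> u j\<rfloor>"

lemma of_int_pairing: "w \<in> lattice_points \<Longrightarrow> of_int (pairing w j) = w \<bullet> u j"
  using inner_lattice_points_Ints[OF _ u_lattice, of w j] by (auto elim!: Ints_cases)

lemma G_nonzero: "t \<in> G \<Longrightarrow> t j \<noteq> 0"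
  and G_prod: "t \<in> G \<Longrightarrow> w \<in> lattice_points \<Longrightarrow> (\<Prod>j\<in>UNIV. t j powi pairing w j) = 1"
  by (simp_all add: cox_group_def)

lemma G_one: "(\<lambda>_. 1) \<in> G"
  by (simp add: cox_group_def)

lemma G_mult: "t \<in> G \<Longrightarrow> t' \<in> G \<Longrightarrow> (\<lambda>j. t j * t' j) \<in> G"
  by (simp add: cox_group_def power_int_mult_distrib prod.distrib)

lemma G_inverse: "t \<in> G \<Longrightarrow> (\<lambda>j. inverse (t j)) \<in> G"
  by (simp add: cox_group_def power_int_inverse prod_inverse)

text \<open>Pairing the dual vector of \<open>i\<close> with \<open>rel_basis s P\<close> leaves
  only the terms of \<open>i\<close> and \<open>s P\<close>. The character equation of this vector
  expresses the coordinate \<open>i\<close> of a group element through the selected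
  coordinates.\<close>

lemma dual_pairing:
  assumes s: "selection s" and i: "i \<notin> s ` PC"
  obtains w where "w \<in> lattice_points" "\<And>k. k \<notin> s ` PC \<Longrightarrow> pairing w k = (if k = i then 1 else 0)"
    "\<And>P. P \<in> PC \<Longrightarrow> pairing w (s P) = - rel_basis s P i"
proof -
  obtain w where w: "w \<in> lattice_points" and dual: "\<forall>k. k \<notin> s ` PC \<longrightarrow> w \<bullet> u k = (if k = i then 1 else 0)"
    using ex_dual[OF s i] by (elim bexE)
  have "w \<bullet> u (s P) = - of_int (rel_basis s P i)" if P: "P \<in> PC" for P
  proof -
    have Pi: "s P \<noteq> i" using i P by blast
    have "0 = (\<Sum>k\<in>UNIV. of_int (rel_basis s P k) * (w \<bullet> u k))"
      using relation_inner[OF rel_basis(1)[OF s P]] by simp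
    also have "\<dots> = (\<Sum>k\<in>{i, s P}. of_int (rel_basis s P k) * (w \<bullet> u k))"
    proof (rule sum.mono_neutral_right)
      show "\<forall>k\<in>UNIV - {i, s P}. of_int (rel_basis s P k) * (w \<bullet> u k) = 0"
      proof
        fix k assume k: "k \<in> UNIV - {i, s P}"
        show "of_int (rel_basis s P k) * (w \<bullet> u k) = 0"
        proof (cases "k \<in> s ` PC")
          case True
          then obtain Q where "Q \<in> PC" "k = s Q" by blast
          then show ?thesis using k rel_basis(2)[OF s P, of Q] by auto
        qed (use dual k in simp)
      qed
    qed auto
    also have "\<dots> = of_int (rel_basis s P i) + w \<bullet> u (s P)"
      using Pi dual i rel_basis(2)[OF s P P] by (simp add: Pi[symmetric])
    finally show ?thesis by simp
  qed
  then show thesis using that[OF w] dual by simp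
qed

lemma G_coordinates:
  assumes s: "selection s" and t: "t \<in> G"
  shows "t j = (\<Prod>P\<in>PC. t (s P) powi rel_basis s P j)"
proof (cases "j \<in> s ` PC")
  case True
  then obtain Q where Q: "Q \<in> PC" "j = s Q" by blast
  have "(\<Prod>P\<in>PC. t (s P) powi rel_basis s P j) = (\<Prod>P\<in>PC. if Q = P then t (s P) else 1)"
    using Q rel_basis(2)[OF s _ Q(1)] by (intro prod.cong) auto
  then show ?thesis using Q by simp
next
  case False
  obtain w where w: "w \<in> lattice_points" "\<And>k. k \<notin> s ` PC \<Longrightarrow> pairing w k = (if k = j then 1 else 0)"
    "\<And>P. P \<in> PC \<Longrightarrow> pairing w (s P) = - rel_basis s P j"
    using dual_pairing[OF s False] by blast
  have inj: "inj_on s PC" using selection_eq_iff[OF s] by (auto intro: inj_onI)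
  have "1 = (\<Prod>k\<in>UNIV. t k powi pairing w k)" using G_prod[OF t w(1)] by simp
  also have "\<dots> = (\<Prod>k\<in>s ` PC. t k powi pairing w k) * (\<Prod>k\<in>- s ` PC. t k powi pairing w k)"
    using prod.union_disjoint[of "s ` PC" "- s ` PC" "\<lambda>k. t k powi pairing w k"] by simp
  also have "(\<Prod>k\<in>- s ` PC. t k powi pairing w k) = (\<Prod>k\<in>- s ` PC. if j = k then t k else 1)"
    using w(2) by (intro prod.cong) auto
  also have "\<dots> = t j" using False by simp
  also have "(\<Prod>k\<in>s ` PC. t k powi pairing w k) = (\<Prod>P\<in>PC. inverse (t (s P) powi rel_basis s P j))"
    by (subst prod.reindex[OF inj]) (simp add: w(3) power_int_minus)
  also have "\<dots> = inverse (\<Prod>P\<in>PC. t (s P) powi rel_basis s P j)" by (rule prod_inverse)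
  finally have *: "1 = inverse (\<Prod>P\<in>PC. t (s P) powi rel_basis s P j) * t j" .
  have "(\<Prod>P\<in>PC. t (s P) powi rel_basis s P j) \<noteq> 0" using G_nonzero[OF t] by simp
  then show ?thesis using * by (simp add: field_simps)
qed

text \<open>The exponent of each \<tau> \<open>P\<close> in a character equation is the pairing of a
  relation with \<open>w\<close>, hence zero. Together with \<open>G_coordinates\<close> this
  identifies \<open>G\<close> with a product of copies of the multiplicative group, one per
  collection.\<close>

lemma G_of_coordinates:
  assumes s: "selection s" and nz: "\<And>P. P \<in> PC \<Longrightarrow> \<tau> P \<noteq> 0"
  shows "(\<lambda>j. \<Prod>P\<in>PC. \<tau> P powi rel_basis s P j) \<in> G"
  unfolding cox_group_def
proof (intro CollectI conjI allI ballI)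
  show "(\<Prod>P\<in>PC. \<tau> P powi rel_basis s P j) \<noteq> 0" for j using nz by simp
next
  fix w :: "real ^ 'n" assume w: "w \<in> lattice_points"
  have *: "(\<Sum>j\<in>UNIV. rel_basis s P j * pairing w j) = 0" if "P \<in> PC" for P
  proof -
    have "real_of_int (\<Sum>j\<in>UNIV. rel_basis s P j * pairing w j) = 0"
      using relation_inner[OF rel_basis(1)[OF s that], of w] by (simp add: of_int_pairing[OF w])
    then show ?thesis by linarith
  qed
  have "(\<Prod>j\<in>UNIV. (\<Prod>P\<in>PC. \<tau> P powi rel_basis s P j) powi pairing w j)
      = (\<Prod>j\<in>UNIV. \<Prod>P\<in>PC. \<tau> P powi (rel_basis s P j * pairing w j))"
    by (simp add: prod_power_int power_int_mult)
  also have "\<dots> = (\<Prod>P\<in>PC. \<Prod>j\<in>UNIV. \<tau> P powi (rel_basis s P j * pairing w j))"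
    by (rule prod.swap)
  also have "\<dots> = (\<Prod>P\<in>PC. \<tau> P powi (\<Sum>j\<in>UNIV. rel_basis s P j * pairing w j))"
    using nz by (intro prod.cong refl power_int_sum'[symmetric])
  also have "\<dots> = 1" using * by simp
  finally show "(\<Prod>j\<in>UNIV. (\<Prod>P\<in>PC. \<tau> P powi rel_basis s P j) powi pairing w j) = 1" .
qed

lemma G_of_coordinates_selected:
  assumes "selection s" and "Q \<in> PC"
  shows "(\<Prod>P\<in>PC. \<tau> P powi rel_basis s P (s Q)) = \<tau> Q"
proof -
  have "(\<Prod>P\<in>PC. \<tau> P powi rel_basis s P (s Q)) = (\<Prod>P\<in>PC. if Q = P then \<tau> P else 1)"
    using rel_basis(2)[OF assms(1) _ assms(2)] by (intro prod.cong) auto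
  then show ?thesis using assms(2) by simp
qed

text \<open>Exponents of equal degree differ by a principal divisor, and on these the characters of
  \<open>G\<close> are trivial by definition.\<close>

lemma monomial_degree_character:
  assumes t: "t \<in> G" and eq: "monomial_degree \<rho> a = monomial_degree \<rho> b"
  shows "(\<Prod>j\<in>UNIV. t j ^ Poly_Mapping.lookup a j) = (\<Prod>j\<in>UNIV. t j ^ Poly_Mapping.lookup b j)"
proof -
  obtain w where w: "w \<in> lattice_points"
    "\<forall>j. of_int (int (Poly_Mapping.lookup a j) - int (Poly_Mapping.lookup b j)) = w \<bullet> u j"
    using eq unfolding monomial_degree_eq_iff lin_equiv_def by blast
  have p: "pairing w j = int (Poly_Mapping.lookup a j) - int (Poly_Mapping.lookup b j)" for j
    by (simp only: w(2)[rule_format, symmetric] floor_of_int)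
  have "1 = (\<Prod>j\<in>UNIV. t j powi (int (Poly_Mapping.lookup a j) - int (Poly_Mapping.lookup b j)))"
    using G_prod[OF t w(1)] by (simp only: p)
  also have "\<dots> = (\<Prod>j\<in>UNIV. t j ^ Poly_Mapping.lookup a j / t j ^ Poly_Mapping.lookup b j)"
    using G_nonzero[OF t] by (simp add: power_int_diff)
  also have "\<dots> = (\<Prod>j\<in>UNIV. t j ^ Poly_Mapping.lookup a j) / (\<Prod>j\<in>UNIV. t j ^ Poly_Mapping.lookup b j)"
    by (rule prod_dividef)
  finally show ?thesis using G_nonzero[OF t] by (simp add: field_simps)
qed

lemma homogeneous_eval_zero:
  assumes t: "t \<in> G" and f: "homogeneous_of_degree \<rho> d f" and zero: "eval_poly f x = 0"
  shows "eval_poly f (\<lambda>j. t j * x j) = 0"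
proof (cases "Poly_Mapping.keys f = {}")
  case True
  then show ?thesis by (simp add: eval_poly_def)
next
  case False
  then obtain b where b: "b \<in> Poly_Mapping.keys f" by blast
  define c where "c = (\<Prod>j\<in>UNIV. t j ^ Poly_Mapping.lookup b j)"
  have "eval_poly f (\<lambda>j. t j * x j) = (\<Sum>a\<in>Poly_Mapping.keys f. c *
      (Poly_Mapping.lookup f a * (\<Prod>k\<in>UNIV. x k ^ Poly_Mapping.lookup a k)))"
    unfolding eval_poly_def
  proof (rule sum.cong[OF refl])
    fix a assume a: "a \<in> Poly_Mapping.keys f"
    then have "(\<Prod>j\<in>UNIV. t j ^ Poly_Mapping.lookup a j) = c"
      unfolding c_def using f b by (intro monomial_degree_character[OF t]) (simp add: homogeneous_of_degree_def)
    then show "Poly_Mapping.lookup f a * (\<Prod>k\<in>UNIV. (t k * x k) ^ Poly_Mapping.lookup a k) =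
        c * (Poly_Mapping.lookup f a * (\<Prod>k\<in>UNIV. x k ^ Poly_Mapping.lookup a k))"
      by (simp add: power_mult_distrib prod.distrib mult_ac)
  qed
  also have "\<dots> = c * eval_poly f x" by (simp add: eval_poly_def sum_distrib_left)
  finally show ?thesis using zero by simp
qed

lemma affine_V_G_invariant:
  assumes "homogeneous_ideal \<rho> I" and t: "t \<in> G" and x: "x \<in> affine_V I"
  shows "(\<lambda>j. t j * x j) \<in> affine_V I"
proof -
  obtain S where S: "\<forall>f\<in>S. \<exists>d. homogeneous_of_degree \<rho> d f" "I = ideal_generated S"
    using assms(1) by (auto simp: homogeneous_ideal_def)
  have "eval_poly f (\<lambda>j. t j * x j) = 0" if f: "f \<in> S" for f
  proof -
    obtain d where "homogeneous_of_degree \<rho> d f" using S(1) f by blast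
    moreover have "eval_poly f x = 0"
      using x f unfolding S(2) affine_V_ideal_generated by (simp add: affine_V_def)
    ultimately show ?thesis by (rule homogeneous_eval_zero[OF t])
  qed
  then show ?thesis unfolding S(2) affine_V_ideal_generated by (simp add: affine_V_def)
qed

section \<open>Orbits and the points of the toric variety\<close>

abbreviation orb :: "('m \<Rightarrow> complex) \<Rightarrow> ('m \<Rightarrow> complex) set" where
  "orb x \<equiv> orbit_rel \<rho> `` {x}"

lemma mem_orb: "y \<in> orb x \<longleftrightarrow> (\<exists>t\<in>G. y = (\<lambda>j. t j * x j))"
  by (auto simp: orbit_rel_def)

lemma orb_self: "x \<in> orb x"
  unfolding mem_orb using G_one by (intro bexI[of _ "\<lambda>_. 1"]) auto

lemma orb_sym: assumes "y \<in> orb x" shows "x \<in> orb y"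
proof -
  obtain t where t: "t \<in> G" "y = (\<lambda>j. t j * x j)" using assms unfolding mem_orb by blast
  have "x = (\<lambda>j. inverse (t j) * y j)" using G_nonzero[OF t(1)] t(2) by (auto simp: fun_eq_iff)
  then show ?thesis unfolding mem_orb using G_inverse[OF t(1)] by (rule_tac bexI[rotated]) auto
qed

lemma orb_trans: assumes "y \<in> orb x" and "z \<in> orb y" shows "z \<in> orb x"
proof -
  obtain t where t: "t \<in> G" "y = (\<lambda>j. t j * x j)" using assms(1) unfolding mem_orb by blast
  obtain t' where t': "t' \<in> G" "z = (\<lambda>j. t' j * y j)" using assms(2) unfolding mem_orb by blast
  have "z = (\<lambda>j. (t' j * t j) * x j)" using t(2) t'(2) by (simp add: mult.assoc)
  then show ?thesis unfolding mem_orb using G_mult[OF t'(1) t(1)] by (rule_tac bexI[rotated]) auto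
qed

lemma orb_eq_iff: "orb x = orb y \<longleftrightarrow> y \<in> orb x"
proof
  show "orb x = orb y \<Longrightarrow> y \<in> orb x" using orb_self[of y] by simp
  show "orb x = orb y" if y: "y \<in> orb x"
    using orb_trans[OF y] orb_trans[OF orb_sym[OF y]] by (intro equalityI subsetI)
qed

lemma toric_V_eq: "toric_V \<Sigma> \<rho> J = orb ` (affine_V J \<inter> ss)"
  unfolding toric_V_def quotient_def by auto

lemma orb_in_toric_V_iff:
  assumes J: "homogeneous_ideal \<rho> J" and x: "x \<in> ss"
  shows "orb x \<in> toric_V \<Sigma> \<rho> J \<longleftrightarrow> x \<in> affine_V J"
proof
  assume "orb x \<in> toric_V \<Sigma> \<rho> J"
  then obtain y where y: "y \<in> affine_V J" "orb x = orb y" unfolding toric_V_eq by (elim imageE IntE)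
  then have "x \<in> orb y" using orb_self[of x] by simp
  then obtain t where "t \<in> G" "x = (\<lambda>j. t j * y j)" unfolding mem_orb by blast
  then show "x \<in> affine_V J" using affine_V_G_invariant[OF J _ y(1)] by simp
qed (use x in \<open>auto simp: toric_V_eq\<close>)

end

subsection \<open>Zero dimensional closed sets are finite\<close>

definition mon :: "('k::finite \<Rightarrow>\<^sub>0 nat) \<Rightarrow> ('k \<Rightarrow> complex) \<Rightarrow> complex" where
  "mon a x = (\<Prod>k\<in>UNIV. x k ^ Poly_Mapping.lookup a k)"

lemma mon_zero: "mon 0 x = 1"
  by (simp add: mon_def)

lemma mon_add: "mon (a + b) x = mon a x * mon b x"
  by (simp add: mon_def lookup_add power_add prod.distrib)

lemma mon_single: "mon (Poly_Mapping.single k n) x = x k ^ n"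
proof -
  have "(\<Prod>i\<in>UNIV. x i ^ Poly_Mapping.lookup (Poly_Mapping.single k n) i) = (\<Prod>i\<in>UNIV. if k = i then x i ^ n else 1)"
    by (rule prod.cong) (auto simp: lookup_single)
  then show ?thesis by (simp add: mon_def)
qed

lemma mon_sum: "mon (\<Sum>i\<in>A. a i) x = (\<Prod>i\<in>A. mon (a i) x)"
  by (induction A rule: infinite_finite_induct) (simp_all add: mon_zero mon_add)

lemma power_int_eq_nat_divide:
  fixes x :: "'a::field"
  assumes "x \<noteq> 0"
  shows "x powi b = x ^ nat b / x ^ nat (- b)"
  by (cases "b \<ge> 0") (simp_all add: power_int_def divide_inverse power_inverse)

context affine_codimension_fan
begin

context
  fixes s :: "'m set \<Rightarrow> 'm" and x0 :: "'m \<Rightarrow> complex"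
  assumes s: "selection s" and x0: "\<And>P. P \<in> PC \<Longrightarrow> x0 (s P) \<noteq> 0"
begin

definition num_exponent :: "'m \<Rightarrow> 'm \<Rightarrow>\<^sub>0 nat" where
  "num_exponent i = (\<Sum>P\<in>PC. Poly_Mapping.single (s P) (nat (rel_basis s P i)))"

definition den_exponent :: "'m \<Rightarrow> 'm \<Rightarrow>\<^sub>0 nat" where
  "den_exponent i = (\<Sum>P\<in>PC. Poly_Mapping.single (s P) (nat (- rel_basis s P i)))"

text \<open>On the orbit, \<open>y i / x0 i\<close> is the product of the quotients
  \<open>y (s P) / x0 (s P)\<close> with exponents \<open>rel_basis s P i\<close>. The binomial is
  this equation with positive and negative exponents separated and denominators cleared.\<close>

definition orbit_binomial :: "'m \<Rightarrow> 'm mpoly" where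
  "orbit_binomial i =
     Poly_Mapping.single (Poly_Mapping.single i 1 + den_exponent i) (mon (num_exponent i) x0) -
     Poly_Mapping.single (num_exponent i) (x0 i * mon (den_exponent i) x0)"

lemma mon_num: "mon (num_exponent i) y = (\<Prod>P\<in>PC. y (s P) ^ nat (rel_basis s P i))"
  and mon_den: "mon (den_exponent i) y = (\<Prod>P\<in>PC. y (s P) ^ nat (- rel_basis s P i))"
  by (simp_all add: num_exponent_def den_exponent_def mon_sum mon_single)

lemma eval_orbit_binomial:
  "eval_poly (orbit_binomial i) y =
     mon (num_exponent i) x0 * y i * mon (den_exponent i) y -
     x0 i * mon (den_exponent i) x0 * mon (num_exponent i) y"
proof -
  have "eval_poly (orbit_binomial i) y =
     mon (num_exponent i) x0 * mon (Poly_Mapping.single i 1 + den_exponent i) y -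
     x0 i * mon (den_exponent i) x0 * mon (num_exponent i) y"
    by (simp add: orbit_binomial_def mon_def)
  then show ?thesis by (simp add: mon_add mon_single)
qed

lemma lookup_sum_selected:
  "Poly_Mapping.lookup (\<Sum>P\<in>PC. Poly_Mapping.single (s P) (n P)) k =
     (if k \<in> s ` PC then n (THE P. P \<in> PC \<and> s P = k) else (0::nat))"
proof (cases "k \<in> s ` PC")
  case True
  then obtain Q where Q: "Q \<in> PC" "k = s Q" by blast
  have "(THE P. P \<in> PC \<and> s P = k) = Q"
    using Q selection_eq_iff[OF s] by (intro the_equality) auto
  moreover have "(\<Sum>P\<in>PC. Poly_Mapping.lookup (Poly_Mapping.single (s P) (n P)) k)
      = (\<Sum>P\<in>PC. if Q = P then n P else 0)"
    using Q selection_eq_iff[OF s] by (intro sum.cong) (auto simp: lookup_single when_def)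
  ultimately show ?thesis using Q True by (simp add: lookup_sum)
next
  case False
  then show ?thesis by (auto simp: lookup_sum lookup_single when_def intro!: sum.neutral)
qed

text \<open>The two exponents differ by the principal divisor of the dual vector of
  \<open>i\<close>.\<close>

lemma homogeneous_orbit_binomial:
  assumes i: "i \<notin> s ` PC"
  shows "homogeneous_of_degree \<rho> (monomial_degree \<rho> (num_exponent i)) (orbit_binomial i)"
proof -
  obtain w where w: "w \<in> lattice_points" "\<And>k. k \<notin> s ` PC \<Longrightarrow> pairing w k = (if k = i then 1 else 0)"
    "\<And>P. P \<in> PC \<Longrightarrow> pairing w (s P) = - rel_basis s P i"
    using dual_pairing[OF s i] by blast
  have "int (Poly_Mapping.lookup (Poly_Mapping.single i 1 + den_exponent i) k) -
      int (Poly_Mapping.lookup (num_exponent i) k) = pairing w k" for k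
  proof (cases "k \<in> s ` PC")
    case True
    then obtain Q where Q: "Q \<in> PC" "k = s Q" by blast
    have "(THE P. P \<in> PC \<and> s P = k) = Q"
      using Q selection_eq_iff[OF s] by (intro the_equality) auto
    moreover have "i \<noteq> k" using i True by blast
    ultimately show ?thesis
      using Q True w(3)[OF Q(1)]
      by (simp add: lookup_add lookup_single when_def num_exponent_def den_exponent_def lookup_sum_selected)
  next
    case False
    then show ?thesis using w(2)[OF False]
      by (auto simp add: lookup_add lookup_single when_def num_exponent_def den_exponent_def lookup_sum_selected)
  qed
  then have "\<forall>k. of_int (int (Poly_Mapping.lookup (Poly_Mapping.single i 1 + den_exponent i) k) -
      int (Poly_Mapping.lookup (num_exponent i) k)) = w \<bullet> u k"
    using of_int_pairing[OF w(1)] by simp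
  then have "monomial_degree \<rho> (Poly_Mapping.single i 1 + den_exponent i) = monomial_degree \<rho> (num_exponent i)"
    unfolding monomial_degree_eq_iff lin_equiv_def using w(1) by blast
  moreover have "a = Poly_Mapping.single i 1 + den_exponent i \<or> a = num_exponent i"
    if "a \<in> Poly_Mapping.keys (orbit_binomial i)" for a
    using that by (auto simp: orbit_binomial_def in_keys_iff lookup_minus lookup_single when_def split: if_splits)
  ultimately show ?thesis unfolding homogeneous_of_degree_def by metis
qed

text \<open>Clearing denominators could add solutions with some \<open>y (s P) = 0\<close>.
  Semistability excludes them by induction along \<open>dep s\<close>; afterwards the quotients of
  the selected coordinates define the group element that carries \<open>x0\<close> to
  \<open>y\<close>.\<close>

lemma orbit_of_binomials:
  assumes y: "y \<in> ss" and zero: "\<And>i. i \<notin> s ` PC \<Longrightarrow> eval_poly (orbit_binomial i) y = 0"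
  shows "y \<in> orb x0"
proof -
  have eq: "mon (num_exponent i) x0 * y i * mon (den_exponent i) y =
      x0 i * mon (den_exponent i) x0 * mon (num_exponent i) y" if "i \<notin> s ` PC" for i
    using zero[OF that] by (simp add: eval_orbit_binomial)
  have x0_num: "mon (num_exponent i) x0 \<noteq> 0" for i using x0 by (simp add: mon_num)
  have ys: "Q \<in> PC \<Longrightarrow> y (s Q) \<noteq> 0" for Q
  proof (induction Q rule: wf_induct_rule[OF wf_dep[OF s]])
    case (1 Q)
    obtain j where j: "j \<in> Q" "y j \<noteq> 0" using y 1(2) unfolding ss_iff by blast
    show ?case
    proof (cases "j = s Q")
      case False
      have nj: "j \<notin> s ` PC"
      proof
        assume "j \<in> s ` PC"
        then obtain R where "R \<in> PC" "j = s R" by blast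
        then show False using selection_eq[OF s 1(2), of R] j(1) False by simp
      qed
      have "y (s P) ^ nat (- rel_basis s P j) \<noteq> 0" if P: "P \<in> PC" for P
      proof (cases "P = Q")
        case True
        then show ?thesis using rel_basis_self[OF s P, of j] j(1) by simp
      next
        case False
        show ?thesis
        proof (cases "rel_basis s P j = 0")
          case False
          then have "(P, Q) \<in> dep s" using \<open>P \<noteq> Q\<close> P 1(2) j(1) by (auto simp: dep_def)
          then show ?thesis using 1(1) P by simp
        qed simp
      qed
      \<comment> \<open>The left side of the binomial equation is nonzero, so the right side is too;
        it contains \<open>y (s Q)\<close> with exponent \<open>rel_basis s Q j = 1\<close>.\<close>
      then have "mon (den_exponent j) y \<noteq> 0" by (simp add: mon_den)
      then have "mon (num_exponent j) x0 * y j * mon (den_exponent j) y \<noteq> 0" using x0_num j(2) by simp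
      then have "mon (num_exponent j) y \<noteq> 0" unfolding eq[OF nj] by simp
      then have "y (s Q) ^ nat (rel_basis s Q j) \<noteq> 0" using 1(2) by (simp add: mon_num)
      then show ?thesis using rel_basis_self[OF s 1(2) j(1)] by simp
    qed (use j in simp)
  qed
  define \<tau> where "\<tau> P = y (s P) / x0 (s P)" for P
  define t where "t j = (\<Prod>P\<in>PC. \<tau> P powi rel_basis s P j)" for j
  have "t \<in> G" unfolding t_def using ys x0 by (intro G_of_coordinates[OF s]) (simp add: \<tau>_def)
  moreover have "y j = t j * x0 j" for j
  proof (cases "j \<in> s ` PC")
    case True
    then obtain Q where Q: "Q \<in> PC" "j = s Q" by blast
    have "t (s Q) = \<tau> Q" unfolding t_def by (rule G_of_coordinates_selected[OF s Q(1)])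
    then show ?thesis using Q x0 by (simp add: \<tau>_def)
  next
    case False
    have "t j = (\<Prod>P\<in>PC. (y (s P) ^ nat (rel_basis s P j) / y (s P) ^ nat (- rel_basis s P j)) /
        (x0 (s P) ^ nat (rel_basis s P j) / x0 (s P) ^ nat (- rel_basis s P j)))"
      unfolding t_def \<tau>_def using ys x0
      by (intro prod.cong) (simp_all add: power_int_divide_distrib power_int_eq_nat_divide)
    also have "\<dots> = (mon (num_exponent j) y / mon (den_exponent j) y) / (mon (num_exponent j) x0 / mon (den_exponent j) x0)"
      by (simp add: prod_dividef prod.distrib mon_num mon_den)
    finally have t: "t j = (mon (num_exponent j) y / mon (den_exponent j) y) / (mon (num_exponent j) x0 / mon (den_exponent j) x0)" .
    have "mon (den_exponent j) y \<noteq> 0" "mon (den_exponent j) x0 \<noteq> 0" using ys x0 by (simp_all add: mon_den)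
    then show ?thesis using eq[OF False] x0_num[of j] unfolding t by (simp add: field_simps)
  qed
  ultimately show ?thesis unfolding mem_orb by (intro bexI[of _ t]) auto
qed

lemma toric_closed_orbit_aux:
  assumes "x0 \<in> ss"
  shows "toric_closed \<Sigma> \<rho> {orb x0}"
proof -
  define J where "J = ideal_generated (orbit_binomial ` (- s ` PC))"
  have J: "homogeneous_ideal \<rho> J"
    unfolding homogeneous_ideal_def
  proof (intro exI[of _ "orbit_binomial ` (- s ` PC)"] conjI ballI)
    fix f assume "f \<in> orbit_binomial ` (- s ` PC)"
    then obtain i where "i \<notin> s ` PC" "f = orbit_binomial i" by blast
    then show "\<exists>d. homogeneous_of_degree \<rho> d f" using homogeneous_orbit_binomial by blast
  qed (rule J_def)
  have V: "y \<in> affine_V J \<longleftrightarrow> (\<forall>i. i \<notin> s ` PC \<longrightarrow> eval_poly (orbit_binomial i) y = 0)" for y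
    unfolding J_def affine_V_ideal_generated by (auto simp: affine_V_def)
  have "x0 \<in> affine_V J" unfolding V by (simp add: eval_orbit_binomial)
  then have "orb x0 \<in> orb ` (affine_V J \<inter> ss)" using assms by (intro imageI IntI)
  moreover have "orb y = orb x0" if "y \<in> affine_V J" "y \<in> ss" for y
  proof -
    have "y \<in> orb x0" using orbit_of_binomials[OF that(2)] that(1) unfolding V by simp
    then show ?thesis by (simp only: orb_eq_iff[of x0 y, symmetric])
  qed
  then have "orb ` (affine_V J \<inter> ss) \<subseteq> {orb x0}" by (simp add: image_subset_iff)
  ultimately have "toric_V \<Sigma> \<rho> J = {orb x0}" unfolding toric_V_eq by (intro equalityI) simp_all
  then show ?thesis using J unfolding toric_closed_def by (intro exI[of _ J]) simp
qed

end

lemma toric_closed_orbit: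
  assumes "x0 \<in> ss"
  shows "toric_closed \<Sigma> \<rho> {orb x0}"
proof -
  obtain s where "selection s" "\<forall>P\<in>PC. x0 (s P) \<noteq> 0" using ss_selection[OF assms] by blast
  then show ?thesis using toric_closed_orbit_aux[of s x0] assms by simp
qed

section \<open>Noetherian induction on closed sets\<close>

lemma toric_closedE:
  assumes "toric_closed \<Sigma> \<rho> Z"
  obtains J where "homogeneous_ideal \<rho> J" "Z = toric_V \<Sigma> \<rho> J"
  using assms by (auto simp: toric_closed_def)

lemma toric_closed_mem:
  assumes "toric_closed \<Sigma> \<rho> Z" and "c \<in> Z"
  obtains x where "x \<in> ss" "c = orb x"
  using assms by (auto simp: toric_closed_def toric_V_eq)

lemma toric_closed_Int:
  assumes "toric_closed \<Sigma> \<rho> Z1" and "toric_closed \<Sigma> \<rho> Z2"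
  shows "toric_closed \<Sigma> \<rho> (Z1 \<inter> Z2)"
proof -
  obtain J1 where J1: "homogeneous_ideal \<rho> J1" "Z1 = toric_V \<Sigma> \<rho> J1" using assms(1) by (rule toric_closedE)
  obtain J2 where J2: "homogeneous_ideal \<rho> J2" "Z2 = toric_V \<Sigma> \<rho> J2" using assms(2) by (rule toric_closedE)
  obtain S1 where S1: "\<forall>f\<in>S1. \<exists>d. homogeneous_of_degree \<rho> d f" "J1 = ideal_generated S1"
    using J1(1) by (auto simp: homogeneous_ideal_def)
  obtain S2 where S2: "\<forall>f\<in>S2. \<exists>d. homogeneous_of_degree \<rho> d f" "J2 = ideal_generated S2"
    using J2(1) by (auto simp: homogeneous_ideal_def)
  define J where "J = ideal_generated (S1 \<union> S2)"
  have J: "homogeneous_ideal \<rho> J"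
    unfolding homogeneous_ideal_def J_def using S1(1) S2(1) by (intro exI[of _ "S1 \<union> S2"]) auto
  have V: "x \<in> affine_V J \<longleftrightarrow> x \<in> affine_V J1 \<and> x \<in> affine_V J2" for x
    unfolding J_def S1(2) S2(2) affine_V_ideal_generated by (auto simp: affine_V_def)
  have "c \<in> toric_V \<Sigma> \<rho> J \<longleftrightarrow> c \<in> Z1 \<inter> Z2" for c
  proof (cases "\<exists>x\<in>ss. c = orb x")
    case True
    then obtain x where "x \<in> ss" "c = orb x" by blast
    then show ?thesis
      using orb_in_toric_V_iff[OF J] orb_in_toric_V_iff[OF J1(1)] orb_in_toric_V_iff[OF J2(1)] V
      by (simp add: J1(2) J2(2))
  next
    case False
    then show ?thesis by (auto simp: J1(2) toric_V_eq)
  qed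
  then show ?thesis unfolding toric_closed_def using J by blast
qed

definition vanishing :: "('m \<Rightarrow> complex) set set \<Rightarrow> 'm mpoly set" where
  "vanishing Z = {f. \<forall>c\<in>Z. \<forall>x\<in>c. eval_poly f x = 0}"

lemma is_ideal_vanishing: "is_ideal (vanishing Z)"
  by (rule ideal.subspaceI) (auto simp: vanishing_def)

text \<open>A descending chain gives an ascending chain of vanishing ideals. Once it is constant,
  the equations of the smaller closed set also hold on the larger one.\<close>

lemma wf_toric_closed:
  "wf {(Z', Z). toric_closed \<Sigma> \<rho> Z' \<and> toric_closed \<Sigma> \<rho> Z \<and> Z' \<subset> Z}"
  unfolding wf_iff_no_infinite_down_chain
proof (rule notI, elim exE)
  fix Z assume chain: "\<forall>i. (Z (Suc i), Z i) \<in> {(Z', Z). toric_closed \<Sigma> \<rho> Z' \<and> toric_closed \<Sigma> \<rho> Z \<and> Z' \<subset> Z}"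
  have "vanishing (Z i) \<subseteq> vanishing (Z (Suc i))" for i
  proof -
    have "Z (Suc i) \<subseteq> Z i" using chain by auto
    then show ?thesis by (auto simp: vanishing_def)
  qed
  then obtain n where stab: "\<forall>i\<ge>n. vanishing (Z i) = vanishing (Z n)"
    using ideal_chain_stabilizes[of "\<lambda>i. vanishing (Z i)"] is_ideal_vanishing by blast
  have n: "vanishing (Z (Suc n)) = vanishing (Z n)" by (rule stab[rule_format]) simp
  have cl: "toric_closed \<Sigma> \<rho> (Z n)" "toric_closed \<Sigma> \<rho> (Z (Suc n))" "Z (Suc n) \<subset> Z n" using chain by auto
  obtain J where J: "homogeneous_ideal \<rho> J" "Z (Suc n) = toric_V \<Sigma> \<rho> J" using cl(2) by (rule toric_closedE)
  have "J \<subseteq> vanishing (Z (Suc n))"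
  proof
    fix f assume f: "f \<in> J"
    have "eval_poly f y = 0" if c: "c \<in> Z (Suc n)" "y \<in> c" for c y
    proof -
      obtain x where x: "x \<in> affine_V J" "c = orb x" using c(1) unfolding J(2) toric_V_eq by blast
      obtain t where "t \<in> G" "y = (\<lambda>j. t j * x j)" using c(2) unfolding x(2) mem_orb by blast
      then have "y \<in> affine_V J" using affine_V_G_invariant[OF J(1) _ x(1)] by simp
      then show ?thesis using f by (simp add: affine_V_def)
    qed
    then show "f \<in> vanishing (Z (Suc n))" by (simp add: vanishing_def)
  qed
  then have JZ: "J \<subseteq> vanishing (Z n)" using n by simp
  have "Z n \<subseteq> Z (Suc n)"
  proof
    fix c assume c: "c \<in> Z n"
    obtain x where x: "x \<in> ss" "c = orb x" using cl(1) c by (rule toric_closed_mem)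
    have "eval_poly f x = 0" if "f \<in> J" for f
      using subsetD[OF JZ that] c orb_self[of x] x(2) by (auto simp: vanishing_def)
    then have "x \<in> affine_V J" by (simp add: affine_V_def)
    then show "c \<in> Z (Suc n)" using orb_in_toric_V_iff[OF J(1) x(1)] J(2) x(2) by simp
  qed
  then show False using cl(3) by blast
qed

lemma toric_irreducible_singleton: "toric_irreducible \<Sigma> \<rho> {c}"
  by (simp add: toric_irreducible_def)

text \<open>Points are closed and irreducible, so a second point in \<open>Z\<close> would give a
  chain of length one.\<close>

lemma irreducible_zero_dimensional:
  assumes dim: "toric_dim \<Sigma> \<rho> Y = 0" and Z: "toric_closed \<Sigma> \<rho> Z" "toric_irreducible \<Sigma> \<rho> Z" "Z \<subseteq> Y"
  shows "finite Z"
proof -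
  obtain c where c: "c \<in> Z" using Z(2) by (auto simp: toric_irreducible_def)
  obtain x where x: "x \<in> ss" "c = orb x" using Z(1) c by (rule toric_closed_mem)
  have "Z = {c}"
  proof (rule ccontr)
    assume neq: "Z \<noteq> {c}"
    define C where "C i = (if i = 0 then {c} else Z)" for i :: nat
    have C: "toric_closed \<Sigma> \<rho> (C i) \<and> toric_irreducible \<Sigma> \<rho> (C i) \<and> C i \<subseteq> Y" for i
      using toric_closed_orbit[OF x(1)] x(2) Z c toric_irreducible_singleton by (auto simp: C_def)
    have "C 0 \<subset> C (Suc 0)" using neq c by (auto simp: C_def)
    then have "(1::nat) \<in> {l. \<exists>C. (\<forall>i\<le>l. toric_closed \<Sigma> \<rho> (C i) \<and> toric_irreducible \<Sigma> \<rho> (C i) \<and> C i \<subseteq> Y) \<and>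
        (\<forall>i<l. C i \<subset> C (Suc i))}"
      using C by (intro CollectI exI[of _ C]) simp
    then have "ereal (real 1) \<le> toric_dim \<Sigma> \<rho> Y" unfolding toric_dim_def by (rule SUP_upper)
    then show False using dim by simp
  qed
  then show ?thesis by simp
qed

text \<open>A reducible set is the union of two smaller closed sets, to which the induction
  applies.\<close>

lemma closed_zero_dimensional_finite:
  assumes dim: "toric_dim \<Sigma> \<rho> Y = 0"
  shows "toric_closed \<Sigma> \<rho> Z \<Longrightarrow> Z \<subseteq> Y \<Longrightarrow> finite Z"
proof (induction Z rule: wf_induct_rule[OF wf_toric_closed])
  case (1 Z)
  show ?case
  proof (cases "Z = {} \<or> toric_irreducible \<Sigma> \<rho> Z")
    case True
    then show ?thesis using irreducible_zero_dimensional[OF dim 1(2) _ 1(3)] by auto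
  next
    case False
    then obtain Z1 Z2 where Z12: "toric_closed \<Sigma> \<rho> Z1" "toric_closed \<Sigma> \<rho> Z2" "Z \<subseteq> Z1 \<union> Z2"
      "\<not> Z \<subseteq> Z1" "\<not> Z \<subseteq> Z2"
      by (auto simp: toric_irreducible_def)
    have "finite (Z \<inter> Z1)" "finite (Z \<inter> Z2)"
      using 1(1)[of "Z \<inter> Z1"] 1(1)[of "Z \<inter> Z2"] 1(2,3) Z12(4,5)
        toric_closed_Int[OF 1(2) Z12(1)] toric_closed_Int[OF 1(2) Z12(2)] by auto
    moreover have "Z = (Z \<inter> Z1) \<union> (Z \<inter> Z2)" using Z12(3) by blast
    ultimately show ?thesis by (metis finite_Un)
  qed
qed

lemma finite_toric_V:
  assumes "homogeneous_ideal \<rho> I" and "reduced_zero_dimensional \<Sigma> \<rho> I"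
  shows "finite (toric_V \<Sigma> \<rho> I)"
  using closed_zero_dimensional_finite[of "toric_V \<Sigma> \<rho> I" "toric_V \<Sigma> \<rho> I"] assms
  by (auto simp: reduced_zero_dimensional_def toric_closed_def)

end

subsection \<open>General choices of scalars\<close>

lemma eval_poly_line:
  fixes f :: "'k::finite mpoly"
  shows "\<exists>p. \<forall>t. eval_poly f (\<lambda>k. a k + t * b k) = poly p t"
proof -
  define p where "p = (\<Sum>e\<in>Poly_Mapping.keys f.
      smult (Poly_Mapping.lookup f e) (\<Prod>k\<in>UNIV. [:a k, b k:] ^ Poly_Mapping.lookup e k))"
  have "eval_poly f (\<lambda>k. a k + t * b k) = poly p t" for t
    unfolding p_def eval_poly_def by (simp add: poly_sum poly_prod poly_power)
  then show ?thesis by blast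
qed

text \<open>On the line through the two witnesses both polynomials become nonzero polynomials in one
  variable, which have finitely many roots. The line stays in the scalar space because that is a
  linear subspace.\<close>

lemma eval_poly_nonzero_common:
  fixes f g :: "'k::finite mpoly"
  assumes a: "a \<in> scalar_space K" "eval_poly f a \<noteq> 0" and b: "b \<in> scalar_space K" "eval_poly g b \<noteq> 0"
  shows "\<exists>c\<in>scalar_space K. eval_poly (f * g) c \<noteq> 0"
proof -
  define l where "l t = (\<lambda>k. a k + t * (b k - a k))" for t
  obtain p where p: "\<And>t. eval_poly f (l t) = poly p t" using eval_poly_line[of f a "\<lambda>k. b k - a k"] unfolding l_def by blast
  obtain q where q: "\<And>t. eval_poly g (l t) = poly q t" using eval_poly_line[of g a "\<lambda>k. b k - a k"] unfolding l_def by blast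
  have "l 0 = a" "l 1 = b" by (simp_all add: l_def)
  then have "poly p 0 \<noteq> 0" "poly q 1 \<noteq> 0" using a b p[of 0] q[of 1] by auto
  then have "p * q \<noteq> 0" by auto
  then have "finite {t. poly (p * q) t = 0}" by (rule poly_roots_finite)
  then obtain t where "t \<notin> {t. poly (p * q) t = 0}"
    using ex_new_if_finite[OF infinite_UNIV_char_0] by blast
  then have "eval_poly (f * g) (l t) \<noteq> 0" using p q by simp
  moreover have "l t \<in> scalar_space K" using a b by (simp add: l_def scalar_space_def)
  ultimately show ?thesis by blast
qed

text \<open>A version of \<open>for_general\<close> with principal open sets, so that intersecting
  open sets is multiplying polynomials.\<close>

definition generic :: "'k::finite set \<Rightarrow> (('k \<Rightarrow> complex) \<Rightarrow> bool) \<Rightarrow> bool" where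
  "generic K Q \<longleftrightarrow> (\<exists>h. (\<exists>\<Lambda>\<in>scalar_space K. eval_poly h \<Lambda> \<noteq> 0) \<and>
     (\<forall>\<Lambda>\<in>scalar_space K. eval_poly h \<Lambda> \<noteq> 0 \<longrightarrow> Q \<Lambda>))"

lemma generic_imp_for_general:
  assumes "generic K Q"
  shows "for_general K Q"
proof -
  obtain h where h: "\<exists>\<Lambda>\<in>scalar_space K. eval_poly h \<Lambda> \<noteq> 0"
    "\<forall>\<Lambda>\<in>scalar_space K. eval_poly h \<Lambda> \<noteq> 0 \<longrightarrow> Q \<Lambda>"
    using assms unfolding generic_def by blast
  have "zariski_open K (scalar_space K - affine_V {h})" unfolding zariski_open_def by blast
  then show ?thesis
    unfolding for_general_def using h by (intro exI[of _ "scalar_space K - affine_V {h}"]) (auto simp: affine_V_def)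
qed

lemma generic_conj:
  assumes "generic K Q" and "generic K R"
  shows "generic K (\<lambda>\<Lambda>. Q \<Lambda> \<and> R \<Lambda>)"
proof -
  obtain f a where f: "a \<in> scalar_space K" "eval_poly f a \<noteq> 0"
    "\<forall>\<Lambda>\<in>scalar_space K. eval_poly f \<Lambda> \<noteq> 0 \<longrightarrow> Q \<Lambda>"
    using assms(1) unfolding generic_def by blast
  obtain g b where g: "b \<in> scalar_space K" "eval_poly g b \<noteq> 0"
    "\<forall>\<Lambda>\<in>scalar_space K. eval_poly g \<Lambda> \<noteq> 0 \<longrightarrow> R \<Lambda>"
    using assms(2) unfolding generic_def by blast
  show ?thesis
    unfolding generic_def using eval_poly_nonzero_common[OF f(1,2) g(1,2)] f(3) g(3)
    by (intro exI[of _ "f * g"]) simp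
qed

lemma generic_True: "generic K (\<lambda>\<Lambda>. True)"
  unfolding generic_def by (intro exI[of _ 1]) (auto simp: scalar_space_def)

lemma generic_ball:
  assumes "finite A" and "\<And>i. i \<in> A \<Longrightarrow> generic K (Q i)"
  shows "generic K (\<lambda>\<Lambda>. \<forall>i\<in>A. Q i \<Lambda>)"
  using assms by (induction A rule: finite_induct) (simp_all add: generic_True generic_conj)

lemma generic_mono: "generic K Q \<Longrightarrow> (\<And>\<Lambda>. Q \<Lambda> \<Longrightarrow> R \<Lambda>) \<Longrightarrow> generic K R"
  unfolding generic_def by blast

lemma generic_coordinates_nonzero:
  fixes K :: "'k::finite set"
  shows "generic K (\<lambda>\<Lambda>. \<forall>k\<in>K. \<Lambda> k \<noteq> 0)"
proof -
  define e :: "'k \<Rightarrow> complex" where "e k = (if k \<in> K then 1 else 0)" for k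
  have "e \<in> scalar_space K" by (simp add: scalar_space_def e_def)
  moreover have "eval_poly (\<Prod>k\<in>K. var k) e \<noteq> 0" by (simp add: eval_poly_prod e_def)
  moreover have "\<forall>k\<in>K. \<Lambda> k \<noteq> 0" if "eval_poly (\<Prod>k\<in>K. var k) \<Lambda> \<noteq> 0" for \<Lambda> :: "'k \<Rightarrow> complex"
    using that by (simp add: eval_poly_prod)
  ultimately show ?thesis unfolding generic_def by blast
qed

text \<open>Agreement with a fraction is asked only where its denominator is nonzero: the functions
  in question are total, with \<open>inverse 0 = 0\<close>, and need not be rational
  elsewhere.\<close>

definition regular_at :: "('k::finite \<Rightarrow> complex) \<Rightarrow> (('k \<Rightarrow> complex) \<Rightarrow> complex) \<Rightarrow> bool" where
  "regular_at p \<phi> \<longleftrightarrow> (\<exists>g h. eval_poly h p \<noteq> 0 \<and> (\<forall>x. eval_poly h x \<noteq> 0 \<longrightarrow> \<phi> x = eval_poly g x / eval_poly h x))"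

lemma regular_at_poly: "regular_at p (eval_poly f)"
  unfolding regular_at_def by (intro exI[of _ f] exI[of _ 1]) simp

lemma regular_at_const:
  fixes p :: "'k::finite \<Rightarrow> complex"
  shows "regular_at p (\<lambda>x. c)"
proof -
  have "eval_poly (const c :: 'k mpoly) = (\<lambda>x. c)" by (rule ext) simp
  then show ?thesis using regular_at_poly[of p "const c"] by simp
qed

lemma regular_at_coordinate: "regular_at p (\<lambda>x. x k)"
proof -
  have "eval_poly (var k) = (\<lambda>x. x k)" by (rule ext) simp
  then show ?thesis using regular_at_poly[of p "var k"] by simp
qed

lemma regular_at_add:
  assumes "regular_at p \<phi>" and "regular_at p \<psi>"
  shows "regular_at p (\<lambda>x. \<phi> x + \<psi> x)"
proof -
  obtain g h where 1: "eval_poly h p \<noteq> 0" "\<forall>x. eval_poly h x \<noteq> 0 \<longrightarrow> \<phi> x = eval_poly g x / eval_poly h x"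
    using assms(1) unfolding regular_at_def by blast
  obtain g' h' where 2: "eval_poly h' p \<noteq> 0" "\<forall>x. eval_poly h' x \<noteq> 0 \<longrightarrow> \<psi> x = eval_poly g' x / eval_poly h' x"
    using assms(2) unfolding regular_at_def by blast
  show ?thesis unfolding regular_at_def
    by (intro exI[of _ "g * h' + g' * h"] exI[of _ "h * h'"]) (use 1 2 in \<open>simp add: field_simps\<close>)
qed

lemma regular_at_mult:
  assumes "regular_at p \<phi>" and "regular_at p \<psi>"
  shows "regular_at p (\<lambda>x. \<phi> x * \<psi> x)"
proof -
  obtain g h where 1: "eval_poly h p \<noteq> 0" "\<forall>x. eval_poly h x \<noteq> 0 \<longrightarrow> \<phi> x = eval_poly g x / eval_poly h x"
    using assms(1) unfolding regular_at_def by blast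
  obtain g' h' where 2: "eval_poly h' p \<noteq> 0" "\<forall>x. eval_poly h' x \<noteq> 0 \<longrightarrow> \<psi> x = eval_poly g' x / eval_poly h' x"
    using assms(2) unfolding regular_at_def by blast
  show ?thesis unfolding regular_at_def
    by (intro exI[of _ "g * g'"] exI[of _ "h * h'"]) (use 1 2 in simp)
qed

lemma regular_at_inverse:
  assumes "regular_at p \<phi>" and nz: "\<phi> p \<noteq> 0"
  shows "regular_at p (\<lambda>x. inverse (\<phi> x))"
proof -
  obtain g h where 1: "eval_poly h p \<noteq> 0" "\<forall>x. eval_poly h x \<noteq> 0 \<longrightarrow> \<phi> x = eval_poly g x / eval_poly h x"
    using assms(1) unfolding regular_at_def by blast
  have "eval_poly g p \<noteq> 0" using 1 nz by auto
  then show ?thesis unfolding regular_at_def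
    \<comment> \<open>The common factor \<open>h\<close> restricts the new fraction to points where
      the fraction for \<phi> is valid.\<close>
    by (intro exI[of _ "h * h"] exI[of _ "g * h"]) (use 1 in simp)
qed

lemma regular_at_sum: "(\<And>i. i \<in> A \<Longrightarrow> regular_at p (\<phi> i)) \<Longrightarrow> regular_at p (\<lambda>x. \<Sum>i\<in>A. \<phi> i x)"
  by (induction A rule: infinite_finite_induct) (simp_all add: regular_at_const regular_at_add)

lemma regular_at_prod: "(\<And>i. i \<in> A \<Longrightarrow> regular_at p (\<phi> i)) \<Longrightarrow> regular_at p (\<lambda>x. \<Prod>i\<in>A. \<phi> i x)"
  by (induction A rule: infinite_finite_induct) (simp_all add: regular_at_const regular_at_mult)

lemma regular_at_power: "regular_at p \<phi> \<Longrightarrow> regular_at p (\<lambda>x. \<phi> x ^ n)"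
  by (induction n) (simp_all add: regular_at_const regular_at_mult)

lemma regular_at_power_int:
  assumes "regular_at p \<phi>" and "\<phi> p \<noteq> 0"
  shows "regular_at p (\<lambda>x. \<phi> x powi n)"
  using assms by (cases "n \<ge> 0") (simp_all add: power_int_def regular_at_power regular_at_inverse)

lemma regular_at_generic_nonzero:
  assumes "regular_at p \<phi>" and "\<phi> p \<noteq> 0" and p: "p \<in> scalar_space K"
  shows "generic K (\<lambda>\<Lambda>. \<phi> \<Lambda> \<noteq> 0)"
proof -
  obtain g h where 1: "eval_poly h p \<noteq> 0" "\<forall>x. eval_poly h x \<noteq> 0 \<longrightarrow> \<phi> x = eval_poly g x / eval_poly h x"
    using assms(1) unfolding regular_at_def by blast
  have "eval_poly g p \<noteq> 0" using 1 assms(2) by auto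
  then show ?thesis unfolding generic_def
    using 1 p by (intro exI[of _ "g * h"]) auto
qed

section \<open>Solving the dehomogenizing equations on an orbit\<close>

context affine_codimension_fan
begin

lemma affine_V_LA: "y \<in> affine_V (LA \<Sigma> \<rho> \<Lambda>) \<longleftrightarrow> (\<forall>P\<in>PC. (\<Sum>j\<in>P. \<Lambda> (P, j) * y j) = 1)"
  unfolding LA_def affine_V_ideal_generated by (auto simp: affine_V_def)

lemma affine_V_LA_subset_ss: "y \<in> affine_V (LA \<Sigma> \<rho> \<Lambda>) \<Longrightarrow> y \<in> ss"
proof -
  assume y: "y \<in> affine_V (LA \<Sigma> \<rho> \<Lambda>)"
  show "y \<in> ss"
    unfolding ss_iff
  proof
    fix P assume P: "P \<in> PC"
    have one: "(\<Sum>j\<in>P. \<Lambda> (P, j) * y j) = 1" using y P unfolding affine_V_LA by blast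
    show "\<exists>j\<in>P. y j \<noteq> 0"
    proof (rule ccontr)
      assume "\<not> ?thesis"
      then have "(\<Sum>j\<in>P. \<Lambda> (P, j) * y j) = 0" by (intro sum.neutral) simp
      then show False using one by simp
    qed
  qed
qed

text \<open>On a variable of \<open>Q\<close> the coordinate of \<open>Q\<close> acts with exponent
  1, and all others that act come from predecessors of \<open>Q\<close>.\<close>

lemma G_coordinates_split:
  assumes s: "selection s" and Q: "Q \<in> PC" "j \<in> Q"
  shows "(\<Prod>P\<in>PC. \<tau> P powi rel_basis s P j) = \<tau> Q * (\<Prod>P | (P, Q) \<in> dep s. \<tau> P powi rel_basis s P j)"
proof -
  have "(\<Prod>P\<in>PC. \<tau> P powi rel_basis s P j) = (\<Prod>P\<in>insert Q {P. (P, Q) \<in> dep s}. \<tau> P powi rel_basis s P j)"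
  proof (rule prod.mono_neutral_right)
    show "insert Q {P. (P, Q) \<in> dep s} \<subseteq> PC" using Q by (auto simp: dep_def)
    show "\<forall>P\<in>PC - insert Q {P. (P, Q) \<in> dep s}. \<tau> P powi rel_basis s P j = 1"
    proof
      fix P assume "P \<in> PC - insert Q {P. (P, Q) \<in> dep s}"
      then have "rel_basis s P j = 0" using Q by (auto simp: dep_def)
      then show "\<tau> P powi rel_basis s P j = 1" by simp
    qed
  qed simp
  also have "\<dots> = \<tau> Q powi rel_basis s Q j * (\<Prod>P | (P, Q) \<in> dep s. \<tau> P powi rel_basis s P j)"
    by (rule prod.insert) (auto simp: dep_def)
  also have "\<tau> Q powi rel_basis s Q j = \<tau> Q" using rel_basis_self[OF s Q] by simp
  finally show ?thesis .
qed

text \<open>Use a selection with nonzero coordinates at \<open>y\<close>. If the earlier coordinates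
  of \<open>t\<close> are 1, then \<open>t\<close> multiplies the linear form of \<open>Q\<close> by
  \<open>t (s Q)\<close>; as both values are 1, so is \<open>t (s Q)\<close>. This holds for every
  \<Lambda>.\<close>

lemma LA_orbit_unique:
  assumes y: "y \<in> affine_V (LA \<Sigma> \<rho> \<Lambda>)" and y': "y' \<in> affine_V (LA \<Sigma> \<rho> \<Lambda>)" and orb: "y' \<in> orb y"
  shows "y' = y"
proof -
  obtain s where s: "selection s" "\<forall>P\<in>PC. y (s P) \<noteq> 0"
    using ss_selection[OF affine_V_LA_subset_ss[OF y]] by blast
  obtain t where t: "t \<in> G" "y' = (\<lambda>j. t j * y j)" using orb unfolding mem_orb by blast
  have one: "Q \<in> PC \<Longrightarrow> t (s Q) = 1" for Q
  proof (induction Q rule: wf_induct_rule[OF wf_dep[OF s(1)]])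
    case (1 Q)
    have "t j = t (s Q)" if j: "j \<in> Q" for j
    proof -
      have "(\<Prod>P | (P, Q) \<in> dep s. t (s P) powi rel_basis s P j) = 1"
        using 1(1) by (intro prod.neutral) (auto simp: dep_def)
      then show ?thesis
        using G_coordinates[OF s(1) t(1), of j] G_coordinates_split[OF s(1) 1(2) j, of "\<lambda>P. t (s P)"] by simp
    qed
    then have "(\<Sum>j\<in>Q. \<Lambda> (Q, j) * y' j) = (\<Sum>j\<in>Q. t (s Q) * (\<Lambda> (Q, j) * y j))"
      by (intro sum.cong) (simp_all add: t(2) mult_ac)
    also have "\<dots> = t (s Q) * (\<Sum>j\<in>Q. \<Lambda> (Q, j) * y j)" by (simp only: sum_distrib_left)
    finally show ?case using y y' 1(2) by (simp add: affine_V_LA)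
  qed
  have "t j = 1" for j
    using G_coordinates[OF s(1) t(1), of j] one by simp
  then show ?thesis by (simp add: t(2))
qed

text \<open>Along the order \<open>dep s\<close> the equations of \<open>LA\<close> on an orbit are triangular: the one for \<open>Q\<close> is linear
  in the coordinate \<open>\<tau> Q\<close> of the torus once the earlier coordinates are known. At the scalars \<open>\<Lambda>\<close>
  with \<open>\<Lambda> (P, s P) = 1\<close> and zero otherwise the linear coefficient is \<open>x (s Q)\<close>.\<close>

lemma generic_LA_orbit_exists:
  assumes "x \<in> ss"
  shows "generic (LA_indices \<Sigma> \<rho>) (\<lambda>\<Lambda>. \<exists>y\<in>orb x. y \<in> affine_V (LA \<Sigma> \<rho> \<Lambda>))"
proof -
  obtain s where s: "selection s" and x: "\<forall>P\<in>PC. x (s P) \<noteq> 0" using ss_selection[OF assms] by blast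
  \<comment> \<open>The recursion solves the equation of \<open>Q\<close> for its coordinate: the
    inverse of the linear coefficient, which involves only predecessors of \<open>Q\<close>.\<close>
  define F where "F \<tau> Q = (\<lambda>\<Lambda>. inverse (\<Sum>j\<in>Q. \<Lambda> (Q, j) * x j *
      (\<Prod>P | (P, Q) \<in> dep s. \<tau> P \<Lambda> powi rel_basis s P j)))"
    for \<tau> :: "'m set \<Rightarrow> ('m set \<times> 'm \<Rightarrow> complex) \<Rightarrow> complex" and Q
  define \<tau> where "\<tau> = wfrec (dep s) F"
  have \<tau>: "\<tau> Q = F \<tau> Q" for Q
  proof -
    have "\<tau> Q = F (cut \<tau> (dep s) Q) Q" unfolding \<tau>_def by (rule wfrec[OF wf_dep[OF s]])
    also have "\<dots> = F \<tau> Q"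
      unfolding F_def by (intro ext arg_cong[of _ _ inverse] sum.cong prod.cong refl arg_cong2[of _ _ _ _ "(*)"]) (simp add: cut_apply)
    finally show ?thesis .
  qed
  \<comment> \<open>This is only a witness that the open set is nonempty, so its zero entries do no
    harm; that general scalars are nonzero is a separate open condition.\<close>
  define \<Lambda>0 :: "'m set \<times> 'm \<Rightarrow> complex" where "\<Lambda>0 = (\<lambda>(P, j). if P \<in> PC \<and> j = s P then 1 else 0)"
  have \<Lambda>0: "\<Lambda>0 \<in> scalar_space (LA_indices \<Sigma> \<rho>)"
    using selectionD[OF s] by (auto simp: \<Lambda>0_def scalar_space_def LA_indices_def)
  have \<tau>0: "\<tau> Q \<Lambda>0 = inverse (x (s Q))" if Q: "Q \<in> PC" for Q
  proof -
    have "(\<Sum>j\<in>Q. \<Lambda>0 (Q, j) * x j * (\<Prod>P | (P, Q) \<in> dep s. \<tau> P \<Lambda>0 powi rel_basis s P j)) =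
        (\<Sum>j\<in>Q. if s Q = j then x j * (\<Prod>P | (P, Q) \<in> dep s. \<tau> P \<Lambda>0 powi rel_basis s P j) else 0)"
      using Q by (intro sum.cong) (auto simp: \<Lambda>0_def)
    also have "\<dots> = x (s Q) * (\<Prod>P | (P, Q) \<in> dep s. \<tau> P \<Lambda>0 powi rel_basis s P (s Q))"
      using selectionD[OF s Q] by simp
    also have "(\<Prod>P | (P, Q) \<in> dep s. \<tau> P \<Lambda>0 powi rel_basis s P (s Q)) = 1"
      using rel_basis(2)[OF s _ Q] by (intro prod.neutral) (auto simp: dep_def)
    finally show ?thesis by (subst \<tau>) (simp add: F_def)
  qed
  have reg: "Q \<in> PC \<Longrightarrow> regular_at \<Lambda>0 (\<tau> Q)" for Q
  proof (induction Q rule: wf_induct_rule[OF wf_dep[OF s]])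
    case (1 Q)
    have P: "regular_at \<Lambda>0 (\<tau> P)" "\<tau> P \<Lambda>0 \<noteq> 0" if "(P, Q) \<in> dep s" for P
      using that 1(1)[OF that] \<tau>0[of P] x by (auto simp: dep_def)
    have "F \<tau> Q \<Lambda>0 \<noteq> 0" using \<tau>0[OF 1(2)] x 1(2) \<tau>[of Q] by simp
    then have "(\<Sum>j\<in>Q. \<Lambda>0 (Q, j) * x j * (\<Prod>P | (P, Q) \<in> dep s. \<tau> P \<Lambda>0 powi rel_basis s P j)) \<noteq> 0"
      by (simp add: F_def)
    then have "regular_at \<Lambda>0 (F \<tau> Q)"
      unfolding F_def using P
      by (intro regular_at_inverse regular_at_sum regular_at_mult regular_at_prod regular_at_power_int
          regular_at_coordinate regular_at_const) auto
    then show ?case using \<tau>[of Q] by simp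
  qed
  have "generic (LA_indices \<Sigma> \<rho>) (\<lambda>\<Lambda>. \<forall>Q\<in>PC. \<tau> Q \<Lambda> \<noteq> 0)"
    using reg \<tau>0 x by (intro generic_ball regular_at_generic_nonzero[OF _ _ \<Lambda>0]) auto
  then show ?thesis
  proof (rule generic_mono)
    fix \<Lambda> assume nz: "\<forall>Q\<in>PC. \<tau> Q \<Lambda> \<noteq> 0"
    define t where "t j = (\<Prod>P\<in>PC. \<tau> P \<Lambda> powi rel_basis s P j)" for j
    have t: "t \<in> G" unfolding t_def using nz by (intro G_of_coordinates[OF s]) auto
    have "(\<Sum>j\<in>Q. \<Lambda> (Q, j) * (t j * x j)) = 1" if Q: "Q \<in> PC" for Q
    proof -
      define b where "b = (\<Sum>j\<in>Q. \<Lambda> (Q, j) * x j * (\<Prod>P | (P, Q) \<in> dep s. \<tau> P \<Lambda> powi rel_basis s P j))"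
      have tb: "\<tau> Q \<Lambda> = inverse b" by (subst \<tau>) (simp add: F_def b_def)
      have "(\<Sum>j\<in>Q. \<Lambda> (Q, j) * (t j * x j)) = \<tau> Q \<Lambda> * b"
        unfolding b_def sum_distrib_left
        by (intro sum.cong refl) (simp add: t_def G_coordinates_split[OF s Q, of _ "\<lambda>P. \<tau> P \<Lambda>"] mult_ac)
      \<comment> \<open>Since \<open>inverse 0 = 0\<close>, a nonzero coordinate already certifies
        that the linear coefficient is nonzero.\<close>
      moreover have "b \<noteq> 0" using nz Q tb by auto
      ultimately show ?thesis by (simp add: tb)
    qed
    then have "(\<lambda>j. t j * x j) \<in> affine_V (LA \<Sigma> \<rho> \<Lambda>)" unfolding affine_V_LA by simp
    moreover have "(\<lambda>j. t j * x j) \<in> orb x" unfolding mem_orb using t by (intro bexI[of _ t]) auto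
    ultimately show "\<exists>y\<in>orb x. y \<in> affine_V (LA \<Sigma> \<rho> \<Lambda>)" by blast
  qed
qed

lemma bij_betw_LA_toric_V:
  assumes I: "homogeneous_ideal \<rho> I"
    and ex: "\<forall>c\<in>toric_V \<Sigma> \<rho> I. \<exists>y\<in>c. y \<in> affine_V (LA \<Sigma> \<rho> \<Lambda>)"
  shows "bij_betw orb (affine_V I \<inter> affine_V (LA \<Sigma> \<rho> \<Lambda>)) (toric_V \<Sigma> \<rho> I)"
proof (rule bij_betw_imageI)
  show "inj_on orb (affine_V I \<inter> affine_V (LA \<Sigma> \<rho> \<Lambda>))"
  proof (rule inj_onI)
    fix y y' assume y: "y \<in> affine_V I \<inter> affine_V (LA \<Sigma> \<rho> \<Lambda>)" "y' \<in> affine_V I \<inter> affine_V (LA \<Sigma> \<rho> \<Lambda>)"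
      and "orb y = orb y'"
    then have "y' \<in> orb y" using orb_eq_iff by simp
    then show "y = y'" using LA_orbit_unique[of y \<Lambda> y'] y by simp
  qed
  show "orb ` (affine_V I \<inter> affine_V (LA \<Sigma> \<rho> \<Lambda>)) = toric_V \<Sigma> \<rho> I"
  proof (intro equalityI subsetI)
    fix c assume "c \<in> orb ` (affine_V I \<inter> affine_V (LA \<Sigma> \<rho> \<Lambda>))"
    then obtain y where y: "y \<in> affine_V I" "y \<in> affine_V (LA \<Sigma> \<rho> \<Lambda>)" "c = orb y" by blast
    then show "c \<in> toric_V \<Sigma> \<rho> I"
      using orb_in_toric_V_iff[OF I affine_V_LA_subset_ss[OF y(2)]] by simp
  next
    fix c assume c: "c \<in> toric_V \<Sigma> \<rho> I"
    then obtain x where x: "x \<in> affine_V I" "c = orb x" unfolding toric_V_eq by blast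
    obtain y where y: "y \<in> orb x" "y \<in> affine_V (LA \<Sigma> \<rho> \<Lambda>)" using ex c x(2) by blast
    obtain t where "t \<in> G" "y = (\<lambda>j. t j * x j)" using y(1) unfolding mem_orb by blast
    then have "y \<in> affine_V I" using affine_V_G_invariant[OF I _ x(1)] by simp
    moreover have "c = orb y" using y(1) orb_eq_iff x(2) by simp
    ultimately show "c \<in> orb ` (affine_V I \<inter> affine_V (LA \<Sigma> \<rho> \<Lambda>))" using y(2) by blast
  qed
qed

text \<open>Zero dimensionality enters through finiteness: only finitely many orbits have to be met
  at once, so the open conditions can be intersected.\<close>

lemma generic_card_LA:
  assumes I: "homogeneous_ideal \<rho> I" and dim: "reduced_zero_dimensional \<Sigma> \<rho> I"
  shows "generic (LA_indices \<Sigma> \<rho>) (\<lambda>\<Lambda>. (\<forall>k\<in>LA_indices \<Sigma> \<rho>. \<Lambda> k \<noteq> 0) \<and>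
    finite (toric_V \<Sigma> \<rho> I) \<and> finite (affine_V I \<inter> affine_V (LA \<Sigma> \<rho> \<Lambda>)) \<and>
    card (toric_V \<Sigma> \<rho> I) = card (affine_V I \<inter> affine_V (LA \<Sigma> \<rho> \<Lambda>)))"
proof -
  have fin: "finite (toric_V \<Sigma> \<rho> I)" using I dim by (rule finite_toric_V)
  have "generic (LA_indices \<Sigma> \<rho>) (\<lambda>\<Lambda>. \<exists>y\<in>c. y \<in> affine_V (LA \<Sigma> \<rho> \<Lambda>))" if "c \<in> toric_V \<Sigma> \<rho> I" for c
  proof -
    have "c \<in> orb ` (affine_V I \<inter> ss)" using that by (simp only: toric_V_eq)
    then obtain x where x: "x \<in> ss" "c = orb x" by blast
    show ?thesis unfolding x(2) using x(1) by (rule generic_LA_orbit_exists)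
  qed
  then have "generic (LA_indices \<Sigma> \<rho>) (\<lambda>\<Lambda>. (\<forall>k\<in>LA_indices \<Sigma> \<rho>. \<Lambda> k \<noteq> 0) \<and>
      (\<forall>c\<in>toric_V \<Sigma> \<rho> I. \<exists>y\<in>c. y \<in> affine_V (LA \<Sigma> \<rho> \<Lambda>)))"
    by (intro generic_conj generic_ball fin generic_coordinates_nonzero)
  then show ?thesis
  proof (rule generic_mono)
    fix \<Lambda> assume *: "(\<forall>k\<in>LA_indices \<Sigma> \<rho>. \<Lambda> k \<noteq> 0) \<and>
      (\<forall>c\<in>toric_V \<Sigma> \<rho> I. \<exists>y\<in>c. y \<in> affine_V (LA \<Sigma> \<rho> \<Lambda>))"
    then have bij: "bij_betw orb (affine_V I \<inter> affine_V (LA \<Sigma> \<rho> \<Lambda>)) (toric_V \<Sigma> \<rho> I)"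
      by (intro bij_betw_LA_toric_V[OF I]) simp
    show "(\<forall>k\<in>LA_indices \<Sigma> \<rho>. \<Lambda> k \<noteq> 0) \<and> finite (toric_V \<Sigma> \<rho> I) \<and>
        finite (affine_V I \<inter> affine_V (LA \<Sigma> \<rho> \<Lambda>)) \<and>
        card (toric_V \<Sigma> \<rho> I) = card (affine_V I \<inter> affine_V (LA \<Sigma> \<rho> \<Lambda>))"
      using * fin bij_betw_finite[OF bij] bij_betw_same_card[OF bij] by simp
  qed
qed

end

theorem theorem3p1:
  fixes \<Sigma> :: "(real ^ 'n) set set"
    and \<rho> :: "'m::finite \<Rightarrow> (real ^ 'n) set"
  assumes "fan \<Sigma>" and "smooth_fan \<Sigma>" and "complete_fan \<Sigma>"
    and "bij_betw \<rho> UNIV (rays \<Sigma>)"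
    and "affine_codimension_condition \<Sigma> \<rho>"
  shows "(\<forall>I :: 'm mpoly set.
            homogeneous_ideal \<rho> I \<and> reduced_zero_dimensional \<Sigma> \<rho> I \<longrightarrow>
            for_general (LA_indices \<Sigma> \<rho>) (\<lambda>\<Lambda>.
              (\<forall>k \<in> LA_indices \<Sigma> \<rho>. \<Lambda> k \<noteq> 0) \<and>
              finite (toric_V \<Sigma> \<rho> I) \<and>
              finite (affine_V I \<inter> affine_V (LA \<Sigma> \<rho> \<Lambda>)) \<and>
              card (toric_V \<Sigma> \<rho> I) = card (affine_V I \<inter> affine_V (LA \<Sigma> \<rho> \<Lambda>))))
       \<and> general_dehomogenizing_ideal \<Sigma> \<rho> (LA_indices \<Sigma> \<rho>) (LA \<Sigma> \<rho>)"
proof -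
  interpret affine_codimension_fan \<Sigma> \<rho>
    using assms by unfold_locales
  have general: "for_general (LA_indices \<Sigma> \<rho>) (\<lambda>\<Lambda>.
      (\<forall>k \<in> LA_indices \<Sigma> \<rho>. \<Lambda> k \<noteq> 0) \<and>
      finite (toric_V \<Sigma> \<rho> I) \<and>
      finite (affine_V I \<inter> affine_V (LA \<Sigma> \<rho> \<Lambda>)) \<and>
      card (toric_V \<Sigma> \<rho> I) = card (affine_V I \<inter> affine_V (LA \<Sigma> \<rho> \<Lambda>)))"
    if "homogeneous_ideal \<rho> I \<and> reduced_zero_dimensional \<Sigma> \<rho> I" for I
    using that by (intro generic_imp_for_general generic_card_LA) simp_all
  have "for_general (LA_indices \<Sigma> \<rho>) (\<lambda>\<Lambda>. dehomogenizing_ideal \<Sigma> \<rho> I (LA \<Sigma> \<rho> \<Lambda>))"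
    if "homogeneous_ideal \<rho> I \<and> reduced_zero_dimensional \<Sigma> \<rho> I" for I
  proof (rule generic_imp_for_general, rule generic_mono)
    show "generic (LA_indices \<Sigma> \<rho>) (\<lambda>\<Lambda>. (\<forall>k\<in>LA_indices \<Sigma> \<rho>. \<Lambda> k \<noteq> 0) \<and>
        finite (toric_V \<Sigma> \<rho> I) \<and> finite (affine_V I \<inter> affine_V (LA \<Sigma> \<rho> \<Lambda>)) \<and>
        card (toric_V \<Sigma> \<rho> I) = card (affine_V I \<inter> affine_V (LA \<Sigma> \<rho> \<Lambda>)))"
      using that by (intro generic_card_LA) simp_all
  next
    fix \<Lambda>
    have "is_ideal (LA \<Sigma> \<rho> \<Lambda>)" unfolding LA_def by (rule ideal.subspace_span)
    then show "(\<forall>k\<in>LA_indices \<Sigma> \<rho>. \<Lambda> k \<noteq> 0) \<and>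
        finite (toric_V \<Sigma> \<rho> I) \<and> finite (affine_V I \<inter> affine_V (LA \<Sigma> \<rho> \<Lambda>)) \<and>
        card (toric_V \<Sigma> \<rho> I) = card (affine_V I \<inter> affine_V (LA \<Sigma> \<rho> \<Lambda>)) \<Longrightarrow>
        dehomogenizing_ideal \<Sigma> \<rho> I (LA \<Sigma> \<rho> \<Lambda>)"
      by (simp add: dehomogenizing_ideal_def)
  qed
  then show ?thesis unfolding general_dehomogenizing_ideal_def using general by blast
qed

end
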